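(* Let $f_1,f_2:[0,\infty)\to\mathbb{R}$ be smooth functions with $\inf_{r\ge 0}\big(f_2(r)-f_1(r)\big)>0$, set $f(r)=f_2(r)-f_1(r)$, and let $$\Omega=\{\mathbf{x}=(x_1,x_2,x_3)\in\mathbb{R}^3:\ f_1(r)<x_3<f_2(r)\},\qquad r=\sqrt{x_1^2+x_2^2}.$$ Assume $$\max_{i=1,2}\|f_i'\|_{C(\mathbb{R}_+)}=\gamma<+\infty$$ and that $|f(r)|\le C r^{\beta}$ for all $r$, for some constants $C>0$ and $\beta\ge 0$. Let $\mathbf{u}$ (with some pressure $P$) be a smooth axisymmetric solution of the steady Navier–Stokes system $$-\Delta\mathbf{u}+(\mathbf{u}\cdot\nabla)\mathbf{u}+\nabla P=0,\qquad \nabla\cdot\mathbf{u}=0\quad\text{in }\Omega,$$ with the no-slip boundary condition $\mathbf{u}=0$ on $x_3=f_i(r)$, $i=1,2$. Then $\mathbf{u}\equiv 0$ provided one of the following holds: (a) $\beta\in[0,\tfrac12)$ and $$\lim_{R\to\infty} R^{2\beta-1}\sup_{z\in[f_1(R),f_2(R)]}|\mathbf{u}(R,z)|=0;$$ (b) $\beta\in[0,\tfrac45)$ and $$\lim_{R\to\infty}R^{5\beta-4}\int_{\Omega_R}|\nabla\mathbf{u}|^2\,d\mathbf{x}=0,$$ where $\Omega_R=\{\mathbf{x}\in\mathbb{R}^3:\ x_1^2+x_2^2<R^2,\ f_1(r)<x_3<f_2(r)\}$.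
   Context: Cylindrical coordinates: $\mathbf{x}=(r\cos\theta,r\sin\theta,z)$, $\mathbf{e}_r=(\cos\theta,\sin\theta,0)$, $\mathbf{e}_\theta=(-\sin\theta,\cos\theta,0)$, $\mathbf{e}_z=(0,0,1)$. A velocity field is axisymmetric if $\mathbf{u}=u^r(r,z)\mathbf{e}_r+u^\theta(r,z)\mathbf{e}_\theta+u^z(r,z)\mathbf{e}_z$. The notation $\mathbf{u}(R,z)$ means the value of $\mathbf{u}$ at any point with $r=R$, $x_3=z$ (independent of $\theta$ in norm).
   Formalization: The bound |f(r)| ≤ C r^β is assumed only for r ≥ 1, since at r = 0 with β > 0 it would contradict inf f > 0; "smooth solution" is read as u smooth up to the boundary of Ω, with P smooth in Ω. *)

theory Defs
  imports "HOL-Analysis.Analysis"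
begin

definition smooth_nonneg :: "(real \<Rightarrow> real) \<Rightarrow> bool" where
  "smooth_nonneg f \<longleftrightarrow> (\<exists>D :: nat \<Rightarrow> real \<Rightarrow> real. D 0 = f \<and>
      (\<forall>n. \<forall>r\<ge>0. (D n has_real_derivative D (Suc n) r) (at r within {0..})))"

definition pd :: "3 \<Rightarrow> (real^3 \<Rightarrow> real) \<Rightarrow> real^3 \<Rightarrow> real" where
  "pd i g x = deriv (\<lambda>t. g (x + t *\<^sub>R axis i 1)) 0"

fun ipd :: "3 list \<Rightarrow> (real^3 \<Rightarrow> real) \<Rightarrow> real^3 \<Rightarrow> real" where
  "ipd [] g = g"
| "ipd (i # is) g = pd i (ipd is g)"

definition smooth_on3 :: "(real^3) set \<Rightarrow> (real^3 \<Rightarrow> real) \<Rightarrow> bool" where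
  "smooth_on3 S g \<longleftrightarrow> (\<forall>is. continuous_on S (ipd is g) \<and>
      (\<forall>i. \<forall>x\<in>S. (\<lambda>t. ipd is g (x + t *\<^sub>R axis i 1)) differentiable (at 0)))"

definition smooth_upto_boundary :: "(real^3) set \<Rightarrow> (real^3 \<Rightarrow> real) \<Rightarrow> bool" where
  "smooth_upto_boundary S g \<longleftrightarrow> smooth_on3 S g \<and>
      (\<forall>is. \<exists>h. continuous_on (closure S) h \<and> (\<forall>x\<in>S. h x = ipd is g x))"

definition rad :: "real^3 \<Rightarrow> real" where
  "rad x = sqrt ((x$1)\<^sup>2 + (x$2)\<^sup>2)"

definition domain :: "(real \<Rightarrow> real) \<Rightarrow> (real \<Rightarrow> real) \<Rightarrow> (real^3) set" where
  "domain f1 f2 = {x. f1 (rad x) < x$3 \<and> x$3 < f2 (rad x)}"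

definition domain_R :: "(real \<Rightarrow> real) \<Rightarrow> (real \<Rightarrow> real) \<Rightarrow> real \<Rightarrow> (real^3) set" where
  "domain_R f1 f2 R = {x. (x$1)\<^sup>2 + (x$2)\<^sup>2 < R\<^sup>2 \<and> f1 (rad x) < x$3 \<and> x$3 < f2 (rad x)}"

definition pt :: "real \<Rightarrow> real \<Rightarrow> real \<Rightarrow> real^3" where
  "pt a b c = vector [a, b, c]"

definition e_r :: "real \<Rightarrow> real^3" where "e_r \<theta> = pt (cos \<theta>) (sin \<theta>) 0"
definition e_theta :: "real \<Rightarrow> real^3" where "e_theta \<theta> = pt (- sin \<theta>) (cos \<theta>) 0"
definition e_z :: "real^3" where "e_z = pt 0 0 1"

definition axisymmetric :: "(real^3) set \<Rightarrow> (real^3 \<Rightarrow> real^3) \<Rightarrow> bool" where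
  "axisymmetric S u \<longleftrightarrow> (\<exists>ur ut uz :: real \<Rightarrow> real \<Rightarrow> real.
     \<forall>r \<theta> z. r \<ge> 0 \<longrightarrow> pt (r * cos \<theta>) (r * sin \<theta>) z \<in> S \<longrightarrow>
        u (pt (r * cos \<theta>) (r * sin \<theta>) z) =
          ur r z *\<^sub>R e_r \<theta> + ut r z *\<^sub>R e_theta \<theta> + uz r z *\<^sub>R e_z)"

definition comp :: "(real^3 \<Rightarrow> real^3) \<Rightarrow> 3 \<Rightarrow> real^3 \<Rightarrow> real" where
  "comp u i = (\<lambda>x. u x $ i)"

definition steady_NS :: "(real^3) set \<Rightarrow> (real^3 \<Rightarrow> real^3) \<Rightarrow> (real^3 \<Rightarrow> real) \<Rightarrow> bool" where
  "steady_NS S u P \<longleftrightarrow> (\<forall>x\<in>S.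
     (\<forall>i. - (\<Sum>j\<in>UNIV. pd j (pd j (comp u i)) x)
          + (\<Sum>j\<in>UNIV. u x $ j * pd j (comp u i) x) + pd i P x = 0)
     \<and> (\<Sum>j\<in>UNIV. pd j (comp u j) x) = 0)"

definition grad_sq :: "(real^3 \<Rightarrow> real^3) \<Rightarrow> real^3 \<Rightarrow> real" where
  "grad_sq u x = (\<Sum>i\<in>UNIV. \<Sum>j\<in>UNIV. (pd j (comp u i) x)\<^sup>2)"

end

theory Submission
  imports Defs
begin

text \<open>
  Axisymmetry, incompressibility and the no-slip condition give a Stokes stream function
  \<open>Psi\<close> that vanishes on both walls: the flux through every cylinder \<open>r = const\<close> is zero because it
  vanishes on the axis.  For a radial cutoff \<open>\<Phi>(r\<^sup>2)\<close> the field
  \<open>v = \<Phi>(r\<^sup>2) u - 2 \<Phi>'(r\<^sup>2) Psi e\<^sub>3\<close> is divergence free and vanishes on the boundary.  Testing the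
  equations with \<open>v\<close> eliminates the pressure and bounds the energy
  \<open>Y(R) = \<integral>\<^bsub>\<Omega>\<^sub>R\<^esub> |\<nabla>u|\<^sup>2\<close> by integrals over an annulus \<open>R < r < R + L\<close>.  If \<open>L\<close> dominates the height
  of the domain there, the Poincare inequality on vertical segments and a Ladyzhenskaya-type estimate yield
  \<open>Y(R) \<le> K (e + L R\<^sup>-\<^sup>1\<^sup>/\<^sup>2 e\<^sup>3\<^sup>/\<^sup>2)\<close> with \<open>e = Y(R + L) - Y(R)\<close>.  Together with
  \<open>Y(R) = o(R\<^sup>4\<^sup>-\<^sup>5\<^sup>\<beta>)\<close> this forces \<open>Y(R) \<le> \<epsilon>(R) Y(2R)\<close> with \<open>\<epsilon>(R) \<rightarrow> 0\<close>, hence \<open>Y = 0\<close>.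
  Under the pointwise hypothesis the same identity, with the gradient terms absorbed,
  gives \<open>Y(R) = o(R\<^sup>4\<^sup>-\<^sup>5\<^sup>\<beta>)\<close>.
\<close>

section \<open>Integrating derivatives of zero extensions\<close>

text \<open>No divergence theorem for \<Omega> is invoked. The velocity is extended by zero, and
  every integration by parts is the fundamental theorem of calculus on coordinate lines, which may
  meet the domain in arbitrary open sets. Cylindrical coordinates are singular on the axis, so the
  profiles of the axisymmetric field are never differentiated; instead rotation equivariance is
  differentiated in Cartesian coordinates, and cutoffs depend on the polynomial r^2.

  The exponent 5\<beta> - 4 comes from scaling. With L of order R^\<beta>, one of about
  R^(1-\<beta>) annuli inside [R, 2R] has e at most of order R^(\<beta>-1) Y(2R). The superlinear
  term L R^(-1/2) e^(3/2) is then, up to constants, at most Y(2R) times the square root of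
  R^(5\<beta>-4) Y(2R). In case (a) the speed S is o(R^(1-2\<beta>)) and the height H is of order
  R^\<beta>; the dominant terms R H S^3 and H^3 S^4 of the energy bound then both scale as
  R^(4-5\<beta>).\<close>

lemma mvt_abs_bound:
  fixes G g :: "real \<Rightarrow> real"
  assumes "a < b" "continuous_on {a..b} G"
    and der: "\<And>t. a < t \<Longrightarrow> t < b \<Longrightarrow> (G has_real_derivative g t) (at t)"
    and bd: "\<And>t. a < t \<Longrightarrow> t < b \<Longrightarrow> \<bar>g t\<bar> \<le> K"
  shows "\<bar>G b - G a\<bar> \<le> K * (b - a)"
proof -
  obtain z where z: "a < z" "z < b" "G b - G a = g z * (b - a)"
    using mvt[OF assms(1,2), of "\<lambda>t. (*) (g t)"] der
    unfolding has_field_derivative_def by blast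
  then show ?thesis using bd[of z] assms(1) by (simp add: abs_mult mult_right_mono)
qed

text \<open>Walk from \<open>t\<close> towards \<open>t0\<close> up to the nearest point
  \<open>c\<close> outside \<open>U\<close>: \<open>G\<close> vanishes at \<open>c\<close>, and
  between \<open>c\<close> and \<open>t\<close> the mean value theorem applies inside
  \<open>U\<close>. Nothing is assumed about derivatives off \<open>U\<close>.\<close>

lemma bounded_deriv_off_zero_lipschitz:
  fixes G g :: "real \<Rightarrow> real"
  assumes cont: "continuous_on UNIV G" and U: "open U" and zero: "\<And>t. t \<notin> U \<Longrightarrow> G t = 0"
    and der: "\<And>t. t \<in> U \<Longrightarrow> (G has_real_derivative g t) (at t)"
    and bd: "\<And>s. s \<in> U \<Longrightarrow> s \<in> closed_segment t0 t \<Longrightarrow> \<bar>g s\<bar> \<le> K"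
    and t0: "t0 \<notin> U" and K: "0 \<le> K"
  shows "\<bar>G t\<bar> \<le> K * \<bar>t - t0\<bar>"
proof (cases "t \<in> U")
  case False
  then show ?thesis using zero K by simp
next
  case True
  define Z where "Z = closed_segment t0 t - U"
  have "compact Z" unfolding Z_def using U by (simp add: compact_diff)
  moreover have "t0 \<in> Z" using t0 by (simp add: Z_def)
  ultimately obtain c where c: "c \<in> Z" "\<And>y. y \<in> Z \<Longrightarrow> dist t c \<le> dist t y"
    using distance_attains_inf[of Z t] by (metis compact_imp_closed empty_iff)
  have cU: "c \<notin> U" and cs: "c \<in> closed_segment t0 t" using c by (auto simp: Z_def)
  have ne: "c \<noteq> t" using cU True by auto
  have sub: "closed_segment c t \<subseteq> closed_segment t0 t"
    using cs by (simp add: subset_closed_segment)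
  have inU: "y \<in> U" if y: "y \<in> closed_segment c t" "y \<noteq> c" for y
  proof (rule ccontr)
    assume "y \<notin> U"
    moreover have "y \<in> closed_segment t0 t"
      using y sub by blast
    ultimately have "dist t c \<le> dist t y" using c(2) by (simp add: Z_def)
    then show False using y by (auto simp: closed_segment_eq_real_ivl dist_real_def split: if_splits)
  qed
  have bdc: "\<bar>g y\<bar> \<le> K" if "y \<in> closed_segment c t" "y \<noteq> c" for y
    using bd[OF inU[OF that]] sub that(1) by blast
  have *: "\<bar>G t - G c\<bar> \<le> K * \<bar>t - c\<bar>"
  proof (cases "c < t")
    case True
    then show ?thesis
      using mvt_abs_bound[of c t G g K] der bdc inU continuous_on_subset[OF cont]
      by (auto simp: closed_segment_eq_real_ivl[of c t])
  next
    case False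
    then have "t < c" using ne by simp
    then show ?thesis
      using mvt_abs_bound[of t c G g K] der bdc inU continuous_on_subset[OF cont]
      by (auto simp: closed_segment_eq_real_ivl[of c t] abs_minus_commute)
  qed
  have "\<bar>t - c\<bar> \<le> \<bar>t - t0\<bar>" using cs by (auto simp: closed_segment_eq_real_ivl split: if_splits)
  then have "K * \<bar>t - c\<bar> \<le> K * \<bar>t - t0\<bar>" using K by (rule mult_left_mono)
  then show ?thesis using * zero[OF cU] by simp
qed

text \<open>Where \<open>g\<close> is nonzero the zeros of \<open>G\<close> are isolated, so they
  form a sparse and hence countable set. This is the null set to be discarded when the regularised
  derivatives below pass to the limit.\<close>

lemma countable_simple_zeros:
  fixes G g :: "real \<Rightarrow> real"
  assumes U: "open U" and der: "\<And>t. t \<in> U \<Longrightarrow> (G has_real_derivative g t) (at t)"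
    and cg: "continuous_on U g"
  shows "countable {t \<in> U. G t = 0 \<and> g t \<noteq> 0}"
proof -
  define V where "V = {t \<in> U. g t \<noteq> 0}"
  define Z where "Z = {t \<in> U. G t = 0 \<and> g t \<noteq> 0}"
  have V: "open V"
    unfolding V_def using continuous_open_preimage[OF cg U, of "- {0}"]
    by (simp add: vimage_def Int_def open_delete Compl_eq_Diff_UNIV)
  have "Z sparse_in V"
    unfolding sparse_in_open[OF V]
  proof (intro ballI)
    fix y assume "y \<in> V"
    then have y: "y \<in> U" "g y \<noteq> 0" by (auto simp: V_def)
    have ev: "\<forall>\<^sub>F t in at y. G t \<noteq> 0"
    proof (cases "G y = 0")
      case False
      have "isCont G y" using der[OF y(1)] by (rule DERIV_isCont)
      then show ?thesis using False unfolding isCont_def by (rule tendsto_imp_eventually_ne)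
    next
      case True
      have "((\<lambda>t. (G t - G y) / (t - y)) \<longlongrightarrow> g y) (at y)"
        using der[OF y(1)] unfolding has_field_derivative_iff by simp
      then have "\<forall>\<^sub>F t in at y. (G t - G y) / (t - y) \<noteq> 0"
        using y(2) by (rule tendsto_imp_eventually_ne)
      then show ?thesis using True by (auto elim: eventually_mono)
    qed
    then have "\<forall>\<^sub>F t in at y. t \<notin> Z" by (rule eventually_mono) (simp add: Z_def)
    then show "\<not> y islimpt Z" by (simp add: islimpt_iff_eventually)
  qed
  then have "countable (V \<inter> Z)" by (rule sparse_imp_countable[OF V])
  moreover have "V \<inter> Z = Z" by (auto simp: V_def Z_def)
  ultimately show ?thesis by (simp add: Z_def)
qed

lemma integrable_lborel_bounded:
  fixes h :: "'a::euclidean_space \<Rightarrow> real"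
  assumes "h \<in> borel_measurable borel" "\<And>x. \<bar>h x\<bar> \<le> K" "\<And>x. x \<notin> S \<Longrightarrow> h x = 0" "bounded S"
  shows "integrable lborel h"
proof -
  obtain c where c: "S \<subseteq> cbox (- c) c" using bounded_subset_cbox_symmetric[OF assms(4)] by blast
  show ?thesis
  proof (rule Bochner_Integration.integrable_bound[of lborel "\<lambda>x. indicator (cbox (- c) c) x * K"])
    show "integrable lborel (\<lambda>x. indicator (cbox (- c) c) x * K :: real)"
      by (intro integrable_mult_left integrable_real_indicator) (use emeasure_lborel_cbox_finite[of "- c" c] in \<open>auto simp: less_top\<close>)
    show "AE x in lborel. norm (h x) \<le> norm (indicator (cbox (- c) c) x * K)"
    proof (rule AE_I2)
      fix x
      show "norm (h x) \<le> norm (indicator (cbox (- c) c) x * K)"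
      proof (cases "x \<in> S")
        case True
        then have "x \<in> cbox (- c) c" using c by blast
        then show ?thesis using assms(2)[of x] by simp
      next
        case False then show ?thesis using assms(3) by simp
      qed
    qed
  qed (use assms(1) in simp)
qed

text \<open>The boundary of \<open>U\<close> may have positive measure, and there \<open>G\<close> is not differentiable in general, so it is replaced by
  \<open>G\<^sup>3 / (G\<^sup>2 + \<epsilon>)\<close>, which is differentiable everywhere, and \<open>\<epsilon>\<close> tends to \<open>0\<close>.\<close>

lemma integral_deriv_zero_extension:
  fixes G g :: "real \<Rightarrow> real"
  assumes cont: "continuous_on UNIV G" and U: "open U" and zero: "\<And>t. t \<notin> U \<Longrightarrow> G t = 0"
    and der: "\<And>t. t \<in> U \<Longrightarrow> (G has_real_derivative g t) (at t)"
    and cg: "continuous_on U g" and bd: "\<And>t. t \<in> U \<Longrightarrow> a \<le> t \<Longrightarrow> t \<le> b \<Longrightarrow> \<bar>g t\<bar> \<le> K"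
    and ab: "a \<le> b"
  shows "integrable lborel (\<lambda>t. indicator ({a..b} \<inter> U) t * g t)"
    and "(\<integral>t. indicator ({a..b} \<inter> U) t * g t \<partial>lborel) = G b - G a"
proof -
  define K0 where "K0 = max K 0"
  have K0: "0 \<le> K0" "\<And>t. t \<in> U \<Longrightarrow> a \<le> t \<Longrightarrow> t \<le> b \<Longrightarrow> \<bar>g t\<bar> \<le> K0"
    using bd by (auto simp: K0_def intro: order_trans[OF bd])
  define e where "e n = 1 / real (Suc n)" for n
  have e: "e n > 0" for n by (simp add: e_def)
  define h where "h n y = y^3 / (y\<^sup>2 + e n)" for n y
  define h' where "h' n y = (y^4 + 3 * e n * y\<^sup>2) / (y\<^sup>2 + e n)\<^sup>2" for n y
  have pos: "y\<^sup>2 + e n > 0" for y n using e[of n] by (simp add: add_nonneg_pos)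
  have hder: "(h n has_real_derivative h' n y) (at y)" for n y
    unfolding h_def h'_def using pos[of y n]
    by (auto intro!: derivative_eq_intros simp: field_simps power2_eq_square power3_eq_cube power4_eq_xxxx)
  \<comment> \<open>The bound 3 does not depend on \<open>n\<close>; it supplies the dominating
    function for the passage to the limit.\<close>
  have h'bd: "0 \<le> h' n y" "h' n y \<le> 3" for n y
  proof -
    show "0 \<le> h' n y" unfolding h'_def using e[of n] by simp
    have "y^4 + 3 * e n * y\<^sup>2 \<le> 3 * (y\<^sup>2 + e n)\<^sup>2"
    proof -
      have "3 * (y\<^sup>2 + e n)\<^sup>2 - (y^4 + 3 * e n * y\<^sup>2) = 2 * y^4 + 3 * e n * y\<^sup>2 + 3 * (e n)\<^sup>2"
        by (simp add: power2_eq_square power4_eq_xxxx algebra_simps)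
      also have "\<dots> \<ge> 0" using e[of n] by simp
      finally show ?thesis by simp
    qed
    then show "h' n y \<le> 3" unfolding h'_def using pos[of y n] by (simp add: divide_le_eq)
  qed
  define k where "k n t = indicator U t * (h' n (G t) * g t)" for n t
  have Gder: "((\<lambda>t. h n (G t)) has_real_derivative k n t) (at t within {a..b})"
    if t: "t \<in> {a..b}" for n t
  proof (cases "t \<in> U")
    case True
    then show ?thesis
      using has_field_derivative_at_within[OF DERIV_chain2[OF hder der[OF True]]] by (simp add: k_def)
  next
    case False
    \<comment> \<open>The cubic numerator of \<open>h\<close> turns the Lipschitz bound on
      \<open>G\<close> into a difference quotient of order |s - t|^2, so the regularised function
      has derivative 0 at every point outside \<open>U\<close>.\<close>
    have "\<bar>h n (G s)\<bar> \<le> K0 ^ 3 / e n * \<bar>s - t\<bar> ^ 3" if s: "s \<in> {a..b}" for s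
    proof -
      have "\<bar>G s\<bar> \<le> K0 * \<bar>s - t\<bar>"
        by (rule bounded_deriv_off_zero_lipschitz[OF cont U zero der K0(2) False K0(1)])
           (use s t in \<open>auto simp: closed_segment_eq_real_ivl split: if_splits\<close>)
      then have "\<bar>G s\<bar> ^ 3 \<le> (K0 * \<bar>s - t\<bar>) ^ 3" by (intro power_mono) auto
      moreover have "\<bar>h n (G s)\<bar> \<le> \<bar>G s\<bar> ^ 3 / e n"
        unfolding h_def using e[of n] pos[of "G s" n]
        by (simp add: abs_divide power_abs divide_left_mono)
      ultimately show ?thesis using e[of n]
        by (smt (verit) divide_right_mono power_mult_distrib times_divide_eq_left)
    qed
    then have b: "\<bar>(h n (G s) - h n (G t)) / (s - t)\<bar> \<le> K0 ^ 3 / e n * \<bar>s - t\<bar>\<^sup>2" if "s \<in> {a..b}" "s \<noteq> t" for s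
      using that zero[OF False]
      by (simp add: h_def[of n 0] abs_divide divide_le_eq power3_eq_cube power2_eq_square mult.assoc)
    have "((\<lambda>s. (h n (G s) - h n (G t)) / (s - t)) \<longlongrightarrow> 0) (at t within {a..b})"
    proof (rule Lim_null_comparison[where g="\<lambda>s. K0 ^ 3 / e n * \<bar>s - t\<bar>\<^sup>2"])
      show "\<forall>\<^sub>F s in at t within {a..b}. norm ((h n (G s) - h n (G t)) / (s - t)) \<le> K0 ^ 3 / e n * \<bar>s - t\<bar>\<^sup>2"
        using b by (auto simp: eventually_at intro!: exI[of _ 1])
      show "((\<lambda>s. K0 ^ 3 / e n * \<bar>s - t\<bar>\<^sup>2) \<longlongrightarrow> 0) (at t within {a..b})"
        using e[of n] by (auto intro!: tendsto_eq_intros)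
    qed
    then show ?thesis using False by (simp add: k_def has_field_derivative_iff)
  qed
  have gm: "(\<lambda>t. indicator U t * g t) \<in> borel_measurable borel"
    using borel_measurable_continuous_on_indicator[OF _ cg] U by simp
  have Gm: "G \<in> borel_measurable borel" using cont by (rule borel_measurable_continuous_onI)
  have h'm: "h' n \<in> borel_measurable borel" for n
    unfolding h'_def by measurable
  have km: "k n \<in> borel_measurable borel" for n
  proof -
    have "(\<lambda>t. h' n (G t)) \<in> borel_measurable borel"
      using measurable_compose[OF Gm h'm] .
    then have "(\<lambda>t. h' n (G t) * (indicator U t * g t)) \<in> borel_measurable borel" using gm by simp
    then show ?thesis by (simp add: k_def mult.left_commute fun_eq_iff[symmetric] cong: measurable_cong)
  qed
  have kb: "\<bar>k n t\<bar> \<le> 3 * K0" if t: "a \<le> t" "t \<le> b" for n t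
  proof (cases "t \<in> U")
    case True
    have "h' n (G t) * \<bar>g t\<bar> \<le> 3 * K0" using h'bd[of n "G t"] K0(2)[OF True t] by (intro mult_mono) auto
    then show ?thesis using True h'bd[of n "G t"] by (simp add: k_def abs_mult)
  qed (use K0 in \<open>simp add: k_def\<close>)
  let ?I = "\<lambda>t. indicator {a..b} t :: real"
  have kint: "(\<integral>t. ?I t * k n t \<partial>lborel) = h n (G b) - h n (G a)" for n
  proof -
    have "integrable lborel (\<lambda>t. ?I t * k n t)"
      by (rule integrable_lborel_bounded[where K="3 * K0" and S="{a..b}"])
         (use km kb K0(1) in \<open>auto simp: indicator_def\<close>)
    then have 1: "((\<lambda>t. ?I t * k n t) has_integral (\<integral>t. ?I t * k n t \<partial>lborel)) UNIV"
      by (rule has_integral_integral_lborel)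
    have "(k n has_integral (h n (G b) - h n (G a))) {a..b}"
      by (rule fundamental_theorem_of_calculus[OF ab])
         (auto simp: has_real_derivative_iff_has_vector_derivative[symmetric]
            intro: Gder)
    then have "((\<lambda>t. if t \<in> {a..b} then k n t else 0) has_integral (h n (G b) - h n (G a))) UNIV"
      by (subst has_integral_restrict_UNIV)
    moreover have "(\<lambda>t. if t \<in> {a..b} then k n t else 0) = (\<lambda>t. ?I t * k n t)"
      by (auto simp: indicator_def)
    ultimately show ?thesis using has_integral_unique[OF 1] by simp
  qed
  let ?f = "\<lambda>t. indicator ({a..b} \<inter> U) t * g t"
  have fm: "?f \<in> borel_measurable borel"
  proof -
    have "(\<lambda>t. ?I t * (indicator U t * g t)) \<in> borel_measurable borel" using gm by measurable
    then show ?thesis by (simp add: indicator_inter_arith mult.assoc)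
  qed
  show fi: "integrable lborel ?f"
    by (rule integrable_lborel_bounded[where K="K0" and S="{a..b}"])
       (use fm K0 in \<open>auto simp: indicator_def\<close>)
  have hlim: "(\<lambda>n. h n y) \<longlonglongrightarrow> y" for y
  proof (cases "y = 0")
    case False
    have "(\<lambda>n. y^3 / (y\<^sup>2 + e n)) \<longlonglongrightarrow> y^3 / (y\<^sup>2 + 0)"
      unfolding e_def using False by (intro tendsto_intros LIMSEQ_Suc[OF lim_1_over_n]) auto
    then show ?thesis using False by (simp add: h_def power2_eq_square power3_eq_cube)
  qed (simp add: h_def)
  have h'lim: "(\<lambda>n. h' n y) \<longlonglongrightarrow> 1" if "y \<noteq> 0" for y
  proof -
    have "(\<lambda>n. h' n y) \<longlonglongrightarrow> (y^4 + 3 * 0 * y\<^sup>2) / (y\<^sup>2 + 0)\<^sup>2"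
      unfolding h'_def e_def using that by (intro tendsto_intros LIMSEQ_Suc[OF lim_1_over_n]) auto
    then show ?thesis using that by (simp add: power2_eq_square power4_eq_xxxx)
  qed
  \<comment> \<open>At a zero of \<open>G\<close> the regularised derivative is 0 for every
    \<open>n\<close>, so its limit can differ from \<open>g\<close> only at zeros where
    \<open>g\<close> is nonzero.\<close>
  have "AE t in lborel. t \<notin> {t \<in> U. G t = 0 \<and> g t \<noteq> 0}"
    by (intro AE_not_in countable_imp_null_set_lborel countable_simple_zeros[OF U der cg])
  then have lim: "AE t in lborel. (\<lambda>n. ?I t * k n t) \<longlonglongrightarrow> ?f t"
  proof (rule AE_mp, intro AE_I2 impI)
    fix t assume t: "t \<notin> {t \<in> U. G t = 0 \<and> g t \<noteq> 0}"
    show "(\<lambda>n. ?I t * k n t) \<longlonglongrightarrow> ?f t"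
    proof (cases "t \<in> U \<and> g t \<noteq> 0")
      case True
      then have "G t \<noteq> 0" using t by auto
      then have "(\<lambda>n. ?I t * (h' n (G t) * g t)) \<longlonglongrightarrow> ?I t * (1 * g t)"
        by (intro tendsto_intros h'lim)
      then show ?thesis using True by (simp add: k_def indicator_def)
    next
      case False
      then show ?thesis by (auto simp: k_def)
    qed
  qed
  have "(\<lambda>n. \<integral>t. ?I t * k n t \<partial>lborel) \<longlonglongrightarrow> (\<integral>t. ?f t \<partial>lborel)"
  proof (rule integral_dominated_convergence[where w="\<lambda>t. ?I t * (3 * K0)"])
    show "integrable lborel (\<lambda>t. ?I t * (3 * K0))"
      by (rule integrable_lborel_bounded[where K="3 * K0" and S="{a..b}"])
         (use K0(1) in \<open>auto simp: indicator_def\<close>)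
    show "AE t in lborel. norm (?I t * k n t) \<le> ?I t * (3 * K0)" for n
      using kb K0(1) by (auto simp: indicator_def)
  qed (use fm km lim in auto)
  moreover have "(\<lambda>n. \<integral>t. ?I t * k n t \<partial>lborel) \<longlonglongrightarrow> G b - G a"
    unfolding kint by (intro tendsto_intros hlim)
  ultimately show "(\<integral>t. ?f t \<partial>lborel) = G b - G a" by (rule LIMSEQ_unique)
qed

section \<open>Coordinates and Lebesgue measure on three-dimensional space\<close>

lemma pt_nth [simp]: "pt a b c $ 1 = a" "pt a b c $ 2 = b" "pt a b c $ 3 = c"
  by (simp_all add: pt_def vector_3)

lemma vec3_eq_iff: "x = y \<longleftrightarrow> x$1 = y$1 \<and> x$2 = y$2 \<and> x$3 = (y::real^3)$3"
  by (metis (no_types) exhaust_3 vec_eq_iff)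

lemma pt_eta [simp]: "pt (x$1) (x$2) (x$3) = x"
  by (simp add: vec3_eq_iff)

lemma pt_eq_iff [simp]: "pt a b c = pt a' b' c' \<longleftrightarrow> a = a' \<and> b = b' \<and> c = c'"
  by (simp add: vec3_eq_iff)

lemma axis_nth3 [simp]:
  "axis 1 (a::real) $ (1::3) = a" "axis 1 a $ (2::3) = 0" "axis 1 a $ (3::3) = 0"
  "axis 2 a $ (1::3) = 0" "axis 2 a $ (2::3) = a" "axis 2 a $ (3::3) = 0"
  "axis 3 a $ (1::3) = 0" "axis 3 a $ (2::3) = 0" "axis 3 a $ (3::3) = a"
  by (simp_all add: axis_def)

lemma pt_add_axis:
  "pt a b c + t *\<^sub>R axis 1 1 = pt (a + t) b c"
  "pt a b c + t *\<^sub>R axis 2 1 = pt a (b + t) c"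
  "pt a b c + t *\<^sub>R axis 3 1 = pt a b (c + t)"
  by (simp_all add: vec3_eq_iff)

text \<open>The horizontal position is kept as one pair, so that Fubini for two factors integrates
  over vertical lines above points of the plane.\<close>

definition vec3 :: "(real \<times> real) \<times> real \<Rightarrow> real^3" where
  "vec3 p = pt (fst (fst p)) (snd (fst p)) (snd p)"

lemma vec3_pair [simp]: "vec3 ((a, b), c) = pt a b c" by (simp add: vec3_def)

lemma continuous_on_pt [continuous_intros]:
  assumes "continuous_on S f" "continuous_on S g" "continuous_on S h"
  shows "continuous_on S (\<lambda>x. pt (f x) (g x) (h x))"
proof -
  have eq: "(\<lambda>x. pt (f x) (g x) (h x)) = (\<lambda>x. f x *\<^sub>R axis 1 1 + g x *\<^sub>R axis 2 1 + h x *\<^sub>R axis 3 1)"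
    by (auto simp: vec3_eq_iff)
  show ?thesis unfolding eq by (intro continuous_intros assms)
qed

lemma continuous_on_vec3: "continuous_on S vec3"
  unfolding vec3_def by (intro continuous_intros)

lemma measurable_vec3 [measurable]: "vec3 \<in> borel_measurable borel"
  by (intro borel_measurable_continuous_onI continuous_on_vec3)

lemma prod_Basis_vec3: "(\<Prod>b\<in>Basis. (v::real^3) \<bullet> b) = v$1 * v$2 * v$3"
proof -
  have B: "(Basis :: (real^3) set) = (\<lambda>i. axis i 1) ` UNIV"
    by (auto simp: Basis_vec_def)
  have "inj (\<lambda>i::3. axis i (1::real))" by (auto simp: inj_def axis_eq_axis)
  then have "(\<Prod>b\<in>Basis. v \<bullet> b) = (\<Prod>i\<in>UNIV. v \<bullet> axis i 1)"
    unfolding B by (subst prod.reindex) auto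
  also have "\<dots> = (\<Prod>i\<in>UNIV. v $ i)" by (simp add: inner_axis)
  also have "\<dots> = v$1 * v$2 * v$3" unfolding UNIV_3 by simp
  finally show ?thesis .
qed

text \<open>Lebesgue measure is determined by its values on boxes, and a box pulls back to a box
  with the same side lengths.\<close>

lemma lborel_vec3: "distr lborel borel vec3 = (lborel :: (real^3) measure)"
proof (rule lborel_eqI[symmetric])
  fix l u :: "real^3" assume lu: "\<And>b. b \<in> Basis \<Longrightarrow> l \<bullet> b \<le> u \<bullet> b"
  have le: "l$i \<le> u$i" for i using lu[of "axis i 1"] by (simp add: inner_axis axis_in_Basis_iff)
  have "vec3 -` box l u = box ((l$1, l$2), l$3) ((u$1, u$2), u$3)"
  proof -
    have "\<And>p. vec3 p \<in> box l u \<longleftrightarrow> p \<in> box ((l$1, l$2), l$3) ((u$1, u$2), u$3)"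
      by (auto simp: mem_box_cart vec3_def box_prod forall_3)
    then show ?thesis by auto
  qed
  then have "emeasure (distr lborel borel vec3) (box l u) =
     emeasure lborel (box ((l$1, l$2), l$3) ((u$1, u$2), u$3))"
    by (subst emeasure_distr) auto
  also have "\<dots> = (\<Prod>b\<in>Basis. (((u$1, u$2), u$3) - ((l$1, l$2), l$3)) \<bullet> b)"
    using le by (subst emeasure_lborel_box) (auto simp: Basis_prod_def)
  also have "(\<Prod>b\<in>Basis. (((u$1, u$2), u$3) - ((l$1, l$2), l$3)) \<bullet> b) = (u$1-l$1)*(u$2-l$2)*(u$3-l$3)"
    by (simp add: Basis_prod_def prod.union_disjoint prod.reindex inj_on_def disjoint_iff)
  also have "\<dots> = (\<Prod>b\<in>Basis. (u - l) \<bullet> b)" by (simp add: prod_Basis_vec3)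
  finally show "emeasure (distr lborel borel vec3) (box l u) = (\<Prod>b\<in>Basis. (u - l) \<bullet> b)" .
qed auto

lemma integrable_vec3_iff:
  fixes h :: "real^3 \<Rightarrow> real"
  assumes "h \<in> borel_measurable borel"
  shows "integrable lborel h \<longleftrightarrow> integrable lborel (\<lambda>p. h (vec3 p))"
  by (rule integrable_distr_eq[of vec3 lborel borel h, unfolded lborel_vec3]) (use assms in simp_all)

lemma integral_vec3:
  fixes h :: "real^3 \<Rightarrow> real"
  assumes "h \<in> borel_measurable borel"
  shows "(\<integral>x. h x \<partial>lborel) = (\<integral>p. h (vec3 p) \<partial>lborel)"
  by (rule integral_distr[of vec3 lborel borel h, unfolded lborel_vec3]) (use assms in simp_all)

lemma integral_lborel_fst:
  fixes h :: "'a::euclidean_space \<times> 'b::euclidean_space \<Rightarrow> real"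
  assumes "integrable lborel h"
  shows "(\<integral>x. (\<integral>y. h (x, y) \<partial>lborel) \<partial>lborel) = (\<integral>p. h p \<partial>lborel)"
    and "integrable lborel (\<lambda>x. \<integral>y. h (x, y) \<partial>lborel)"
  using lborel_pair.integral_fst'[of h] lborel_pair.integrable_fst'[of h] assms
  by (simp_all add: lborel_prod)

lemma integral_lborel_snd:
  fixes h :: "'a::euclidean_space \<times> 'b::euclidean_space \<Rightarrow> real"
  assumes "integrable lborel h"
  shows "(\<integral>y. (\<integral>x. h (x, y) \<partial>lborel) \<partial>lborel) = (\<integral>p. h p \<partial>lborel)"
    and "integrable lborel (\<lambda>y. \<integral>x. h (x, y) \<partial>lborel)"
  using lborel_pair.integral_snd[of "\<lambda>x y. h (x,y)"] lborel_pair.integrable_snd[of "\<lambda>x y. h (x,y)"] assms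
  by (simp_all add: lborel_prod case_prod_eta)

section \<open>Partial derivatives and integration by parts\<close>

text \<open>Relational, because \<open>pd\<close> rests on \<open>deriv\<close>, whose value carries
  no information where the derivative fails to exist; here a value comes together with
  differentiability along the line.\<close>

definition has_pd :: "3 \<Rightarrow> (real^3 \<Rightarrow> real) \<Rightarrow> real \<Rightarrow> real^3 \<Rightarrow> bool" where
  "has_pd j G d x \<longleftrightarrow> ((\<lambda>t. G (x + t *\<^sub>R axis j 1)) has_real_derivative d) (at 0)"

lemma has_pd_line:
  assumes "has_pd j G d (x + t *\<^sub>R axis j 1)"
  shows "((\<lambda>t. G (x + t *\<^sub>R axis j 1)) has_real_derivative d) (at t)"
proof -
  have "(\<lambda>s. G (x + t *\<^sub>R axis j 1 + s *\<^sub>R axis j 1)) = (\<lambda>s. G (x + (s + t) *\<^sub>R axis j 1))"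
    by (simp add: algebra_simps)
  then show ?thesis
    using assms DERIV_shift[of "\<lambda>t. G (x + t *\<^sub>R axis j 1)" d 0 t] by (simp add: has_pd_def)
qed

text \<open>The line meets \<open>W\<close> in an open set of parameters, possibly with infinitely
  many components. This is the case that \<open>integral_deriv_zero_extension\<close> covers, so
  \<open>W\<close> may be any open set.\<close>

lemma integral_pd_line:
  fixes G d :: "real^3 \<Rightarrow> real"
  assumes W: "open W" and cont: "continuous_on UNIV G" and zero: "\<And>x. x \<notin> W \<Longrightarrow> G x = 0"
    and der: "\<And>x. x \<in> W \<Longrightarrow> has_pd j G (d x) x" and cd: "continuous_on W d"
    and bd: "\<And>t. a \<le> t \<Longrightarrow> t \<le> b \<Longrightarrow> x + t *\<^sub>R axis j 1 \<in> W \<Longrightarrow> \<bar>d (x + t *\<^sub>R axis j 1)\<bar> \<le> K"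
    and ab: "a \<le> b"
  shows "integrable lborel (\<lambda>t. indicator {a..b} t * (indicator W (x + t *\<^sub>R axis j 1) * d (x + t *\<^sub>R axis j 1)))"
    and "(\<integral>t. indicator {a..b} t * (indicator W (x + t *\<^sub>R axis j 1) * d (x + t *\<^sub>R axis j 1)) \<partial>lborel)
       = G (x + b *\<^sub>R axis j 1) - G (x + a *\<^sub>R axis j 1)"
proof -
  define U where "U = {t. x + t *\<^sub>R axis j 1 \<in> W}"
  have U: "open U" unfolding U_def
    using open_vimage[OF W, of "\<lambda>t. x + t *\<^sub>R axis j 1"] by (simp add: vimage_def continuous_intros)
  have c1: "continuous_on UNIV (\<lambda>t. G (x + t *\<^sub>R axis j 1))"
    by (rule continuous_on_compose2[OF cont]) (auto intro!: continuous_intros)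
  have c2: "continuous_on U (\<lambda>t. d (x + t *\<^sub>R axis j 1))"
    by (rule continuous_on_compose2[OF cd]) (auto intro!: continuous_intros simp: U_def)
  have eq: "(\<lambda>t. indicator {a..b} t * (indicator W (x + t *\<^sub>R axis j 1) * d (x + t *\<^sub>R axis j 1)))
     = (\<lambda>t. indicator ({a..b} \<inter> U) t * d (x + t *\<^sub>R axis j 1))"
    by (auto simp: U_def indicator_def)
  note * = integral_deriv_zero_extension[where G="\<lambda>t. G (x + t *\<^sub>R axis j 1)" and U=U
      and g="\<lambda>t. d (x + t *\<^sub>R axis j 1)" and a=a and b=b and K=K, OF c1 U _ _ c2 _ ab]
  show "integrable lborel (\<lambda>t. indicator {a..b} t * (indicator W (x + t *\<^sub>R axis j 1) * d (x + t *\<^sub>R axis j 1)))"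
    unfolding eq using zero der bd by (intro *) (auto simp: U_def intro: has_pd_line)
  show "(\<integral>t. indicator {a..b} t * (indicator W (x + t *\<^sub>R axis j 1) * d (x + t *\<^sub>R axis j 1)) \<partial>lborel)
       = G (x + b *\<^sub>R axis j 1) - G (x + a *\<^sub>R axis j 1)"
    unfolding eq using zero der bd by (intro *) (auto simp: U_def intro: has_pd_line)
qed

text \<open>The divergence theorem for one component. On each line in direction \<open>j\<close> the
  integral is a difference of two values of \<open>G\<close> beyond the bounded set
  \<open>W\<close>, hence zero, and Fubini collects the lines. The cases on \<open>j\<close> only
  arrange that this direction is integrated innermost.\<close>

lemma integral_pd_zero:
  fixes G d :: "real^3 \<Rightarrow> real"
  assumes W: "open W" "bounded W" and cont: "continuous_on UNIV G" and zero: "\<And>x. x \<notin> W \<Longrightarrow> G x = 0"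
    and der: "\<And>x. x \<in> W \<Longrightarrow> has_pd j G (d x) x" and cd: "continuous_on W d"
    and bd: "\<And>x. x \<in> W \<Longrightarrow> \<bar>d x\<bar> \<le> K"
  shows "integrable lborel (\<lambda>x. indicator W x * d x)"
    and "(\<integral>x. indicator W x * d x \<partial>lborel) = 0"
proof -
  let ?h = "\<lambda>x. indicator W x * d x"
  obtain B where B: "\<And>x. x \<in> W \<Longrightarrow> norm x \<le> B" using W(2) by (auto simp: bounded_iff)
  have hm [measurable]: "?h \<in> borel_measurable borel"
    using borel_measurable_continuous_on_indicator[OF _ cd] W by simp
  have hb: "\<bar>?h x\<bar> \<le> max K 0" for x using bd[of x] by (auto simp: indicator_def)
  show hi: "integrable lborel ?h"
    by (rule integrable_lborel_bounded[OF hm hb _ W(2)]) auto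
  \<comment> \<open>With base point in the plane where coordinate \<open>j\<close> is 0, the
    parameter \<open>t\<close> is that coordinate, so the line is outside \<open>W\<close> as soon
    as |t| exceeds the bound on \<open>W\<close>.\<close>
  have line: "(\<integral>t. ?h (x + t *\<^sub>R axis j 1) \<partial>lborel) = 0" if x: "x $ j = 0" for x
  proof -
    have out: "x + t *\<^sub>R axis j 1 \<notin> W" if "\<bar>t\<bar> > \<bar>B\<bar>" for t
    proof
      assume "x + t *\<^sub>R axis j 1 \<in> W"
      then have "\<bar>(x + t *\<^sub>R axis j 1) $ j\<bar> \<le> B" using B component_le_norm_cart order_trans by blast
      then show False using that x by (simp add: axis_def)
    qed
    have "(\<lambda>t. ?h (x + t *\<^sub>R axis j 1)) =
      (\<lambda>t. indicator {-(\<bar>B\<bar>+1)..\<bar>B\<bar>+1} t * (indicator W (x + t *\<^sub>R axis j 1) * d (x + t *\<^sub>R axis j 1)))"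
    proof
      fix t show "?h (x + t *\<^sub>R axis j 1) = indicator {-(\<bar>B\<bar>+1)..\<bar>B\<bar>+1} t *
          (indicator W (x + t *\<^sub>R axis j 1) * d (x + t *\<^sub>R axis j 1))"
        using out[of t] by (cases "\<bar>t\<bar> > \<bar>B\<bar>") (auto simp: indicator_def)
    qed
    then show ?thesis
      using integral_pd_line(2)[OF W(1) cont zero der cd, where x=x and a="-(\<bar>B\<bar>+1)" and b="\<bar>B\<bar>+1" and K=K]
        bd out zero by simp
  qed
  have hvi: "integrable lborel (\<lambda>p. ?h (vec3 p))" using hi integrable_vec3_iff[OF hm] by simp
  have "(\<integral>p. ?h (vec3 p) \<partial>lborel) = 0"
  proof (cases "j = 3")
    case True
    have "(\<integral>z. ?h (vec3 (q, z)) \<partial>lborel) = 0" for q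
      using line[of "vec3 (q, 0)"] True by (simp add: vec3_def pt_add_axis)
    then show ?thesis using integral_lborel_fst(1)[OF hvi] by simp
  next
    case False
    have "(\<integral>q. ?h (vec3 (q, z)) \<partial>lborel) = 0" for z
    proof -
      have qi: "integrable lborel (\<lambda>q. ?h (vec3 (q, z)))"
      proof (rule integrable_lborel_bounded[where K="max K 0" and S="cball 0 \<bar>B\<bar>"])
        have "(\<lambda>q. vec3 (q, z)) \<in> borel_measurable borel"
          unfolding vec3_def by (intro borel_measurable_continuous_onI continuous_intros)
        from measurable_compose[OF this hm]
        show "(\<lambda>q. ?h (vec3 (q, z))) \<in> borel_measurable borel" .
        fix q :: "real \<times> real" assume q: "q \<notin> cball 0 \<bar>B\<bar>"
        have "norm q \<le> norm (vec3 (q, z))"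
          by (cases q) (simp add: norm_Pair norm_vec_def L2_set_def sum_3 real_sqrt_le_iff)
        then have "vec3 (q, z) \<notin> W" using q B[of "vec3 (q, z)"] by auto
        then show "?h (vec3 (q, z)) = 0" by simp
      qed (use hb in auto)
      show ?thesis
      proof (cases "j = 1")
        case True
        have "(\<integral>a. ?h (vec3 ((a, b), z)) \<partial>lborel) = 0" for b
          using line[of "vec3 ((0, b), z)"] True by (simp add: vec3_def pt_add_axis)
        then show ?thesis using integral_lborel_snd(1)[OF qi] by simp
      next
        case F: False
        then have "j = 2" using False exhaust_3[of j] by auto
        then have "(\<integral>b. ?h (vec3 ((a, b), z)) \<partial>lborel) = 0" for a
          using line[of "vec3 ((a, 0), z)"] by (simp add: vec3_def pt_add_axis)
        then show ?thesis using integral_lborel_fst(1)[OF qi] by simp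
      qed
    qed
    then show ?thesis using integral_lborel_snd(1)[OF hvi] by simp
  qed
  then show "(\<integral>x. ?h x \<partial>lborel) = 0" using integral_vec3[OF hm] by simp
qed

section \<open>Axisymmetric flows\<close>

lemma has_pd_cong:
  assumes "open S" "x \<in> S" "\<And>y. y \<in> S \<Longrightarrow> f y = g y" "has_pd j f d x"
  shows "has_pd j g d x"
proof -
  let ?l = "\<lambda>t::real. x + t *\<^sub>R axis j 1"
  have "open (?l -` S)" by (intro open_vimage assms continuous_intros)
  moreover have "0 \<in> ?l -` S" using assms by simp
  ultimately have "\<forall>\<^sub>F t in nhds 0. t \<in> ?l -` S" by (rule eventually_nhds_in_open)
  then have "\<forall>\<^sub>F t in nhds 0. f (?l t) = g (?l t)"
    by (rule eventually_mono) (use assms(3) in auto)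
  then show ?thesis using assms(4) unfolding has_pd_def
    by (subst (asm) DERIV_cong_ev[OF refl _ refl]) auto
qed

lemma rad_nonneg [simp]: "0 \<le> rad x" by (simp add: rad_def)

lemma rad_sq: "(rad x)\<^sup>2 = (x$1)\<^sup>2 + (x$2)\<^sup>2" by (simp add: rad_def)

lemma continuous_on_rad [continuous_intros]: "continuous_on S rad"
  unfolding rad_def by (intro continuous_intros)

lemma abs_le_rad: "\<bar>x$1\<bar> \<le> rad x" "\<bar>x$2\<bar> \<le> rad x"
  by (simp_all add: rad_def real_le_rsqrt power2_abs)

lemma rad_pt [simp]: "rad (pt a b c) = sqrt (a\<^sup>2 + b\<^sup>2)" by (simp add: rad_def)

lemma norm3_sq: "(norm (x::real^3))\<^sup>2 = (x$1)\<^sup>2 + (x$2)\<^sup>2 + (x$3)\<^sup>2"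
  by (simp add: norm_vec_def L2_set_def sum_3)

lemma polar_form: "\<exists>\<theta>. x = pt (rad x * cos \<theta>) (rad x * sin \<theta>) (x$3)"
proof -
  define w where "w = Complex (x$1) (x$2)"
  have "Re w = rad x * cos (Arg w)" "Im w = rad x * sin (Arg w)"
    using rcis_cmod_Arg[of w] by (metis Re_rcis Im_rcis w_def cmod_def complex.sel rad_def)+
  then show ?thesis by (auto simp: vec3_eq_iff w_def)
qed

definition rot :: "real \<Rightarrow> real^3 \<Rightarrow> real^3" where
  "rot \<theta> x = pt (x$1 * cos \<theta> - x$2 * sin \<theta>) (x$1 * sin \<theta> + x$2 * cos \<theta>) (x$3)"

lemma rot_sq: "(a * cos \<theta> - b * sin \<theta>)\<^sup>2 + (a * sin \<theta> + b * cos \<theta>)\<^sup>2 = a\<^sup>2 + (b::real)\<^sup>2"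
proof -
  have "(sin \<theta>)\<^sup>2 + (cos \<theta>)\<^sup>2 = 1" by simp
  then show ?thesis by algebra
qed

text \<open>The chain rule needs differentiability in the horizontal plane. Existence of one partial
  derivative together with continuity of the other on a product neighbourhood provides it.\<close>

lemma has_pd_rotation:
  fixes g :: "real^3 \<Rightarrow> real"
  assumes S: "open S" "x \<in> S"
    and g1: "\<And>y. y \<in> S \<Longrightarrow> has_pd 1 g (g1 y) y" and g2: "\<And>y. y \<in> S \<Longrightarrow> has_pd 2 g (g2 y) y"
    and c: "continuous_on S g2"
  shows "((\<lambda>\<theta>. g (rot \<theta> x)) has_real_derivative (x$1 * g2 x - x$2 * g1 x)) (at 0)"
proof -
  define z where "z = x$3"
  have "open ((\<lambda>q. vec3 (q, z)) -` S)"
    unfolding vec3_def by (intro open_vimage S continuous_intros) 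
  moreover have "(x$1, x$2) \<in> (\<lambda>q. vec3 (q, z)) -` S" using S by (simp add: z_def)
  ultimately obtain X Y where XY: "open X" "open Y" "x$1 \<in> X" "x$2 \<in> Y"
      "X \<times> Y \<subseteq> (\<lambda>q. vec3 (q, z)) -` S"
    using open_prod_elim by (metis mem_Sigma_iff)
  obtain e where e: "e > 0" "ball (x$2) e \<subseteq> Y" using XY(2,4) openE by blast
  define Y' where "Y' = ball (x$2) e"
  have inS: "pt a b z \<in> S" if "a \<in> X" "b \<in> Y'" for a b
  proof -
    have "(a, b) \<in> X \<times> Y" using that e(2) by (auto simp: Y'_def)
    then show ?thesis using XY(5) by auto
  qed
  define h where "h a b = g (pt a b z)" for a b
  define fy where "fy a b = g2 (pt a b z) *\<^sub>R (id_blinfun :: real \<Rightarrow>\<^sub>L real)" for a b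
  have "((\<lambda>(a, b). h a b) has_derivative
      (\<lambda>(s, t). g1 (pt (x$1) (x$2) z) * s + blinfun_apply (fy (x$1) (x$2)) t)) (at (x$1, x$2) within X \<times> Y')"
  proof (rule has_derivative_partialsI)
    have "((\<lambda>t. g (pt 0 (x$2) z + t *\<^sub>R axis 1 1)) has_real_derivative g1 (pt (x$1) (x$2) z)) (at (x$1))"
      by (rule has_pd_line) (use g1[of "pt (x$1) (x$2) z"] S in \<open>simp add: pt_add_axis z_def\<close>)
    then show "((\<lambda>a. h a (x$2)) has_derivative (*) (g1 (pt (x$1) (x$2) z))) (at (x$1) within X)"
      by (simp add: pt_add_axis h_def has_field_derivative_def has_derivative_at_withinI)
    show "((\<lambda>b. h a b) has_derivative blinfun_apply (fy a b)) (at b within Y')"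
      if "a \<in> X" "b \<in> Y'" for a b
    proof -
      have "((\<lambda>t. g (pt a 0 z + t *\<^sub>R axis 2 1)) has_real_derivative g2 (pt a b z)) (at b)"
        by (rule has_pd_line) (use g2[OF inS[OF that]] in \<open>simp add: pt_add_axis\<close>)
      then show ?thesis
        by (simp add: pt_add_axis h_def has_field_derivative_def has_derivative_at_withinI fy_def
             scaleR_blinfun.rep_eq)
    qed
    have "continuous_on (X \<times> Y') (\<lambda>q. g2 (pt (fst q) (snd q) z))"
      by (rule continuous_on_compose2[OF c]) (use inS in \<open>auto intro!: continuous_intros\<close>)
    then have "continuous_on (X \<times> Y') (\<lambda>(a, b). fy a b)"
      unfolding fy_def case_prod_unfold by (intro continuous_intros)
    then show "continuous (at (x$1, x$2) within X \<times> Y') (\<lambda>(a, b). fy a b)"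
      using XY e(1) by (auto simp: continuous_on_eq_continuous_within Y'_def)
  qed (use e in \<open>auto simp: Y'_def\<close>)
  note raw = this
  have XYo: "open (X \<times> Y')" "(x$1, x$2) \<in> X \<times> Y'" using XY e by (auto simp: Y'_def open_Times)
  have D: "((\<lambda>(a, b). h a b) has_derivative
      (\<lambda>(s, t). g1 x * s + g2 x * t)) (at (x$1, x$2))"
    using raw unfolding at_within_open[OF XYo(2,1)]
    by (simp add: fy_def z_def scaleR_blinfun.rep_eq)
  have E: "((\<lambda>\<theta>. (x$1 * cos \<theta> - x$2 * sin \<theta>, x$1 * sin \<theta> + x$2 * cos \<theta>)) has_derivative
      (\<lambda>t. (- (x$2) * t, x$1 * t))) (at 0)"
    by (auto intro!: derivative_eq_intros)
  have "((\<lambda>\<theta>. (\<lambda>(a, b). h a b) (x$1 * cos \<theta> - x$2 * sin \<theta>, x$1 * sin \<theta> + x$2 * cos \<theta>)) has_derivative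
      (\<lambda>t. (\<lambda>(s, t). g1 x * s + g2 x * t) (- (x$2) * t, x$1 * t))) (at 0)"
    by (rule has_derivative_compose[OF E]) (use D in simp)
  moreover have "(\<lambda>t. (\<lambda>(s, t). g1 x * s + g2 x * t) (- (x$2) * t, x$1 * t)) = (*) (x$1 * g2 x - x$2 * g1 x)"
    by (auto simp: algebra_simps)
  ultimately show ?thesis
    by (simp add: has_field_derivative_def h_def rot_def z_def)
qed

section \<open>The flow, its zero extension and its symmetry\<close>

locale axi_flow =
  fixes f1 f2 :: "real \<Rightarrow> real" and u :: "real^3 \<Rightarrow> real^3" and P :: "real^3 \<Rightarrow> real"
  assumes cf: "continuous_on {0..} f1" "continuous_on {0..} f2"
    and f_less: "\<And>r. r \<ge> 0 \<Longrightarrow> f1 r < f2 r"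
    and u_smooth: "\<And>i. smooth_upto_boundary (domain f1 f2) (comp u i)"
    and u_cont: "continuous_on (closure (domain f1 f2)) u"
    and P_smooth: "smooth_on3 (domain f1 f2) P"
    and axi: "axisymmetric (domain f1 f2) u"
    and NS: "steady_NS (domain f1 f2) u P"
    and noslip1: "\<And>x. x$3 = f1 (rad x) \<Longrightarrow> u x = 0"
    and noslip2: "\<And>x. x$3 = f2 (rad x) \<Longrightarrow> u x = 0"
begin

abbreviation "Om \<equiv> domain f1 f2"
abbreviation "OmR \<equiv> domain_R f1 f2"

text \<open>Away from the closure of the domain \<open>u\<close> is arbitrary. \<open>U\<close>
  agrees with the flow inside and is continuous everywhere, so lines of integration may cross the
  walls.\<close>

definition U :: "real^3 \<Rightarrow> real^3" where "U x = (if x \<in> Om then u x else 0)"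
definition du :: "3 \<Rightarrow> 3 \<Rightarrow> real^3 \<Rightarrow> real" where "du i j = pd j (comp u i)"
definition ddu :: "3 \<Rightarrow> 3 \<Rightarrow> real^3 \<Rightarrow> real" where "ddu i j = pd j (pd j (comp u i))"

lemma continuous_f_rad: "continuous_on S (\<lambda>x. f1 (rad x))" "continuous_on S (\<lambda>x. f2 (rad x))"
  by (rule continuous_on_compose2[OF cf(1)] continuous_on_compose2[OF cf(2)];
      auto intro: continuous_intros)+

lemma open_Om: "open Om"
  unfolding domain_def
  by (intro open_Collect_conj open_Collect_less continuous_f_rad continuous_intros)

lemma closure_Om: "closure Om \<subseteq> {x. f1 (rad x) \<le> x$3 \<and> x$3 \<le> f2 (rad x)}"
proof (rule closure_minimal)
  show "closed {x. f1 (rad x) \<le> x$3 \<and> x$3 \<le> f2 (rad x)}"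
    by (intro closed_Collect_conj closed_Collect_le continuous_f_rad continuous_intros)
qed (auto simp: domain_def)

lemma OmR_eq: "0 \<le> R \<Longrightarrow> OmR R = {x \<in> Om. rad x < R}"
proof -
  assume "0 \<le> R"
  then have "rad x < R \<longleftrightarrow> (x$1)\<^sup>2 + (x$2)\<^sup>2 < R\<^sup>2" for x
    by (metis rad_sq rad_nonneg abs_of_nonneg power2_less_imp_less power_strict_mono zero_less_numeral)
  then show ?thesis by (auto simp: domain_R_def domain_def)
qed

lemma open_OmR: "open (OmR R)"
  unfolding domain_R_def
  by (intro open_Collect_conj open_Collect_less continuous_f_rad continuous_intros)

lemma bounded_Om_cyl: "bounded {x. rad x \<le> R \<and> f1 (rad x) \<le> x$3 \<and> x$3 \<le> f2 (rad x)}" (is "bounded ?S")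
proof -
  have "bounded (f1 ` {0..R})" "bounded (f2 ` {0..R})"
    by (intro compact_imp_bounded compact_continuous_image continuous_on_subset[OF cf(1)]
       continuous_on_subset[OF cf(2)]; auto)+
  then obtain a b where a: "\<And>r. r \<in> {0..R} \<Longrightarrow> \<bar>f1 r\<bar> \<le> a" and b: "\<And>r. r \<in> {0..R} \<Longrightarrow> \<bar>f2 r\<bar> \<le> b"
    unfolding bounded_iff by (metis image_eqI real_norm_def)
  have "norm x \<le> R + R + (a + b)" if "x \<in> ?S" for x
  proof -
    have "norm x \<le> \<bar>x$1\<bar> + \<bar>x$2\<bar> + \<bar>x$3\<bar>" using norm_le_l1_cart[of x] by (simp add: sum_3)
    moreover have "\<bar>f1 (rad x)\<bar> \<le> a" "\<bar>f2 (rad x)\<bar> \<le> b" using a b that by auto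
    ultimately show ?thesis using abs_le_rad[of x] that by auto
  qed
  then show ?thesis by (auto simp: bounded_iff)
qed

lemma bounded_OmR: "bounded (OmR R)"
proof -
  have "OmR R = OmR \<bar>R\<bar>" by (simp add: domain_R_def)
  also have "\<dots> \<subseteq> {x. rad x \<le> \<bar>R\<bar> \<and> f1 (rad x) \<le> x$3 \<and> x$3 \<le> f2 (rad x)}"
    by (auto simp: OmR_eq domain_def)
  finally show ?thesis using bounded_Om_cyl bounded_subset by blast
qed

lemma compact_closure_cyl: "compact (closure Om \<inter> {x. rad x \<le> R})"
  unfolding compact_eq_bounded_closed
proof
  show "bounded (closure Om \<inter> {x. rad x \<le> R})"
    by (rule bounded_subset[OF bounded_Om_cyl[of R]]) (use closure_Om in auto)
  show "closed (closure Om \<inter> {x. rad x \<le> R})"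
    by (intro closed_Int closed_closure closed_Collect_le continuous_intros)
qed

text \<open>A point of the closure outside the open domain lies on one of the two walls, where
  no-slip makes the two pieces agree.\<close>

lemma continuous_U: "continuous_on UNIV U"
proof -
  have "continuous_on (closure Om \<union> - Om) (\<lambda>x. if x \<in> Om then u x else 0)"
  proof (rule continuous_on_If[OF closed_closure _ u_cont continuous_on_const])
    show "closed (- Om)" using open_Om by (simp add: closed_Compl)
    fix x assume "x \<in> closure Om" "x \<notin> Om"
    then have "x$3 = f1 (rad x) \<or> x$3 = f2 (rad x)" using closure_Om by (force simp: domain_def)
    then show "u x = 0" using noslip1 noslip2 by auto
  qed auto
  moreover have "closure Om \<union> - Om = UNIV" using closure_subset by auto
  ultimately show ?thesis by (simp add: U_def[abs_def])
qed

lemma U_off: "x \<notin> Om \<Longrightarrow> U x = 0" and U_on: "x \<in> Om \<Longrightarrow> U x = u x"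
  by (simp_all add: U_def)

lemma smooth_pd:
  assumes "smooth_on3 S g" "x \<in> S"
  shows "has_pd j (ipd js g) (pd j (ipd js g) x) x"
  using assms unfolding smooth_on3_def has_pd_def pd_def
  by (simp add: DERIV_deriv_iff_real_differentiable)

lemma u_smooth_on: "smooth_on3 Om (comp u i)" using u_smooth[of i] by (simp add: smooth_upto_boundary_def)

lemma has_pd_u: "x \<in> Om \<Longrightarrow> has_pd j (comp u i) (du i j x) x"
  using smooth_pd[OF u_smooth_on, where x=x and js="[]" and j=j] by (simp add: du_def)

lemma has_pd_du: "x \<in> Om \<Longrightarrow> has_pd j (du i j) (ddu i j x) x"
  using smooth_pd[OF u_smooth_on, where x=x and js="[j]" and j=j] by (simp add: du_def ddu_def)

lemma has_pd_P: "x \<in> Om \<Longrightarrow> has_pd j P (pd j P x) x"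
  using smooth_pd[OF P_smooth, where x=x and js="[]" and j=j] by simp

lemma has_pd_U: "x \<in> Om \<Longrightarrow> has_pd j (\<lambda>x. U x $ i) (du i j x) x"
  by (rule has_pd_cong[OF open_Om _ _ has_pd_u]) (auto simp: U_def comp_def)

lemma continuous_du: "continuous_on Om (du i j)"
  using u_smooth_on[of i] unfolding smooth_on3_def du_def by (auto dest: spec[of _ "[j]"])

lemma continuous_ddu: "continuous_on Om (ddu i j)"
  using u_smooth_on[of i] unfolding smooth_on3_def ddu_def by (auto dest: spec[of _ "[j, j]"])

lemma continuous_P: "continuous_on Om P" and continuous_pdP: "continuous_on Om (pd j P)"
  using P_smooth unfolding smooth_on3_def by (auto dest: spec[of _ "[]"] spec[of _ "[j]"])

text \<open>Each derivative extends continuously to the closure of the domain, and the part of this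
  closure inside a cylinder is compact.\<close>

lemma bounded_ipd: "\<exists>K. \<forall>x\<in>Om. rad x \<le> R \<longrightarrow> \<bar>ipd js (comp u i) x\<bar> \<le> K"
proof -
  obtain h where h: "continuous_on (closure Om) h" "\<And>x. x \<in> Om \<Longrightarrow> h x = ipd js (comp u i) x"
    using u_smooth[of i] unfolding smooth_upto_boundary_def by blast
  have "bounded (h ` (closure Om \<inter> {x. rad x \<le> R}))"
    by (intro compact_imp_bounded compact_continuous_image compact_closure_cyl continuous_on_subset[OF h(1)]) auto
  then obtain K where K: "\<forall>x\<in>closure Om \<inter> {x. rad x \<le> R}. \<bar>h x\<bar> \<le> K" by (auto simp: bounded_iff)
  have "\<bar>ipd js (comp u i) x\<bar> \<le> K" if "x \<in> Om" "rad x \<le> R" for x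
    using K h(2)[OF that(1)] that closure_subset[of Om] by force
  then show ?thesis by blast
qed

lemma bounded_derivs:
  obtains K where "K \<ge> 0" "\<And>i j x. x \<in> Om \<Longrightarrow> rad x \<le> R \<Longrightarrow> \<bar>du i j x\<bar> \<le> K"
    "\<And>i j x. x \<in> Om \<Longrightarrow> rad x \<le> R \<Longrightarrow> \<bar>ddu i j x\<bar> \<le> K" "\<And>i x. x \<in> Om \<Longrightarrow> rad x \<le> R \<Longrightarrow> \<bar>U x $ i\<bar> \<le> K"
proof -
  have "\<forall>i js. \<exists>K. \<forall>x\<in>Om. rad x \<le> R \<longrightarrow> \<bar>ipd js (comp u i) x\<bar> \<le> K"
    using bounded_ipd by blast
  then obtain k where k: "\<And>i js x. x \<in> Om \<Longrightarrow> rad x \<le> R \<Longrightarrow> \<bar>ipd js (comp u i) x\<bar> \<le> k i js"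
    by metis
  define K where "K = (\<Sum>i\<in>UNIV. \<bar>k i []\<bar> + (\<Sum>j\<in>UNIV. \<bar>k i [j]\<bar> + \<bar>k i [j,j]\<bar>))"
  have le: "\<bar>k i []\<bar> + (\<Sum>j\<in>UNIV. \<bar>k i [j]\<bar> + \<bar>k i [j,j]\<bar>) \<le> K" for i
    unfolding K_def by (rule member_le_sum) (auto intro!: add_nonneg_nonneg sum_nonneg)
  have le1: "\<bar>k i [j]\<bar> + \<bar>k i [j,j]\<bar> \<le> (\<Sum>j\<in>UNIV. \<bar>k i [j]\<bar> + \<bar>k i [j,j]\<bar>)" for i j
    by (rule member_le_sum) auto
  have b: "k i [] \<le> K" "k i [j] \<le> K" "k i [j,j] \<le> K" for i j using le[of i] le1[of i j] by linarith+
  have "K \<ge> 0" using le[of 1] le1[of 1 1] by linarith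
  then show ?thesis
  proof (rule that)
    fix i j x assume x: "x \<in> Om" "rad x \<le> R"
    show "\<bar>du i j x\<bar> \<le> K" using k[OF x, of "[j]" i] b by (simp add: du_def) (meson order_trans)
    show "\<bar>ddu i j x\<bar> \<le> K" using k[OF x, of "[j,j]" i] b by (simp add: ddu_def) (meson order_trans)
    show "\<bar>U x $ i\<bar> \<le> K" using k[OF x, of "[]" i] b x by (simp add: U_on comp_def) (meson order_trans)
  qed
qed

lemma rot_Om: "x \<in> Om \<Longrightarrow> rot \<theta> x \<in> Om"
proof -
  have "rad (rot \<theta> x) = rad x" by (simp add: rot_def rad_def rot_sq)
  then show "x \<in> Om \<Longrightarrow> rot \<theta> x \<in> Om" by (simp add: domain_def) (simp add: rot_def)
qed

text \<open>Equivariance restates axisymmetry without the profiles \<open>ur\<close>,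
  \<open>ut\<close>, \<open>uz\<close>, for which no regularity is given; in this form it can be
  differentiated.\<close>

lemma u_rot: assumes "x \<in> Om" shows "u (rot \<theta> x) = rot \<theta> (u x)"
proof -
  obtain ur ut uz where U: "\<And>r \<theta> z. r \<ge> 0 \<Longrightarrow> pt (r * cos \<theta>) (r * sin \<theta>) z \<in> Om \<Longrightarrow>
        u (pt (r * cos \<theta>) (r * sin \<theta>) z) =
          ur r z *\<^sub>R e_r \<theta> + ut r z *\<^sub>R e_theta \<theta> + uz r z *\<^sub>R e_z"
    using axi unfolding axisymmetric_def by blast
  obtain \<alpha> where x: "x = pt (rad x * cos \<alpha>) (rad x * sin \<alpha>) (x$3)" using polar_form by blast
  have r: "rot \<theta> x = pt (rad x * cos (\<alpha> + \<theta>)) (rad x * sin (\<alpha> + \<theta>)) (x$3)"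
    by (subst (1) x) (simp add: rot_def cos_add sin_add algebra_simps)
  have "u x = ur (rad x) (x$3) *\<^sub>R e_r \<alpha> + ut (rad x) (x$3) *\<^sub>R e_theta \<alpha> + uz (rad x) (x$3) *\<^sub>R e_z"
    using U[of "rad x" \<alpha> "x$3"] x assms by simp
  moreover have "u (rot \<theta> x) = ur (rad x) (x$3) *\<^sub>R e_r (\<alpha>+\<theta>) + ut (rad x) (x$3) *\<^sub>R e_theta (\<alpha>+\<theta>) + uz (rad x) (x$3) *\<^sub>R e_z"
    using U[of "rad x" "\<alpha>+\<theta>" "x$3"] r rot_Om[OF assms, of \<theta>] by simp
  moreover have "rot \<theta> (a *\<^sub>R e_r \<alpha> + b *\<^sub>R e_theta \<alpha> + c *\<^sub>R e_z)
      = a *\<^sub>R e_r (\<alpha>+\<theta>) + b *\<^sub>R e_theta (\<alpha>+\<theta>) + c *\<^sub>R e_z" for a b c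
    by (simp add: vec3_eq_iff rot_def e_r_def e_theta_def e_z_def cos_add sin_add algebra_simps)
  ultimately show ?thesis by simp
qed

text \<open>Angular derivatives of \<open>u_rot\<close> at angle 0: the left sides come from moving
  the point, the right sides from turning the vector.\<close>

lemma rotation_identities:
  assumes x: "x \<in> Om"
  shows "x$1 * du 1 2 x - x$2 * du 1 1 x = - u x $ 2"
    and "x$1 * du 2 2 x - x$2 * du 2 1 x = u x $ 1"
    and "x$1 * du 3 2 x - x$2 * du 3 1 x = 0"
proof -
  have D: "((\<lambda>\<theta>. rot \<theta> (u x) $ i) has_real_derivative (x$1 * du i 2 x - x$2 * du i 1 x)) (at 0)" for i
    using has_pd_rotation[OF open_Om x has_pd_u has_pd_u continuous_du, of i]
    by (simp add: comp_def u_rot[OF x])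
  have "((\<lambda>\<theta>. rot \<theta> (u x) $ 1) has_real_derivative (- u x $ 2)) (at 0)"
    "((\<lambda>\<theta>. rot \<theta> (u x) $ 2) has_real_derivative (u x $ 1)) (at 0)"
    "((\<lambda>\<theta>. rot \<theta> (u x) $ 3) has_real_derivative 0) (at 0)"
    unfolding rot_def by (auto intro!: derivative_eq_intros)
  then show "x$1 * du 1 2 x - x$2 * du 1 1 x = - u x $ 2"
    and "x$1 * du 2 2 x - x$2 * du 2 1 x = u x $ 1"
    and "x$1 * du 3 2 x - x$2 * du 3 1 x = 0"
    using D DERIV_unique by blast+
qed

lemma norm_U_radial: assumes "rad x = rad y" "x$3 = y$3" shows "norm (U x) = norm (U y)"
proof (cases "x \<in> Om")
  case True
  obtain ur ut uz where U: "\<And>r \<theta> z. r \<ge> 0 \<Longrightarrow> pt (r * cos \<theta>) (r * sin \<theta>) z \<in> Om \<Longrightarrow>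
        u (pt (r * cos \<theta>) (r * sin \<theta>) z) =
          ur r z *\<^sub>R e_r \<theta> + ut r z *\<^sub>R e_theta \<theta> + uz r z *\<^sub>R e_z"
    using axi unfolding axisymmetric_def by blast
  have *: "(norm (u w))\<^sup>2 = (ur (rad w) (w$3))\<^sup>2 + (ut (rad w) (w$3))\<^sup>2 + (uz (rad w) (w$3))\<^sup>2"
    if "w \<in> Om" for w
  proof -
    obtain \<alpha> where w: "w = pt (rad w * cos \<alpha>) (rad w * sin \<alpha>) (w$3)" using polar_form by blast
    define a b where "a = ur (rad w) (w$3)" and "b = ut (rad w) (w$3)"
    have "u w = a *\<^sub>R e_r \<alpha> + b *\<^sub>R e_theta \<alpha> + uz (rad w) (w$3) *\<^sub>R e_z"
      using U[of "rad w" \<alpha> "w$3"] w that by (simp add: a_def b_def)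
    then have "(norm (u w))\<^sup>2 = (a * cos \<alpha> - b * sin \<alpha>)\<^sup>2 + (a * sin \<alpha> + b * cos \<alpha>)\<^sup>2 + (uz (rad w) (w$3))\<^sup>2"
      by (simp add: norm3_sq e_r_def e_theta_def e_z_def)
    then show ?thesis by (simp add: a_def b_def rot_sq)
  qed
  have y: "y \<in> Om" using True assms by (simp add: domain_def)
  have "(norm (u x))\<^sup>2 = (norm (u y))\<^sup>2" using *[OF True] *[OF y] assms by simp
  then show ?thesis using True y by (simp add: U_on)
next
  case False
  then have "y \<notin> Om" using assms by (simp add: domain_def)
  then show ?thesis using False by (simp add: U_off)
qed

lemma div_free: "x \<in> Om \<Longrightarrow> du 1 1 x + du 2 2 x + du 3 3 x = 0"
  using NS by (auto simp: steady_NS_def sum_3 du_def)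

lemma momentum: "x \<in> Om \<Longrightarrow> pd i P x = ddu i 1 x + ddu i 2 x + ddu i 3 x
    - (u x $ 1 * du i 1 x + u x $ 2 * du i 2 x + u x $ 3 * du i 3 x)"
proof -
  assume "x \<in> Om"
  then have "- (\<Sum>j\<in>UNIV. pd j (pd j (comp u i)) x) + (\<Sum>j\<in>UNIV. u x $ j * pd j (comp u i) x) + pd i P x = 0"
    using NS by (simp add: steady_NS_def)
  then show ?thesis unfolding sum_3 du_def ddu_def by linarith
qed

end

section \<open>The stream function\<close>

lemma pd_diff_bound:
  assumes ab: "a \<le> b"
    and der: "\<And>t. a \<le> t \<Longrightarrow> t \<le> b \<Longrightarrow> has_pd j G (d t) (x + t *\<^sub>R axis j 1)"
    and bd: "\<And>t. a \<le> t \<Longrightarrow> t \<le> b \<Longrightarrow> \<bar>d t\<bar> \<le> K"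
  shows "\<bar>G (x + b *\<^sub>R axis j 1) - G (x + a *\<^sub>R axis j 1)\<bar> \<le> K * (b - a)"
proof (cases "a = b")
  case False
  have D: "((\<lambda>t. G (x + t *\<^sub>R axis j 1)) has_real_derivative d t) (at t)" if "a \<le> t" "t \<le> b" for t
    by (rule has_pd_line[OF der[OF that]])
  have "continuous_on {a..b} (\<lambda>t. G (x + t *\<^sub>R axis j 1))"
    by (rule continuous_at_imp_continuous_on) (auto intro!: DERIV_isCont[OF D])
  then show ?thesis
    by (rule mvt_abs_bound[rotated, where g=d]) (use False ab D bd in auto)
qed simp

lemma pd_diff_bound':
  assumes der: "\<And>s. s \<in> closed_segment 0 t \<Longrightarrow> has_pd j G (d (x + s *\<^sub>R axis j 1)) (x + s *\<^sub>R axis j 1)"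
    and bd: "\<And>s. s \<in> closed_segment 0 t \<Longrightarrow> \<bar>d (x + s *\<^sub>R axis j 1)\<bar> \<le> K"
  shows "\<bar>G (x + t *\<^sub>R axis j 1) - G x\<bar> \<le> K * \<bar>t\<bar>"
proof (cases "0 \<le> t")
  case True
  then show ?thesis using pd_diff_bound[of 0 t j G "\<lambda>s. d (x + s *\<^sub>R axis j 1)" x K] der bd
    by (simp add: closed_segment_eq_real_ivl)
next
  case False
  then show ?thesis using pd_diff_bound[of t 0 j G "\<lambda>s. d (x + s *\<^sub>R axis j 1)" x K] der bd
    by (simp add: closed_segment_eq_real_ivl abs_minus_commute)
qed

text \<open>Bounded partial derivatives make \<open>G\<close> Lipschitz near \<open>x\<close>: go
  from \<open>x\<close> to \<open>y\<close> along three coordinate edges. Each edge has length at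
  most 1, so the whole path stays in \<open>cball x 3\<close>, where compactness bounds the partial
  derivatives.\<close>

lemma continuous_of_pds:
  fixes G :: "real^3 \<Rightarrow> real"
  assumes der: "\<And>j x. has_pd j G (d j x) x" and c: "\<And>j. continuous_on UNIV (d j)"
  shows "continuous_on UNIV G"
proof (rule continuous_at_imp_continuous_on, intro ballI)
  fix x :: "real^3"
  have "\<exists>K. \<forall>y\<in>cball x 3. \<bar>d j y\<bar> \<le> K" for j
  proof -
    have "bounded (d j ` cball x 3)"
      by (intro compact_imp_bounded compact_continuous_image continuous_on_subset[OF c]) auto
    then show ?thesis by (auto simp: bounded_iff)
  qed
  then obtain k where k: "\<And>j y. y \<in> cball x 3 \<Longrightarrow> \<bar>d j y\<bar> \<le> k j" by metis
  define K where "K = \<bar>k 1\<bar> + \<bar>k 2\<bar> + \<bar>k 3\<bar>"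
  have K: "\<bar>d j y\<bar> \<le> K" if "y \<in> cball x 3" for j y
    using k[OF that, of j] exhaust_3[of j] by (auto simp: K_def)
  have lip: "\<bar>G y - G x\<bar> \<le> 3 * K * norm (y - x)" if y: "y \<in> ball x 1" for y
  proof -
    have n: "\<bar>y$i - x$i\<bar> \<le> norm (y - x)" for i
      using component_le_norm_cart[of "y - x" i] by simp
    have n1: "norm (y - x) < 1" using y by (simp add: dist_norm norm_minus_commute)
    have inb: "pt (x$1 + a) (x$2 + b) (x$3 + c) \<in> cball x 3"
      if "\<bar>a\<bar> \<le> 1" "\<bar>b\<bar> \<le> 1" "\<bar>c\<bar> \<le> 1" for a b c
    proof -
      have "norm (pt (x$1 + a) (x$2 + b) (x$3 + c) - x) \<le> \<bar>a\<bar> + \<bar>b\<bar> + \<bar>c\<bar>"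
        using norm_le_l1_cart[of "pt (x$1 + a) (x$2 + b) (x$3 + c) - x"] by (simp add: sum_3)
      then show ?thesis using that by (simp add: dist_norm norm_minus_commute)
    qed
    define t where "t i = y$i - x$i" for i
    have t1: "\<bar>t i\<bar> \<le> 1" for i using n[of i] n1 by (simp add: t_def)
    have seg: "\<bar>s\<bar> \<le> 1" if "s \<in> closed_segment 0 (t i)" for s i
      using that t1[of i] by (auto simp: closed_segment_eq_real_ivl split: if_splits)
    have A: "\<bar>G (x + t 1 *\<^sub>R axis 1 1) - G x\<bar> \<le> K * \<bar>t 1\<bar>"
    proof (rule pd_diff_bound'[OF der K])
      fix s assume "s \<in> closed_segment 0 (t 1)"
      then show "x + s *\<^sub>R axis 1 1 \<in> cball x 3"
        using inb[of s 0 0] seg[of s 1] pt_add_axis(1)[of "x$1" "x$2" "x$3" s] by simp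
    qed
    have B: "\<bar>G (pt (y$1) (x$2) (x$3) + t 2 *\<^sub>R axis 2 1) - G (pt (y$1) (x$2) (x$3))\<bar> \<le> K * \<bar>t 2\<bar>"
    proof (rule pd_diff_bound'[OF der K])
      fix s assume "s \<in> closed_segment 0 (t 2)"
      then show "pt (y$1) (x$2) (x$3) + s *\<^sub>R axis 2 1 \<in> cball x 3"
        using inb[of "t 1" s 0] seg[of s 2] t1[of 1] by (simp add: pt_add_axis t_def)
    qed
    have C: "\<bar>G (pt (y$1) (y$2) (x$3) + t 3 *\<^sub>R axis 3 1) - G (pt (y$1) (y$2) (x$3))\<bar> \<le> K * \<bar>t 3\<bar>"
    proof (rule pd_diff_bound'[OF der K])
      fix s assume "s \<in> closed_segment 0 (t 3)"
      then show "pt (y$1) (y$2) (x$3) + s *\<^sub>R axis 3 1 \<in> cball x 3"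
        using inb[of "t 1" "t 2" s] seg[of s 3] t1 by (simp add: pt_add_axis t_def)
    qed
    have e1: "x + t 1 *\<^sub>R axis 1 1 = pt (y$1) (x$2) (x$3)"
      by (simp add: vec3_eq_iff t_def)
    have e2: "pt (y$1) (x$2) (x$3) + t 2 *\<^sub>R axis 2 1 = pt (y$1) (y$2) (x$3)"
      by (simp add: vec3_eq_iff t_def)
    have e3: "pt (y$1) (y$2) (x$3) + t 3 *\<^sub>R axis 3 1 = y"
      by (simp add: vec3_eq_iff t_def)
    have "K * \<bar>t i\<bar> \<le> K * norm (y - x)" for i
      using n[of i] by (intro mult_left_mono) (auto simp: t_def K_def)
    then have "K * \<bar>t 1\<bar> \<le> K * norm (y - x)" "K * \<bar>t 2\<bar> \<le> K * norm (y - x)" "K * \<bar>t 3\<bar> \<le> K * norm (y - x)"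
      by auto
    then show ?thesis using A B C unfolding e1 e2 e3 by linarith
  qed
  have "((\<lambda>y. G y - G x) \<longlongrightarrow> 0) (at x)"
  proof (rule Lim_null_comparison[where g="\<lambda>y. 3 * K * norm (y - x)"])
    show "\<forall>\<^sub>F y in at x. norm (G y - G x) \<le> 3 * K * norm (y - x)"
      unfolding eventually_at by (rule exI[of _ 1]) (use lip in \<open>auto simp: dist_commute\<close>)
    show "((\<lambda>y. 3 * K * norm (y - x)) \<longlongrightarrow> 0) (at x)"
      by (auto intro!: tendsto_eq_intros)
  qed
  then show "isCont G x" by (simp add: isCont_def LIM_zero_iff)
qed

lemma has_pd_const: "has_pd j (\<lambda>x. c) 0 x"
  by (simp add: has_pd_def)

lemma has_pd_nth: "has_pd j (\<lambda>x. x $ i) (if i = j then 1 else 0) x"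
  by (auto simp: has_pd_def axis_def intro!: derivative_eq_intros)

lemma has_pd_mult:
  "has_pd j f a x \<Longrightarrow> has_pd j g b x \<Longrightarrow> has_pd j (\<lambda>x. f x * g x) (a * g x + f x * b) x"
  unfolding has_pd_def by (auto intro!: derivative_eq_intros)

lemma has_pd_add:
  "has_pd j f a x \<Longrightarrow> has_pd j g b x \<Longrightarrow> has_pd j (\<lambda>x. f x + g x) (a + b) x"
  unfolding has_pd_def by (auto intro!: derivative_eq_intros)

lemma has_pd_diff:
  "has_pd j f a x \<Longrightarrow> has_pd j g b x \<Longrightarrow> has_pd j (\<lambda>x. f x - g x) (a - b) x"
  unfolding has_pd_def by (auto intro!: derivative_eq_intros)

lemma has_pd_compose:
  "(h has_real_derivative h') (at (f x)) \<Longrightarrow> has_pd j f a x \<Longrightarrow> has_pd j (\<lambda>x. h (f x)) (h' * a) x"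
  unfolding has_pd_def by (rule DERIV_chain2) auto

lemma has_pd_eq: "has_pd j f a x \<Longrightarrow> a = b \<Longrightarrow> has_pd j f b x" by simp

lemma integral_eq_lborel:
  fixes q :: "real \<Rightarrow> real"
  assumes "continuous_on {a..b} q"
  shows "integral {a..b} q = (\<integral>s. indicator {a..b} s * q s \<partial>lborel)"
  using set_borel_integral_eq_integral(2)[OF borel_integrable_atLeastAtMost'[OF assms]]
  by (simp add: set_lebesgue_integral_def)

context axi_flow begin

text \<open>This is r times the radial velocity. Written with Cartesian components it is continuous
  across the axis.\<close>

definition Q :: "real^3 \<Rightarrow> real" where "Q x = x$1 * U x $ 1 + x$2 * U x $ 2"

text \<open>The Stokes stream function: \<open>\<partial>\<^sub>zPsi = r u\<^sup>r\<close> and \<open>\<partial>\<^sub>rPsi = - r u\<^sup>z\<close>.\<close>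

definition Psi :: "real^3 \<Rightarrow> real" where
  "Psi x = integral {f1 (rad x)..x$3} (\<lambda>s. Q (pt (x$1) (x$2) s))"

lemma continuous_U_nth: "continuous_on S (\<lambda>x. U x $ i)"
  by (intro continuous_intros continuous_on_subset[OF continuous_U]) auto

lemma continuous_Q: "continuous_on S Q"
  unfolding Q_def[abs_def] by (intro continuous_intros continuous_U_nth)

lemma Q_off: "x \<notin> Om \<Longrightarrow> Q x = 0" by (simp add: Q_def U_off)

lemma continuous_Q_vert: "continuous_on S (\<lambda>s. Q (pt a b s))"
  by (rule continuous_on_compose2[OF continuous_Q[of UNIV]]) (auto intro!: continuous_intros)

lemma rad_pt_nth: "rad (pt (x$1) (x$2) s) = rad x" by (simp add: rad_def)

text \<open>\<open>Q\<close> vanishes below the lower wall, so the integral may start at any height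
  beneath it. A common starting height allows \<open>Psi\<close> to be compared at points with
  different radii.\<close>

lemma Psi_alt:
  assumes "c \<le> f1 (rad x)"
  shows "Psi x = integral {c..x$3} (\<lambda>s. Q (pt (x$1) (x$2) s))"
proof -
  have z: "Q (pt (x$1) (x$2) s) = 0" if "s \<le> f1 (rad x)" for s
    using that by (intro Q_off) (auto simp: domain_def rad_def)
  have z0: "integral {c..d} (\<lambda>s. Q (pt (x$1) (x$2) s)) = 0" if "d \<le> f1 (rad x)" for d
    using integral_cong[of "{c..d}" "\<lambda>s. Q (pt (x$1) (x$2) s)" "\<lambda>s. 0"] z that by auto
  show ?thesis
  proof (cases "f1 (rad x) \<le> x$3")
    case True
    have "integral {c..f1 (rad x)} (\<lambda>s. Q (pt (x$1) (x$2) s)) + integral {f1 (rad x)..x$3} (\<lambda>s. Q (pt (x$1) (x$2) s))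
      = integral {c..x$3} (\<lambda>s. Q (pt (x$1) (x$2) s))"
      by (rule Henstock_Kurzweil_Integration.integral_combine[OF assms True])
         (intro integrable_continuous_real continuous_Q_vert)
    then show ?thesis using z0 by (simp add: Psi_def)
  next
    case False
    then show ?thesis using z0[of "x$3"] by (simp add: Psi_def)
  qed
qed

lemma has_pd_Psi3: "has_pd 3 Psi (Q x) x"
proof -
  \<comment> \<open>Starting at least 2 below \<open>x$3\<close> puts this height in the interior of
    the range of integration, so the one-sided derivative is two-sided.\<close>
  define c where "c = min (f1 (rad x)) (x$3 - 2)"
  let ?q = "\<lambda>s. Q (pt (x$1) (x$2) s)"
  have eq: "Psi (x + t *\<^sub>R axis 3 1) = integral {c..x$3 + t} ?q" for t
  proof -
    have "rad (x + t *\<^sub>R axis 3 1) = rad x" by (simp add: rad_def)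
    then show ?thesis using Psi_alt[of c "x + t *\<^sub>R axis 3 1"] by (simp add: c_def)
  qed
  have "((\<lambda>s. integral {c..s} ?q) has_real_derivative ?q (x$3)) (at (x$3) within {c..x$3+1})"
    by (rule integral_has_real_derivative) (auto intro!: continuous_Q_vert simp: c_def)
  moreover have "x$3 \<in> interior {c..x$3+1}" by (simp add: c_def interior_atLeastAtMost_real)
  ultimately have "((\<lambda>s. integral {c..s} ?q) has_real_derivative ?q (x$3)) (at (x$3))"
    by (metis at_within_interior)
  then have "((\<lambda>t. integral {c..x$3 + t} ?q) has_real_derivative ?q (x$3)) (at 0)"
    using DERIV_shift[of "\<lambda>s. integral {c..s} ?q" _ 0 "x$3"] by (simp add: add.commute)
  then show ?thesis unfolding has_pd_def eq by simp
qed

text \<open>By the divergence equation and the rotation identities, \<open>\<partial>\<^sub>jQ = - \<partial>\<^sub>3(x\<^sub>j U\<^sub>3)\<close> for \<open>j = 1, 2\<close>.\<close>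

lemma has_pd_Q: assumes "x \<in> Om" "j \<noteq> 3" shows "has_pd j Q (- (x$j * du 3 3 x)) x"
proof -
  have "has_pd j Q ((if 1 = j then 1 else 0) * U x $ 1 + x$1 * du 1 j x + ((if 2 = j then 1 else 0) * U x $ 2 + x$2 * du 2 j x)) x"
    unfolding Q_def[abs_def] by (intro has_pd_add has_pd_mult has_pd_nth has_pd_U assms)
  then show ?thesis
  proof (rule has_pd_eq)
    have d: "du 3 3 x = - du 1 1 x - du 2 2 x" using div_free[OF assms(1)] by linarith
    have "j = 1 \<or> j = 2" using exhaust_3[of j] assms by auto
    then show "(if 1 = j then 1 else 0) * U x $ 1 + x$1 * du 1 j x + ((if 2 = j then 1 else 0) * U x $ 2 + x$2 * du 2 j x)
       = - (x$j * du 3 3 x)"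
      using rotation_identities[OF assms(1)] unfolding d U_on[OF assms(1)]
      by (auto simp: algebra_simps)
  qed
qed

text \<open>The walls move with the horizontal point and the derivative of \<open>Q\<close> may jump
  there, so differentiation under the integral is avoided. Instead y_j \<partial>_3 U_3 is
  integrated over a vertical rectangle in both orders: along \<open>j\<close> it gives increments of
  \<open>-Q\<close> by \<open>has_pd_Q\<close>, and vertically it gives y_j U_3 at the top, since
  the bottom is outside the domain.\<close>

lemma Psi_diff:
  assumes j: "j \<noteq> 3" and ab: "a \<le> b"
  shows "Psi (x + b *\<^sub>R axis j 1) - Psi (x + a *\<^sub>R axis j 1) =
    - (\<integral>t. indicator {a..b} t * ((x + t *\<^sub>R axis j 1) $ j * U (x + t *\<^sub>R axis j 1) $ 3) \<partial>lborel)"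
proof -
  define T where "T y = y$j * U y $ 3" for y
  define y0 where "y0 = pt (x$1) (x$2) 0"
  define p where "p t s = y0 + t *\<^sub>R axis j 1 + s *\<^sub>R axis 3 1" for t s
  define R where "R = (SUP t\<in>{a..b}. rad (p t 0))"
  have pj3: "axis j 1 $ 3 = (0::real)" using j by (simp add: axis_def)
  have pnth: "p t s = pt (p t 0 $ 1) (p t 0 $ 2) s" "p t s $ 3 = s" for t s
    using pj3 by (simp_all add: p_def y0_def vec3_eq_iff)
  have px: "x + t *\<^sub>R axis j 1 = p t (x$3)" for t
    using pj3 by (simp add: p_def y0_def vec3_eq_iff)
  have radp: "rad (p t s) = rad (p t 0)" for t s
    by (metis pnth(1) rad_pt_nth)
  have cp: "continuous_on S (\<lambda>t. p t s)" for S s unfolding p_def by (intro continuous_intros)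
  have crad: "continuous_on S (\<lambda>t. rad (p t 0))" for S
    by (rule continuous_on_compose2[OF continuous_on_rad[of UNIV] cp]) auto
  have "compact ((\<lambda>t. rad (p t 0)) ` {a..b})"
    by (intro compact_continuous_image crad) auto
  then have "bdd_above ((\<lambda>t. rad (p t 0)) ` {a..b})" by (intro bounded_imp_bdd_above compact_imp_bounded)
  then have R: "rad (p t s) \<le> R" if "a \<le> t" "t \<le> b" for t s
    unfolding R_def radp[of t s] using that by (intro cSUP_upper) auto
  have "compact ((\<lambda>t. f1 (rad (p t 0))) ` {a..b})"
    by (intro compact_continuous_image continuous_on_compose2[OF cf(1) crad]) auto
  \<comment> \<open>A lower bound for the lower wall along the whole segment provides one rectangle
    that serves for all \<open>t\<close>.\<close>
  then obtain c0 where c0: "\<And>t. a \<le> t \<Longrightarrow> t \<le> b \<Longrightarrow> c0 \<le> f1 (rad (p t 0))"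
    using compact_imp_bounded bounded_imp_bdd_below
    by (metis (no_types, lifting) atLeastAtMost_iff bdd_below.E imageI)
  define z where "z = x$3"
  define c where "c = min c0 z"
  have cz: "c \<le> z" by (simp add: c_def)
  have cf1: "c \<le> f1 (rad (p t s))" if "a \<le> t" "t \<le> b" for t s
    using c0[OF that] radp[of t s] by (simp add: c_def)
  obtain K where K: "K \<ge> 0" "\<And>i j x. x \<in> Om \<Longrightarrow> rad x \<le> R \<Longrightarrow> \<bar>du i j x\<bar> \<le> K"
    using bounded_derivs by metis
  have "R \<ge> 0" using R[of a 0] ab rad_nonneg[of "p a 0"] by linarith
  define D where "D y = y$j * du 3 3 y" for y
  have Db: "\<bar>D y\<bar> \<le> R * K" if "y \<in> Om" "rad y \<le> R" for y
  proof -
    have "\<bar>y$j\<bar> \<le> rad y" using exhaust_3[of j] j abs_le_rad[of y] by auto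
    then show ?thesis unfolding D_def abs_mult using that K \<open>R \<ge> 0\<close> by (intro mult_mono) auto
  qed
  have cD: "continuous_on Om D" unfolding D_def by (intro continuous_intros continuous_du)
  have cD': "continuous_on Om (\<lambda>y. - D y)" by (intro continuous_intros cD)
  have cT: "continuous_on UNIV T" unfolding T_def by (intro continuous_intros continuous_U_nth)
  have dT: "has_pd 3 T (D y) y" if "y \<in> Om" for y
    unfolding T_def D_def
    by (rule has_pd_eq[OF has_pd_mult[OF has_pd_nth has_pd_U[OF that]]]) (use j in auto)
  have dQ: "has_pd j Q (- D y) y" if "y \<in> Om" for y unfolding D_def using has_pd_Q[OF that j] .
  define H where "H q = indicator {c..z} (fst q) * (indicator {a..b} (snd q) * (indicator Om (p (snd q) (fst q)) * D (p (snd q) (fst q))))"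
    for q :: "real \<times> real"
  have Hm: "H \<in> borel_measurable borel"
  proof -
    have 1: "(\<lambda>y. indicator Om y * D y) \<in> borel_measurable borel"
      using borel_measurable_continuous_on_indicator[OF _ cD] open_Om by simp
    have "(\<lambda>q::real\<times>real. p (snd q) (fst q)) \<in> borel_measurable borel"
      unfolding p_def by (intro borel_measurable_continuous_onI continuous_intros)
    from measurable_compose[OF this 1]
    have 2: "(\<lambda>q. indicator Om (p (snd q) (fst q)) * D (p (snd q) (fst q))) \<in> borel_measurable borel" .
    have "(\<lambda>q::real\<times>real. indicator ({c..z} \<times> {a..b}) q :: real) \<in> borel_measurable borel"
      by (intro borel_measurable_indicator borel_closed closed_Times) auto
    from borel_measurable_times[OF this 2] show ?thesis
      by (rule back_subst[of "\<lambda>f. f \<in> borel_measurable borel"]) (auto simp: H_def indicator_def)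
  qed
  have Hi: "integrable lborel H"
  proof (rule integrable_lborel_bounded[OF Hm, where K="R * K" and S="{c..z} \<times> {a..b}"])
    fix q :: "real \<times> real"
    show "\<bar>H q\<bar> \<le> R * K"
      using Db[of "p (snd q) (fst q)"] R[of "snd q" "fst q"] K(1) \<open>R \<ge> 0\<close> by (auto simp: H_def indicator_def)
    show "q \<notin> {c..z} \<times> {a..b} \<Longrightarrow> H q = 0" by (cases q) (auto simp: H_def indicator_def)
  qed (auto intro: bounded_Times)
  have PsiQ: "Psi (x + t *\<^sub>R axis j 1) = (\<integral>s. indicator {c..z} s * Q (p t s) \<partial>lborel)"
    if "a \<le> t" "t \<le> b" for t
  proof -
    have "Psi (p t z) = integral {c..z} (\<lambda>s. Q (pt (p t z $ 1) (p t z $ 2) s))"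
      using Psi_alt[OF cf1[OF that, of z]] pnth(2)[of t z] by simp
    also have "(\<lambda>s. Q (pt (p t z $ 1) (p t z $ 2) s)) = (\<lambda>s. Q (p t s))"
      using pnth(1) by (metis pt_nth(1,2))
    also have "integral {c..z} (\<lambda>s. Q (p t s)) = (\<integral>s. indicator {c..z} s * Q (p t s) \<partial>lborel)"
    proof (rule integral_eq_lborel)
      show "continuous_on {c..z} (\<lambda>s. Q (p t s))"
        by (rule continuous_on_compose2[OF continuous_Q[of UNIV]]) (auto simp: p_def intro!: continuous_intros)
    qed
    finally show ?thesis by (simp add: px z_def)
  qed
  have Qi: "integrable lborel (\<lambda>s. indicator {c..z} s * Q (p t s))" for t
  proof -
    have "continuous_on {c..z} (\<lambda>s. Q (p t s))"
      by (rule continuous_on_compose2[OF continuous_Q[of UNIV]]) (auto simp: p_def intro!: continuous_intros)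
    from borel_integrable_atLeastAtMost'[OF this] show ?thesis by (simp add: set_integrable_def)
  qed
  have inner: "(\<integral>t. H (s, t) \<partial>lborel) = indicator {c..z} s * (- (Q (p b s) - Q (p a s)))" for s
  proof -
    have "(\<integral>t. indicator {a..b} t * (indicator Om (y0 + s *\<^sub>R axis 3 1 + t *\<^sub>R axis j 1) * - D (y0 + s *\<^sub>R axis 3 1 + t *\<^sub>R axis j 1)) \<partial>lborel)
      = Q (y0 + s *\<^sub>R axis 3 1 + b *\<^sub>R axis j 1) - Q (y0 + s *\<^sub>R axis 3 1 + a *\<^sub>R axis j 1)"
    proof (rule integral_pd_line(2)[OF open_Om continuous_Q Q_off dQ cD' _ ab])
      fix t assume t: "a \<le> t" "t \<le> b" "y0 + s *\<^sub>R axis 3 1 + t *\<^sub>R axis j 1 \<in> Om"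
      show "\<bar>- D (y0 + s *\<^sub>R axis 3 1 + t *\<^sub>R axis j 1)\<bar> \<le> R * K"
        using Db[OF t(3)] R[OF t(1,2), of s] by (simp add: p_def add_ac)
    qed
    then have "(\<integral>t. indicator {a..b} t * (indicator Om (p t s) * D (p t s)) \<partial>lborel) = - (Q (p b s) - Q (p a s))"
      by (simp add: p_def add_ac)
    then show ?thesis by (simp add: H_def)
  qed
  have outer: "(\<integral>s. H (s, t) \<partial>lborel) = indicator {a..b} t * T (p t z)" for t
  proof (cases "t \<in> {a..b}")
    case True
    then have t: "a \<le> t" "t \<le> b" by auto
    have "(\<integral>s. indicator {c..z} s * (indicator Om (y0 + t *\<^sub>R axis j 1 + s *\<^sub>R axis 3 1) * D (y0 + t *\<^sub>R axis j 1 + s *\<^sub>R axis 3 1)) \<partial>lborel)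
      = T (y0 + t *\<^sub>R axis j 1 + z *\<^sub>R axis 3 1) - T (y0 + t *\<^sub>R axis j 1 + c *\<^sub>R axis 3 1)"
    proof (rule integral_pd_line(2)[OF open_Om cT _ dT cD _ cz])
      fix s assume s: "y0 + t *\<^sub>R axis j 1 + s *\<^sub>R axis 3 1 \<in> Om"
      show "\<bar>D (y0 + t *\<^sub>R axis j 1 + s *\<^sub>R axis 3 1)\<bar> \<le> R * K"
        using Db[OF s] R[OF t, of s] by (simp add: p_def)
    qed (simp add: T_def U_off)
    moreover have "p t c \<notin> Om" using cf1[OF t, of c] pnth(2)[of t c] by (auto simp: domain_def)
    ultimately show ?thesis using True by (simp add: H_def p_def T_def U_off)
  qed (simp add: H_def)
  have "Psi (x + b *\<^sub>R axis j 1) - Psi (x + a *\<^sub>R axis j 1)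
      = (\<integral>s. indicator {c..z} s * Q (p b s) - indicator {c..z} s * Q (p a s) \<partial>lborel)"
    using Bochner_Integration.integral_diff[OF Qi Qi, of b a] PsiQ[of a] PsiQ[of b] ab by simp
  also have "\<dots> = (\<integral>s. - (\<integral>t. H (s, t) \<partial>lborel) \<partial>lborel)"
    unfolding inner by (simp add: algebra_simps)
  also have "\<dots> = - (\<integral>t. (\<integral>s. H (s, t) \<partial>lborel) \<partial>lborel)"
    using integral_lborel_fst(1)[OF Hi] integral_lborel_snd(1)[OF Hi] by simp
  finally show ?thesis unfolding outer px T_def z_def by simp
qed

text \<open>The fundamental theorem of calculus for \<open>Psi_diff\<close>. The integrand is
  continuous on the whole line, so the formula holds on and beyond the walls too.\<close>

lemma has_pd_Psi: assumes j: "j \<noteq> 3" shows "has_pd j Psi (- (x$j * U x $ 3)) x"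
proof -
  define g where "g t = (x + t *\<^sub>R axis j 1) $ j * U (x + t *\<^sub>R axis j 1) $ 3" for t
  have cg: "continuous_on S g" for S
    unfolding g_def by (intro continuous_intros continuous_on_compose2[OF continuous_U_nth[of UNIV]]) auto
  have "((\<lambda>t. integral {-1..t} g) has_real_derivative g 0) (at 0 within {-1..1})"
    by (rule integral_has_real_derivative) (auto intro: cg)
  moreover have "(0::real) \<in> interior {-1..1}" by (simp add: interior_atLeastAtMost_real)
  ultimately have "((\<lambda>t. integral {-1..t} g) has_real_derivative g 0) (at 0)" by (metis at_within_interior)
  then have D: "((\<lambda>t. Psi (x + (-1) *\<^sub>R axis j 1) - integral {-1..t} g) has_real_derivative - g 0) (at 0)"
    by (auto intro!: derivative_eq_intros)
  have "\<forall>\<^sub>F t in nhds (0::real). t \<in> {-1<..<1}"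
    by (rule eventually_nhds_in_open) auto
  then have "\<forall>\<^sub>F t in nhds 0. Psi (x + (-1) *\<^sub>R axis j 1) - integral {-1..t} g = Psi (x + t *\<^sub>R axis j 1)"
  proof (rule eventually_mono)
    fix t :: real assume "t \<in> {-1<..<1}"
    then show "Psi (x + (-1) *\<^sub>R axis j 1) - integral {-1..t} g = Psi (x + t *\<^sub>R axis j 1)"
      using Psi_diff[OF j, of "-1" t x] integral_eq_lborel[OF cg, of "-1" t] by (simp add: g_def)
  qed
  with D have "((\<lambda>t. Psi (x + t *\<^sub>R axis j 1)) has_real_derivative - g 0) (at 0)"
    by (subst (asm) DERIV_cong_ev[OF refl _ refl]) auto
  then show ?thesis by (simp add: has_pd_def g_def)
qed

lemma continuous_Psi: "continuous_on UNIV Psi"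
proof (rule continuous_of_pds[where d="\<lambda>j x. if j = 3 then Q x else - (x$j * U x $ 3)"])
  show "has_pd j Psi (if j = 3 then Q x else - (x$j * U x $ 3)) x" for j x
    using has_pd_Psi3 has_pd_Psi by auto
  show "continuous_on UNIV (\<lambda>x. if j = 3 then Q x else - (x$j * U x $ 3))" for j
    by (cases "j = 3") (auto intro!: continuous_intros continuous_Q continuous_U_nth)
qed

text \<open>The flux through every circular cross section vanishes, so the stream function vanishes
  on the upper boundary as well.\<close>

lemma Psi_off: assumes "x \<notin> Om" shows "Psi x = 0"
proof (cases "x$3 \<le> f1 (rad x)")
  case True
  then show ?thesis by (cases "x$3 = f1 (rad x)") (auto simp: Psi_def)
next
  case False
  then have x3: "x$3 \<ge> f2 (rad x)" using assms by (auto simp: domain_def)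
  have "compact (f2 ` {0..rad x})" by (intro compact_continuous_image continuous_on_subset[OF cf(2)]) auto
  then obtain m where m: "\<And>r. 0 \<le> r \<Longrightarrow> r \<le> rad x \<Longrightarrow> f2 r \<le> m"
    using compact_imp_bounded bounded_imp_bdd_above
    by (metis (no_types, lifting) atLeastAtMost_iff bdd_above.E imageI)
  \<comment> \<open>At height \<open>Z\<close> the whole disc of radius \<open>rad x\<close> is
    outside the domain. There \<open>Psi\<close> has zero horizontal derivatives, so its value can
    be carried to the axis, where it vanishes because \<open>Q\<close> does.\<close>
  define Z where "Z = max m (x$3)"
  have above: "y \<notin> Om" if "rad y \<le> rad x" "y$3 \<ge> Z" for y
    using m[of "rad y"] that by (auto simp: domain_def Z_def)
  have "\<bar>Psi (x + (Z - x$3) *\<^sub>R axis 3 1) - Psi x\<bar> \<le> 0 * \<bar>Z - x$3\<bar>"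
  proof (rule pd_diff_bound'[OF has_pd_Psi3])
    fix s assume "s \<in> closed_segment 0 (Z - x$3)"
    then have "s \<ge> 0" by (auto simp: closed_segment_eq_real_ivl Z_def split: if_splits)
    moreover have "rad (x + s *\<^sub>R axis 3 1) = rad x" by (simp add: rad_def)
    ultimately have "x + s *\<^sub>R axis 3 1 \<notin> Om" using x3 by (auto simp: domain_def)
    then show "\<bar>Q (x + s *\<^sub>R axis 3 1)\<bar> \<le> 0" by (simp add: Q_off)
  qed
  moreover have "x + (Z - x$3) *\<^sub>R axis 3 1 = pt (x$1) (x$2) Z" by (simp add: vec3_eq_iff)
  ultimately have 1: "Psi x = Psi (pt (x$1) (x$2) Z)" by simp
  have rx: "rad x = sqrt ((x$1)\<^sup>2 + (x$2)\<^sup>2)" by (simp add: rad_def)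
  have "\<bar>Psi (pt (x$1) (x$2) Z + (- x$1) *\<^sub>R axis 1 1) - Psi (pt (x$1) (x$2) Z)\<bar> \<le> 0 * \<bar>- x$1\<bar>"
  proof (rule pd_diff_bound'[OF has_pd_Psi])
    fix s assume "s \<in> closed_segment 0 (- x$1)"
    then have "\<bar>x$1 + s\<bar> \<le> \<bar>x$1\<bar>" by (auto simp: closed_segment_eq_real_ivl split: if_splits)
    then have "(x$1 + s)\<^sup>2 \<le> (x$1)\<^sup>2" by (simp add: abs_le_square_iff)
    then have "pt (x$1 + s) (x$2) Z \<notin> Om" by (intro above) (auto simp: rx)
    then show "\<bar>- ((pt (x$1) (x$2) Z + s *\<^sub>R axis 1 1) $ 1 * U (pt (x$1) (x$2) Z + s *\<^sub>R axis 1 1) $ 3)\<bar> \<le> 0"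
      by (simp add: pt_add_axis U_off)
  qed simp
  then have 2: "Psi (pt (x$1) (x$2) Z) = Psi (pt 0 (x$2) Z)" by (simp add: pt_add_axis del: scaleR_minus_left)
  have "\<bar>Psi (pt 0 (x$2) Z + (- x$2) *\<^sub>R axis 2 1) - Psi (pt 0 (x$2) Z)\<bar> \<le> 0 * \<bar>- x$2\<bar>"
  proof (rule pd_diff_bound'[OF has_pd_Psi])
    fix s assume "s \<in> closed_segment 0 (- x$2)"
    then have "\<bar>x$2 + s\<bar> \<le> \<bar>x$2\<bar>" by (auto simp: closed_segment_eq_real_ivl split: if_splits)
    then have "\<bar>x$2 + s\<bar> \<le> rad x" using abs_le_rad(2)[of x] by linarith
    then have "pt 0 (x$2 + s) Z \<notin> Om" by (intro above) auto
    then show "\<bar>- ((pt 0 (x$2) Z + s *\<^sub>R axis 2 1) $ 2 * U (pt 0 (x$2) Z + s *\<^sub>R axis 2 1) $ 3)\<bar> \<le> 0"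
      by (simp add: pt_add_axis U_off)
  qed simp
  then have 3: "Psi (pt 0 (x$2) Z) = Psi (pt 0 0 Z)" by (simp add: pt_add_axis del: scaleR_minus_left)
  have "Psi (pt 0 0 Z) = 0" by (simp add: Psi_def Q_def)
  then show ?thesis using 1 2 3 by simp
qed

lemma abs_Q_le: "\<bar>Q x\<bar> \<le> rad x * norm (U x)"
proof -
  have "(Q x)\<^sup>2 \<le> ((x$1)\<^sup>2 + (x$2)\<^sup>2) * ((U x $ 1)\<^sup>2 + (U x $ 2)\<^sup>2)"
  proof -
    have "((x$1)\<^sup>2 + (x$2)\<^sup>2) * ((U x $ 1)\<^sup>2 + (U x $ 2)\<^sup>2) - (Q x)\<^sup>2 = (x$1 * U x $ 2 - x$2 * U x $ 1)\<^sup>2"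
      by (simp add: Q_def power2_eq_square algebra_simps)
    then show ?thesis by (smt (verit) zero_le_power2)
  qed
  also have "\<dots> \<le> (rad x)\<^sup>2 * (norm (U x))\<^sup>2"
    unfolding rad_sq norm3_sq by (intro mult_left_mono) auto
  finally show ?thesis by (simp add: power_mult_distrib[symmetric] abs_le_square_iff[symmetric] abs_mult)
qed

lemma integrable_vert:
  fixes h :: "real^3 \<Rightarrow> real"
  assumes "continuous_on UNIV h" "\<And>x. x \<notin> Om \<Longrightarrow> h x = 0"
  shows "integrable lborel (\<lambda>s. h (pt a b s))"
proof -
  define r where "r = sqrt (a\<^sup>2 + b\<^sup>2)"
  have "continuous_on {f1 r..f2 r} (\<lambda>s. h (pt a b s))"
    by (rule continuous_on_compose2[OF assms(1)]) (auto intro!: continuous_intros)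
  from borel_integrable_atLeastAtMost'[OF this]
  have "integrable lborel (\<lambda>s. indicator {f1 r..f2 r} s * h (pt a b s))" by (simp add: set_integrable_def)
  moreover have "indicator {f1 r..f2 r} s * h (pt a b s) = h (pt a b s)" for s
    by (cases "pt a b s \<in> Om") (auto simp: assms(2) indicator_def domain_def r_def)
  ultimately show ?thesis by simp
qed

lemma Psi_bound: "\<bar>Psi x\<bar> \<le> rad x * (\<integral>s. norm (U (pt (x$1) (x$2) s)) \<partial>lborel)"
proof -
  let ?p = "\<lambda>s. pt (x$1) (x$2) s"
  have n: "integrable lborel (\<lambda>s. norm (U (?p s)))"
    by (rule integrable_vert) (auto intro!: continuous_intros continuous_U simp: U_off)
  have "Psi x = (\<integral>s. indicator {f1 (rad x)..x$3} s * Q (?p s) \<partial>lborel)"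
    unfolding Psi_def by (intro integral_eq_lborel continuous_Q_vert)
  also have "\<bar>\<dots>\<bar> \<le> (\<integral>s. rad x * norm (U (?p s)) \<partial>lborel)"
  proof (rule integral_abs_bound_integral)
    show "integrable lborel (\<lambda>s. indicator {f1 (rad x)..x$3} s * Q (?p s))"
      using borel_integrable_atLeastAtMost'[OF continuous_Q_vert] by (simp add: set_integrable_def)
    show "integrable lborel (\<lambda>s. rad x * norm (U (?p s)))" using n by simp
    show "\<bar>indicator {f1 (rad x)..x$3} s * Q (?p s)\<bar> \<le> rad x * norm (U (?p s))" for s
      using abs_Q_le[of "?p s"] by (auto simp: indicator_def rad_def)
  qed
  finally show ?thesis by simp
qed

end

section \<open>The energy identity\<close>

text \<open>Squeezing by a majorant that vanishes off \<open>W\<close>. The intended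
  \<open>h\<close> are products of a bounded factor, such as the pressure or a velocity derivative,
  with a factor tending to zero at the boundary.\<close>

lemma continuous_zero_extension:
  fixes h B :: "'a::metric_space \<Rightarrow> real"
  assumes W: "open W" and c: "continuous_on W h" and cB: "continuous_on UNIV B"
    and B0: "\<And>x. x \<notin> W \<Longrightarrow> B x = 0" and le: "\<And>x. x \<in> W \<Longrightarrow> \<bar>h x\<bar> \<le> B x"
  shows "continuous_on UNIV (\<lambda>x. if x \<in> W then h x else 0)"
proof (rule continuous_at_imp_continuous_on, intro ballI)
  fix y
  let ?h = "\<lambda>x. if x \<in> W then h x else 0"
  show "isCont ?h y"
  proof (cases "y \<in> W")
    case True
    have "continuous_on W ?h" using c by (simp cong: continuous_on_cong)
    then show ?thesis using True W continuous_on_eq_continuous_at by blast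
  next
    case False
    have "(?h \<longlongrightarrow> 0) (at y)"
    proof (rule Lim_null_comparison[where g=B])
      show "\<forall>\<^sub>F x in at y. norm (?h x) \<le> B x" using le B0 by (intro always_eventually) auto
      show "(B \<longlongrightarrow> 0) (at y)"
        using cB B0[OF False] by (metis UNIV_I continuous_on_eq_continuous_at isCont_def open_UNIV)
    qed
    then show ?thesis using False by (simp add: isCont_def)
  qed
qed

lemma sum5_le_each:
  fixes a b c d e :: real
  assumes "0 \<le> a" "0 \<le> b" "0 \<le> c" "0 \<le> d" "0 \<le> e" "\<bar>a + b + c + d + e\<bar> \<le> K"
  shows "a \<le> K \<and> b \<le> K \<and> c \<le> K \<and> d \<le> K \<and> e \<le> K"
  using assms by auto

lemma abs_sum5_le:
  fixes a b c d e :: real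
  assumes "\<bar>a\<bar> \<le> a'" "\<bar>b\<bar> \<le> b'" "\<bar>c\<bar> \<le> c'" "\<bar>d\<bar> \<le> d'" "\<bar>e\<bar> \<le> e'"
  shows "\<bar>a + b + c - d - 1/2 * e\<bar> \<le> a' + b' + c' + d' + e'"
  using assms by linarith

section \<open>Bounded functions and integrability on bounded open sets\<close>

definition bdd_fun :: "'a set \<Rightarrow> ('a \<Rightarrow> real) \<Rightarrow> bool" where
  "bdd_fun W h \<longleftrightarrow> (\<exists>K. \<forall>x\<in>W. \<bar>h x\<bar> \<le> K)"

lemma bdd_fun_const: "bdd_fun W (\<lambda>x. c)" by (auto simp: bdd_fun_def)

lemma bdd_fun_add: "bdd_fun W f \<Longrightarrow> bdd_fun W g \<Longrightarrow> bdd_fun W (\<lambda>x. f x + g x)"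
proof -
  assume "bdd_fun W f" "bdd_fun W g"
  then obtain a b where "\<And>x. x \<in> W \<Longrightarrow> \<bar>f x\<bar> \<le> a" "\<And>x. x \<in> W \<Longrightarrow> \<bar>g x\<bar> \<le> b"
    by (auto simp: bdd_fun_def)
  then have "\<forall>x\<in>W. \<bar>f x + g x\<bar> \<le> a + b" by (fastforce intro: order_trans[OF abs_triangle_ineq])
  then show ?thesis by (auto simp: bdd_fun_def)
qed

lemma bdd_fun_minus: "bdd_fun W f \<Longrightarrow> bdd_fun W (\<lambda>x. - f x)"
  by (simp add: bdd_fun_def)

lemma bdd_fun_diff: "bdd_fun W f \<Longrightarrow> bdd_fun W g \<Longrightarrow> bdd_fun W (\<lambda>x. f x - g x)"
  using bdd_fun_add[of W f "\<lambda>x. - g x"] bdd_fun_minus by auto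

lemma bdd_fun_mult: "bdd_fun W f \<Longrightarrow> bdd_fun W g \<Longrightarrow> bdd_fun W (\<lambda>x. f x * g x)"
proof -
  assume "bdd_fun W f" "bdd_fun W g"
  then obtain a b where ab: "\<And>x. x \<in> W \<Longrightarrow> \<bar>f x\<bar> \<le> a" "\<And>x. x \<in> W \<Longrightarrow> \<bar>g x\<bar> \<le> b"
    by (auto simp: bdd_fun_def)
  have "\<bar>f x * g x\<bar> \<le> a * b" if "x \<in> W" for x
    unfolding abs_mult using ab[OF that] abs_ge_zero[of "f x"] by (intro mult_mono) linarith+
  then show ?thesis by (auto simp: bdd_fun_def)
qed

lemma bdd_fun_abs: "bdd_fun W f \<Longrightarrow> bdd_fun W (\<lambda>x. \<bar>f x\<bar>)" by (simp add: bdd_fun_def)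

lemma bdd_fun_sqrt: "bdd_fun W f \<Longrightarrow> bdd_fun W (\<lambda>x. sqrt (f x))"
proof -
  have "\<bar>sqrt a\<bar> = sqrt \<bar>a\<bar>" for a :: real by (auto simp: abs_if real_sqrt_minus)
  then show "bdd_fun W f \<Longrightarrow> bdd_fun W (\<lambda>x. sqrt (f x))"
    unfolding bdd_fun_def by (metis real_sqrt_le_iff)
qed

lemma bdd_fun_power: "bdd_fun W f \<Longrightarrow> bdd_fun W (\<lambda>x. f x ^ n)"
  by (induction n) (auto intro: bdd_fun_const bdd_fun_mult)

lemma bdd_fun_continuous:
  fixes W :: "'a::heine_borel set"
  assumes "bounded W" "continuous_on UNIV h" shows "bdd_fun W h"
proof -
  have "bounded (h ` closure W)"
    using assms by (intro compact_imp_bounded compact_continuous_image)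
      (auto intro: continuous_on_subset simp: compact_closure)
  then have "bounded (h ` W)" by (rule bounded_subset) (use closure_subset in auto)
  then show ?thesis by (auto simp: bdd_fun_def bounded_iff)
qed

lemmas bdd_fun_intros = bdd_fun_const bdd_fun_add bdd_fun_minus bdd_fun_diff bdd_fun_mult bdd_fun_abs bdd_fun_sqrt bdd_fun_power

lemma integrable_bdd_fun:
  fixes W :: "'a::euclidean_space set"
  assumes "open W" "bounded W" "continuous_on W h" "bdd_fun W h"
  shows "integrable lborel (\<lambda>x. indicator W x * h x)"
proof -
  obtain K where K: "\<And>x. x \<in> W \<Longrightarrow> \<bar>h x\<bar> \<le> K" using assms(4) by (auto simp: bdd_fun_def)
  show ?thesis
  proof (rule integrable_lborel_bounded[OF _ _ _ assms(2), where K="max K 0"])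
    show "(\<lambda>x. indicator W x * h x) \<in> borel_measurable borel"
      using borel_measurable_continuous_on_indicator[OF _ assms(3)] assms(1) by simp
    show "\<bar>indicator W x * h x\<bar> \<le> max K 0" for x using K[of x] by (auto simp: indicator_def)
  qed auto
qed

text \<open>Cutoffs take r^2 rather than r as argument: it is a polynomial, so its partial
  derivatives exist on the axis as well.\<close>

definition sq :: "real^3 \<Rightarrow> real" where "sq x = (x$1)\<^sup>2 + (x$2)\<^sup>2"

lemma continuous_sq: "continuous_on S sq" unfolding sq_def by (intro continuous_intros)

lemma has_pd_sq: "has_pd j sq (if j = 3 then 0 else 2 * x$j) x"
proof -
  have "has_pd j (\<lambda>x. x$1 * x$1 + x$2 * x$2) ((if 1 = j then 1 else 0) * x$1 + x$1 * (if 1 = j then 1 else 0)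
     + ((if 2 = j then 1 else 0) * x$2 + x$2 * (if 2 = j then 1 else 0))) x"
    by (intro has_pd_add has_pd_mult has_pd_nth)
  then show ?thesis using exhaust_3[of j] by (auto simp: sq_def[abs_def] power2_eq_square)
qed

context axi_flow begin

lemma grad_sq_du: "grad_sq u x = (\<Sum>i\<in>UNIV. \<Sum>j\<in>UNIV. (du i j x)\<^sup>2)"
  by (simp add: grad_sq_def du_def)

lemma grad_sq_nonneg: "0 \<le> grad_sq u x" by (simp add: grad_sq_du sum_nonneg)

lemma du_le: "\<bar>du i j x\<bar> \<le> sqrt (grad_sq u x)"
proof -
  have "(du i j x)\<^sup>2 \<le> (\<Sum>j\<in>UNIV. (du i j x)\<^sup>2)" by (rule member_le_sum) auto
  also have "\<dots> \<le> grad_sq u x" unfolding grad_sq_du by (rule member_le_sum) (auto intro: sum_nonneg)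
  finally show ?thesis by (simp add: real_le_rsqrt)
qed

lemma continuous_grad_sq: "continuous_on Om (grad_sq u)"
  unfolding grad_sq_du[abs_def] by (intro continuous_intros continuous_du)

text \<open>Regularity of the pressure is given only in the open domain. Velocity derivatives are
  bounded up to the walls, so the momentum equation bounds \<partial>_3 P. Integrating vertically
  from the middle surface, whose part inside a cylinder is a compact subset of the domain, bounds
  the pressure itself.\<close>

lemma P_bounded: "\<exists>K. \<forall>x\<in>Om. rad x \<le> R \<longrightarrow> \<bar>P x\<bar> \<le> K"
proof -
  define mid where "mid x = pt (x$1) (x$2) ((f1 (rad x) + f2 (rad x)) / 2)" for x
  have cm: "continuous_on S mid" for S
    unfolding mid_def by (intro continuous_intros continuous_f_rad) auto
  have radm: "rad (mid x) = rad x" for x by (simp add: mid_def rad_def)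
  have mOm: "mid x \<in> Om" for x
    unfolding domain_def using f_less[OF rad_nonneg[of x]] by (simp add: radm) (simp add: mid_def)
  have "compact (mid ` {x. rad x \<le> R \<and> x$3 = 0})"
  proof (intro compact_continuous_image cm)
    have "bounded {x::real^3. rad x \<le> R \<and> x$3 = 0}"
    proof -
      have "norm x \<le> R + R" if "rad x \<le> R" "x$3 = 0" for x :: "real^3"
        using norm_le_l1_cart[of x] abs_le_rad[of x] that by (simp add: sum_3)
      then show ?thesis by (auto simp: bounded_iff)
    qed
    moreover have "closed {x::real^3. rad x \<le> R \<and> x$3 = 0}"
      by (intro closed_Collect_conj closed_Collect_le closed_Collect_eq continuous_intros)
    ultimately show "compact {x::real^3. rad x \<le> R \<and> x$3 = 0}" by (simp add: compact_eq_bounded_closed)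
  qed
  note cpt = this
  have "bounded (P ` mid ` {x. rad x \<le> R \<and> x$3 = 0})"
    by (rule compact_imp_bounded[OF compact_continuous_image[OF continuous_on_subset[OF continuous_P] cpt]])
       (use mOm in auto)
  then obtain K1 where K1: "\<And>x. rad x \<le> R \<Longrightarrow> x$3 = 0 \<Longrightarrow> \<bar>P (mid x)\<bar> \<le> K1"
    by (auto simp: bounded_iff)
  have K1': "\<bar>P (mid x)\<bar> \<le> K1" if "rad x \<le> R" for x
  proof -
    have "mid x = mid (pt (x$1) (x$2) 0)" by (simp add: mid_def rad_def)
    then show ?thesis using K1[of "pt (x$1) (x$2) 0"] that by (simp add: rad_def)
  qed
  obtain K where K: "K \<ge> 0" "\<And>i j x. x \<in> Om \<Longrightarrow> rad x \<le> R \<Longrightarrow> \<bar>du i j x\<bar> \<le> K"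
    "\<And>i j x. x \<in> Om \<Longrightarrow> rad x \<le> R \<Longrightarrow> \<bar>ddu i j x\<bar> \<le> K" "\<And>i x. x \<in> Om \<Longrightarrow> rad x \<le> R \<Longrightarrow> \<bar>U x $ i\<bar> \<le> K"
    using bounded_derivs by metis
  have dP: "\<bar>pd 3 P x\<bar> \<le> 3 * K + 3 * (K * K)" if x: "x \<in> Om" "rad x \<le> R" for x
  proof -
    have "\<bar>u x $ i * du 3 i x\<bar> \<le> K * K" for i
      unfolding abs_mult using K(1) K(2)[OF x] K(4)[OF x] x by (intro mult_mono) (auto simp: U_on)
    note m = this[of 1] this[of 2] this[of 3]
    have "\<bar>ddu 3 1 x\<bar> \<le> K" "\<bar>ddu 3 2 x\<bar> \<le> K" "\<bar>ddu 3 3 x\<bar> \<le> K" using K(3)[OF x] by auto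
    then show ?thesis using m unfolding momentum[OF x(1)] by linarith
  qed
  obtain B where B: "\<And>x. rad x \<le> R \<Longrightarrow> f1 (rad x) \<le> x$3 \<Longrightarrow> x$3 \<le> f2 (rad x) \<Longrightarrow> norm x \<le> B"
    using bounded_Om_cyl[of R] by (auto simp: bounded_iff)
  show ?thesis
  proof (intro exI ballI impI)
    fix x assume x: "x \<in> Om" "rad x \<le> R"
    define m where "m = (f1 (rad x) + f2 (rad x)) / 2"
    have m: "f1 (rad x) < m" "m < f2 (rad x)" using f_less[of "rad x"] by (auto simp: m_def)
    have xm: "mid x + (x$3 - m) *\<^sub>R axis 3 1 = x" by (simp add: mid_def m_def vec3_eq_iff)
    have seg: "mid x + s *\<^sub>R axis 3 1 \<in> Om \<and> rad (mid x + s *\<^sub>R axis 3 1) \<le> R"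
      if s: "s \<in> closed_segment 0 (x$3 - m)" for s
    proof -
      have e: "mid x + s *\<^sub>R axis 3 1 = pt (x$1) (x$2) (m + s)" by (simp add: mid_def m_def pt_add_axis)
      have r: "rad (mid x + s *\<^sub>R axis 3 1) = rad x" unfolding e by (simp add: rad_def)
      have "f1 (rad x) < x$3" "x$3 < f2 (rad x)" using x by (auto simp: domain_def)
      then have "f1 (rad x) < m + s" "m + s < f2 (rad x)"
        using s m by (auto simp: closed_segment_eq_real_ivl split: if_splits)
      then show ?thesis using x(2) unfolding domain_def mem_Collect_eq r by (simp add: e)
    qed
    have "\<bar>P (mid x + (x$3 - m) *\<^sub>R axis 3 1) - P (mid x)\<bar> \<le> (3 * K + 3 * (K * K)) * \<bar>x$3 - m\<bar>"
      by (rule pd_diff_bound'[where d="pd 3 P"]) (use seg has_pd_P dP in auto)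
    moreover have "\<bar>x$3 - m\<bar> \<le> 2 * B"
    proof -
      have "\<bar>x$3\<bar> \<le> B"
        using B[of x] x component_le_norm_cart[of x 3] by (auto simp: domain_def)
      moreover have "\<bar>mid x $ 3\<bar> \<le> B"
        using B[of "mid x"] x mOm[of x] component_le_norm_cart[of "mid x" 3] by (auto simp: domain_def radm)
      then have "\<bar>m\<bar> \<le> B" by (simp add: mid_def m_def)
      ultimately show ?thesis by linarith
    qed
    then have "(3 * K + 3 * (K * K)) * \<bar>x$3 - m\<bar> \<le> (3 * K + 3 * (K * K)) * (2 * B)"
      using K(1) by (intro mult_left_mono) auto
    ultimately show "\<bar>P x\<bar> \<le> K1 + (3 * K + 3 * (K * K)) * (2 * B)"
      using K1'[OF x(2)] unfolding xm by linarith
  qed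
qed

lemma bdd_fun_OmR:
  assumes "R \<ge> 0"
  shows "bdd_fun (OmR R) (du i j)" "bdd_fun (OmR R) (ddu i j)" "bdd_fun (OmR R) (\<lambda>x. U x $ i)"
    "bdd_fun (OmR R) P" "bdd_fun (OmR R) (\<lambda>x. x $ i)"
proof -
  obtain K where K: "\<And>i j x. x \<in> Om \<Longrightarrow> rad x \<le> R \<Longrightarrow> \<bar>du i j x\<bar> \<le> K"
    "\<And>i j x. x \<in> Om \<Longrightarrow> rad x \<le> R \<Longrightarrow> \<bar>ddu i j x\<bar> \<le> K" "\<And>i x. x \<in> Om \<Longrightarrow> rad x \<le> R \<Longrightarrow> \<bar>U x $ i\<bar> \<le> K"
    using bounded_derivs[of R] by metis
  obtain K' where "\<And>x. x \<in> Om \<Longrightarrow> rad x \<le> R \<Longrightarrow> \<bar>P x\<bar> \<le> K'" using P_bounded[of R] by blast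
  then show "bdd_fun (OmR R) P"
    unfolding bdd_fun_def OmR_eq[OF assms] by (auto intro!: exI[of _ K'])
  show "bdd_fun (OmR R) (du i j)" "bdd_fun (OmR R) (ddu i j)" "bdd_fun (OmR R) (\<lambda>x. U x $ i)"
    unfolding bdd_fun_def OmR_eq[OF assms] using K by (auto intro!: exI[of _ K])
  show "bdd_fun (OmR R) (\<lambda>x. x $ i)"
    by (rule bdd_fun_continuous[OF bounded_OmR]) (intro continuous_intros)
qed

lemma OmR_subset: "OmR R \<subseteq> Om" by (auto simp: domain_R_def domain_def)

text \<open>The energy identity is the vanishing of \<open>\<integral> div F\<close>, where
  \<open>F\<^sub>j = \<partial>\<^sub>ju \<cdot> v - P v\<^sub>j - \<Phi> |u|\<^sup>2 u\<^sub>j / 2\<close> for the test field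
  \<open>v = \<Phi>(r\<^sup>2) u - 2 \<Phi>'(r\<^sup>2) Psi e\<^sub>3\<close>.  The second term of \<open>v\<close> makes it
  divergence free, so that the pressure drops out; \<open>v\<close> vanishes on the boundary
  because the stream function does.\<close>

lemma energy_identity:
  assumes R: "R \<ge> 0"
    and d1: "\<And>s. (\<Phi> has_real_derivative \<phi>1 s) (at s)" and d2: "\<And>s. (\<phi>1 has_real_derivative \<phi>2 s) (at s)"
    and c2: "continuous_on UNIV \<phi>2"
    and z: "\<And>s. s \<ge> R\<^sup>2 \<Longrightarrow> \<Phi> s = 0" "\<And>s. s \<ge> R\<^sup>2 \<Longrightarrow> \<phi>1 s = 0"
  defines "rest \<equiv> \<lambda>x. 2 * \<phi>1 (sq x) * (\<Sum>i\<in>UNIV. U x $ i * (x$1 * du i 1 x + x$2 * du i 2 x))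
      - (4 * \<phi>2 (sq x) * Psi x - 2 * \<phi>1 (sq x) * U x $ 3) * (x$1 * du 3 1 x + x$2 * du 3 2 x)
      - 2 * \<phi>1 (sq x) * Q x * du 3 3 x
      - 2 * \<phi>1 (sq x) * Psi x * (U x $ 1 * du 3 1 x + U x $ 2 * du 3 2 x + U x $ 3 * du 3 3 x)
      - \<phi>1 (sq x) * Q x * ((U x $ 1)\<^sup>2 + (U x $ 2)\<^sup>2 + (U x $ 3)\<^sup>2)"
  shows "(\<integral>x. indicator (OmR R) x * (\<Phi> (sq x) * grad_sq u x + rest x) \<partial>lborel) = 0"
proof -
  let ?W = "OmR R"
  define hf :: real where "hf = 1/2"
  \<comment> \<open>The value 2 at index 3 serves twice: as the coefficient of the correction in the
    third component of \<open>v\<close>, and, through \<open>2 - \<kappa> j\<close>, to make the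
    vertical derivative of r^2 vanish.\<close>
  define \<kappa> where "\<kappa> i = (if i = 3 then 2 else 0 :: real)" for i :: 3
  define v where "v i x = \<Phi> (sq x) * U x $ i - \<kappa> i * (\<phi>1 (sq x) * Psi x)" for i x
  define ds where "ds j x = (2 - \<kappa> j) * x $ j" for j and x :: "real^3"
  define dPsi where "dPsi j x = (if j = 3 then Q x else - (x$j * U x $ 3))" for j x
  define dv where "dv i j x = \<phi>1 (sq x) * ds j x * U x $ i + \<Phi> (sq x) * du i j x
     - \<kappa> i * (\<phi>2 (sq x) * ds j x * Psi x + \<phi>1 (sq x) * dPsi j x)" for i j x
  define N where "N x = U x $ 1 * U x $ 1 + U x $ 2 * U x $ 2 + U x $ 3 * U x $ 3" for x
  define dN where "dN j x = 2 * (U x $ 1 * du 1 j x + U x $ 2 * du 2 j x + U x $ 3 * du 3 j x)" for j x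
  define F where "F j x = du 1 j x * v 1 x + du 2 j x * v 2 x + du 3 j x * v 3 x - P x * v j x
      - hf * (\<Phi> (sq x) * (N x * U x $ j))" for j x
  define dF where "dF j x = (ddu 1 j x * v 1 x + du 1 j x * dv 1 j x) + (ddu 2 j x * v 2 x + du 2 j x * dv 2 j x)
      + (ddu 3 j x * v 3 x + du 3 j x * dv 3 j x) - (pd j P x * v j x + P x * dv j j x)
      - hf * (\<phi>1 (sq x) * ds j x * (N x * U x $ j) + \<Phi> (sq x) * (dN j x * U x $ j + N x * du j j x))" for j x
  have c\<Phi>: "continuous_on S (\<lambda>x. \<Phi> (sq x))" and c\<phi>1: "continuous_on S (\<lambda>x. \<phi>1 (sq x))"
    and c\<phi>2: "continuous_on S (\<lambda>x. \<phi>2 (sq x))" for S :: "(real^3) set"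
  proof -
    have "continuous_on UNIV \<Phi>" "continuous_on UNIV \<phi>1"
      using DERIV_isCont[OF d1] DERIV_isCont[OF d2] by (auto intro: continuous_at_imp_continuous_on)
    then show "continuous_on S (\<lambda>x. \<Phi> (sq x))" "continuous_on S (\<lambda>x. \<phi>1 (sq x))" "continuous_on S (\<lambda>x. \<phi>2 (sq x))"
      using c2 by (auto intro: continuous_on_compose2[OF _ continuous_sq])
  qed
  have cPsi: "continuous_on S Psi" for S using continuous_Psi continuous_on_subset by blast
  have cv: "continuous_on S (v i)" for S i
    unfolding v_def by (intro continuous_intros c\<Phi> c\<phi>1 cPsi continuous_U_nth)
  have cds: "continuous_on S (ds j)" for S j
    unfolding ds_def by (intro continuous_intros)
  have cdPsi: "continuous_on S (dPsi j)" for S j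
    unfolding dPsi_def by (cases "j = 3") (auto intro!: continuous_intros continuous_Q continuous_U_nth)
  have cN: "continuous_on S N" for S
    unfolding N_def by (intro continuous_intros continuous_U_nth)
  have cW: "continuous_on ?W (du i j)" "continuous_on ?W (ddu i j)" "continuous_on ?W P" "continuous_on ?W (pd j P)" for i j
    by (rule continuous_on_subset[OF _ OmR_subset], rule continuous_du continuous_ddu continuous_P continuous_pdP)+
  have cdv: "continuous_on ?W (dv i j)" for i j
    unfolding dv_def by (intro continuous_intros c\<Phi> c\<phi>1 c\<phi>2 cPsi continuous_U_nth cds cdPsi cW)
  have cF: "continuous_on ?W (F j)" for j
    unfolding F_def by (intro continuous_intros cW cv c\<Phi> cN continuous_U_nth)
  have cdF: "continuous_on ?W (dF j)" for j
    unfolding dF_def dN_def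
    by (intro cW cv c\<Phi> cN c\<phi>1 cds cdv continuous_U_nth continuous_intros)
  note bc = bdd_fun_continuous[OF bounded_OmR]
  note bb = bdd_fun_OmR[OF R]
  have b: "bdd_fun ?W (v i)" "bdd_fun ?W (ds j)" "bdd_fun ?W (dPsi j)" "bdd_fun ?W N"
     "bdd_fun ?W (\<lambda>x. \<Phi> (sq x))" "bdd_fun ?W (\<lambda>x. \<phi>1 (sq x))" "bdd_fun ?W (\<lambda>x. \<phi>2 (sq x))" "bdd_fun ?W Psi" for i j
    by (intro bc cv cds cdPsi cN c\<Phi> c\<phi>1 c\<phi>2 cPsi)+
  have bdv: "bdd_fun ?W (dv i j)" for i j
    unfolding dv_def by (intro bdd_fun_intros b bb)
  have bdP: "bdd_fun ?W (pd j P)" for j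
  proof -
    have "bdd_fun ?W (\<lambda>x. ddu j 1 x + ddu j 2 x + ddu j 3 x
       - (U x $ 1 * du j 1 x + U x $ 2 * du j 2 x + U x $ 3 * du j 3 x))"
      by (intro bdd_fun_intros bb)
    then show ?thesis using OmR_subset[of R] by (auto simp: bdd_fun_def momentum U_on subset_iff)
  qed
  have bdF: "bdd_fun ?W (dF j)" for j
    unfolding dF_def dN_def by (intro bdd_fun_intros b bb bdv bdP)
  have W_iff: "x \<in> ?W \<longleftrightarrow> x \<in> Om \<and> sq x < R\<^sup>2" for x
    by (auto simp: domain_R_def domain_def sq_def)
  have v0: "v i x = 0" if "x \<notin> ?W" for i x
  proof (cases "x \<in> Om")
    case True
    then have "sq x \<ge> R\<^sup>2" using that W_iff by auto
    then show ?thesis by (simp add: v_def z)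
  qed (simp add: v_def U_off Psi_off)
  have \<Phi>U0: "\<Phi> (sq x) * U x $ i = 0" if "x \<notin> ?W" for i x
    using that W_iff[of x] z(1)[of "sq x"] by (cases "x \<in> Om") (auto simp: U_off)
  have hs: "has_pd j sq (ds j x) x" for j x using has_pd_sq[of j x] by (cases "j = 3") (simp_all add: ds_def \<kappa>_def)
  have hPsi: "has_pd j Psi (dPsi j x) x" for j x
    unfolding dPsi_def using has_pd_Psi3 has_pd_Psi by auto
  have hv: "has_pd j (v i) (dv i j x) x" if "x \<in> Om" for i j x
  proof -
    have 1: "has_pd j (\<lambda>x. \<Phi> (sq x) * U x $ i) (\<phi>1 (sq x) * ds j x * U x $ i + \<Phi> (sq x) * du i j x) x"
      by (intro has_pd_mult has_pd_compose[OF d1] hs has_pd_U that)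
    have 2: "has_pd j (\<lambda>x. \<kappa> i * (\<phi>1 (sq x) * Psi x))
       (0 * (\<phi>1 (sq x) * Psi x) + \<kappa> i * (\<phi>2 (sq x) * ds j x * Psi x + \<phi>1 (sq x) * dPsi j x)) x"
      by (intro has_pd_mult has_pd_const has_pd_compose[OF d2] hs hPsi)
    show ?thesis using has_pd_diff[OF 1 2] by (simp add: v_def[abs_def] dv_def)
  qed
  have hN: "has_pd j N (dN j x) x" if "x \<in> Om" for j x
  proof -
    have "has_pd j N ((du 1 j x * U x $ 1 + U x $ 1 * du 1 j x) + (du 2 j x * U x $ 2 + U x $ 2 * du 2 j x)
       + (du 3 j x * U x $ 3 + U x $ 3 * du 3 j x)) x"
      unfolding N_def[abs_def] by (intro has_pd_add has_pd_mult has_pd_U that)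
    then show ?thesis by (simp add: dN_def algebra_simps)
  qed
  have hF: "has_pd j (F j) (dF j x) x" if "x \<in> Om" for j x
  proof -
    have "has_pd j (F j) ((ddu 1 j x * v 1 x + du 1 j x * dv 1 j x) + (ddu 2 j x * v 2 x + du 2 j x * dv 2 j x)
      + (ddu 3 j x * v 3 x + du 3 j x * dv 3 j x) - (pd j P x * v j x + P x * dv j j x)
      - (0 * (\<Phi> (sq x) * (N x * U x $ j)) + hf * (\<phi>1 (sq x) * ds j x * (N x * U x $ j)
           + \<Phi> (sq x) * (dN j x * U x $ j + N x * du j j x)))) x"
      unfolding F_def[abs_def]
      by (intro has_pd_add has_pd_diff has_pd_mult has_pd_const has_pd_U has_pd_du has_pd_P hv hN
          has_pd_compose[OF d1] hs that)
    then show ?thesis by (simp add: dF_def)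
  qed
  have FE: "continuous_on UNIV (\<lambda>x. if x \<in> ?W then F j x else 0)" for j
  proof -
    have "bdd_fun ?W (\<lambda>x. \<bar>du 1 j x\<bar> + \<bar>du 2 j x\<bar> + \<bar>du 3 j x\<bar> + \<bar>P x\<bar> + \<bar>N x\<bar>)"
      by (intro bdd_fun_intros b bb)
    then obtain K where K: "\<And>x. x \<in> ?W \<Longrightarrow> \<bar>\<bar>du 1 j x\<bar> + \<bar>du 2 j x\<bar> + \<bar>du 3 j x\<bar> + \<bar>P x\<bar> + \<bar>N x\<bar>\<bar> \<le> K"
      by (auto simp: bdd_fun_def)
    \<comment> \<open>Every term of \<open>F\<close> is a bounded factor times a component of
      \<open>v\<close> or of \<Phi> U, and these vanish off the truncated domain.\<close>
    define B where "B x = K * (\<bar>v 1 x\<bar> + \<bar>v 2 x\<bar> + \<bar>v 3 x\<bar> + \<bar>v j x\<bar> + \<bar>\<Phi> (sq x) * U x $ j\<bar>)" for x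
    show ?thesis
    proof (rule continuous_zero_extension[OF open_OmR cF, where B=B])
      show "continuous_on UNIV B" unfolding B_def by (intro continuous_intros cv c\<Phi> continuous_U_nth)
      show "B x = 0" if "x \<notin> ?W" for x using v0[OF that] \<Phi>U0[OF that] by (simp add: B_def)
      fix x assume x: "x \<in> ?W"
      have k: "\<bar>du 1 j x\<bar> \<le> K" "\<bar>du 2 j x\<bar> \<le> K" "\<bar>du 3 j x\<bar> \<le> K" "\<bar>P x\<bar> \<le> K" "\<bar>N x\<bar> \<le> K"
        using sum5_le_each[OF abs_ge_zero abs_ge_zero abs_ge_zero abs_ge_zero abs_ge_zero K[OF x]] by blast+
      have m: "\<bar>a * c\<bar> \<le> K * \<bar>c\<bar>" if "\<bar>a\<bar> \<le> K" for a c using that by (simp add: abs_mult mult_right_mono)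
      have "F j x = du 1 j x * v 1 x + du 2 j x * v 2 x + du 3 j x * v 3 x - P x * v j x
         - hf * (N x * (\<Phi> (sq x) * U x $ j))" by (simp add: F_def algebra_simps)
      then show "\<bar>F j x\<bar> \<le> B x"
        unfolding B_def distrib_left hf_def using abs_sum5_le[OF m[OF k(1)] m[OF k(2)] m[OF k(3)] m[OF k(4)] m[OF k(5)]]
        by simp
    qed
  qed
  have int0: "integrable lborel (\<lambda>x. indicator ?W x * dF j x)" "(\<integral>x. indicator ?W x * dF j x \<partial>lborel) = 0" for j
  proof -
    obtain K where K: "\<And>x. x \<in> ?W \<Longrightarrow> \<bar>dF j x\<bar> \<le> K" using bdF[of j] by (auto simp: bdd_fun_def)
    have h: "has_pd j (\<lambda>x. if x \<in> ?W then F j x else 0) (dF j x) x" if "x \<in> ?W" for x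
      by (rule has_pd_cong[OF open_OmR that _ hF]) (use that OmR_subset in auto)
    show "integrable lborel (\<lambda>x. indicator ?W x * dF j x)" "(\<integral>x. indicator ?W x * dF j x \<partial>lborel) = 0"
      by (rule integral_pd_zero[OF open_OmR bounded_OmR FE _ h cdF K]; simp)+
  qed
  have eq: "dF 1 x + dF 2 x + dF 3 x = \<Phi> (sq x) * grad_sq u x + rest x" if x: "x \<in> Om" for x
  proof -
    have ux: "u x = U x" using x by (simp add: U_on)
    \<comment> \<open>The gradient of the cutoff contributes
      \<open>2 * \<phi>1 (sq x) * Q x\<close>, and the vertical derivative of the correction
      contributes its negative.\<close>
    have dvz: "dv 1 1 x + dv 2 2 x + dv 3 3 x = 0"
      using div_free[OF x] by (simp add: dv_def ds_def dPsi_def Q_def \<kappa>_def) algebra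
    \<comment> \<open>The momentum equation removes second derivatives and the pressure gradient.
      The convective term tested with \<Phi> u cancels against the divergence of \<Phi> |u|^2 u / 2,
      up to a term with \<open>\<phi>1\<close> and one with div u.\<close>
    have "dF 1 x + dF 2 x + dF 3 x = \<Phi> (sq x) * grad_sq u x + rest x - P x * (dv 1 1 x + dv 2 2 x + dv 3 3 x)
       - hf * \<Phi> (sq x) * N x * (du 1 1 x + du 2 2 x + du 3 3 x)"
      unfolding dF_def momentum[OF x] ux grad_sq_du rest_def sum_3
      by (simp add: v_def dv_def ds_def dPsi_def dN_def N_def Q_def \<kappa>_def hf_def power2_eq_square) (simp add: field_simps)
    then show ?thesis using dvz div_free[OF x] by simp
  qed
  have "(\<integral>x. indicator ?W x * (\<Phi> (sq x) * grad_sq u x + rest x) \<partial>lborel)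
     = (\<integral>x. indicator ?W x * dF 1 x + indicator ?W x * dF 2 x + indicator ?W x * dF 3 x \<partial>lborel)"
  proof (rule Bochner_Integration.integral_cong[OF refl])
    fix x show "indicator ?W x * (\<Phi> (sq x) * grad_sq u x + rest x) =
       indicator ?W x * dF 1 x + indicator ?W x * dF 2 x + indicator ?W x * dF 3 x"
      using eq[of x] OmR_subset[of R] by (cases "x \<in> ?W") auto
  qed
  also have "\<dots> = 0" using int0 by simp
  finally show ?thesis .
qed

end

section \<open>Estimates on vertical lines\<close>

lemma Cauchy_Schwarz_integral:
  fixes f g :: "'a \<Rightarrow> real"
  assumes m: "f \<in> borel_measurable M" "g \<in> borel_measurable M"
    and i: "integrable M (\<lambda>x. (f x)\<^sup>2)" "integrable M (\<lambda>x. (g x)\<^sup>2)"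
    and nn: "\<And>x. 0 \<le> f x" "\<And>x. 0 \<le> g x"
  shows "(\<integral>x. f x * g x \<partial>M) \<le> sqrt (\<integral>x. (f x)\<^sup>2 \<partial>M) * sqrt (\<integral>x. (g x)\<^sup>2 \<partial>M)"
proof -
  have fg: "integrable M (\<lambda>x. f x * g x)"
  proof (rule Bochner_Integration.integrable_bound[of M "\<lambda>x. (f x)\<^sup>2 + (g x)\<^sup>2"])
    show "AE x in M. norm (f x * g x) \<le> norm ((f x)\<^sup>2 + (g x)\<^sup>2)"
    proof (rule AE_I2)
      fix x
      have "0 \<le> (f x - g x)\<^sup>2" by simp
      then have "2 * (f x * g x) \<le> (f x)\<^sup>2 + (g x)\<^sup>2" by (simp add: power2_diff)
      moreover have "0 \<le> f x * g x" using nn by simp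
      ultimately show "norm (f x * g x) \<le> norm ((f x)\<^sup>2 + (g x)\<^sup>2)" by simp
    qed
  qed (use i m in auto)
  have "(\<integral>\<^sup>+x. ennreal (f x) * ennreal (g x) \<partial>M)\<^sup>2 \<le>
      (\<integral>\<^sup>+x. ennreal (f x) ^ 2 \<partial>M) * (\<integral>\<^sup>+x. ennreal (g x) ^ 2 \<partial>M)"
    using m by (intro Cauchy_Schwarz_nn_integral) auto
  also have "(\<integral>\<^sup>+x. ennreal (f x) ^ 2 \<partial>M) = ennreal (\<integral>x. (f x)\<^sup>2 \<partial>M)"
    using nn i by (subst nn_integral_eq_integral[symmetric]) (auto simp: ennreal_power)
  also have "(\<integral>\<^sup>+x. ennreal (g x) ^ 2 \<partial>M) = ennreal (\<integral>x. (g x)\<^sup>2 \<partial>M)"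
    using nn i by (subst nn_integral_eq_integral[symmetric]) (auto simp: ennreal_power)
  also have "(\<integral>\<^sup>+x. ennreal (f x) * ennreal (g x) \<partial>M) = ennreal (\<integral>x. f x * g x \<partial>M)"
    using nn fg by (subst nn_integral_eq_integral[symmetric]) (auto simp: ennreal_mult)
  finally have "ennreal ((\<integral>x. f x * g x \<partial>M)\<^sup>2) \<le> ennreal ((\<integral>x. (f x)\<^sup>2 \<partial>M) * (\<integral>x. (g x)\<^sup>2 \<partial>M))"
    using nn by (simp add: ennreal_power ennreal_mult Bochner_Integration.integral_nonneg)
  then have "(\<integral>x. f x * g x \<partial>M)\<^sup>2 \<le> (\<integral>x. (f x)\<^sup>2 \<partial>M) * (\<integral>x. (g x)\<^sup>2 \<partial>M)"
    by (simp add: Bochner_Integration.integral_nonneg)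
  then have "(\<integral>x. f x * g x \<partial>M) \<le> sqrt ((\<integral>x. (f x)\<^sup>2 \<partial>M) * (\<integral>x. (g x)\<^sup>2 \<partial>M))"
    by (rule real_le_rsqrt)
  then show ?thesis by (simp add: real_sqrt_mult)
qed

lemma norm_pair_real: "norm ((a, b) :: real \<times> real) = sqrt (a\<^sup>2 + b\<^sup>2)"
  by (simp add: norm_Pair)

lemma rad_vec3: "rad (vec3 (q, s)) = norm q"
  by (cases q) (simp add: norm_pair_real)

context axi_flow begin

text \<open>No decay at infinity is required: bounds on each truncated cylinder make integrals over
  cylinders and columns finite, and the class is closed under the operations that build the energy
  terms.\<close>

definition nice :: "(real^3 \<Rightarrow> real) \<Rightarrow> bool" where
  "nice h \<longleftrightarrow> continuous_on Om h \<and> (\<forall>R\<ge>0. bdd_fun (OmR R) h)"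

lemma nice_continuous: "continuous_on UNIV h \<Longrightarrow> nice h"
  unfolding nice_def using bdd_fun_continuous[OF bounded_OmR] continuous_on_subset by blast

lemma nice_const: "nice (\<lambda>x. c)" by (intro nice_continuous continuous_intros)

lemma nice_add: "nice f \<Longrightarrow> nice g \<Longrightarrow> nice (\<lambda>x. f x + g x)"
  by (auto simp: nice_def intro: bdd_fun_add continuous_intros)

lemma nice_diff: "nice f \<Longrightarrow> nice g \<Longrightarrow> nice (\<lambda>x. f x - g x)"
  by (auto simp: nice_def intro: bdd_fun_diff continuous_intros)

lemma nice_mult: "nice f \<Longrightarrow> nice g \<Longrightarrow> nice (\<lambda>x. f x * g x)"
  by (auto simp: nice_def intro: bdd_fun_mult continuous_intros)

lemma nice_power: "nice f \<Longrightarrow> nice (\<lambda>x. f x ^ k)"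
  by (auto simp: nice_def intro: bdd_fun_power continuous_intros)

lemma nice_abs: "nice f \<Longrightarrow> nice (\<lambda>x. \<bar>f x\<bar>)"
  by (auto simp: nice_def intro: bdd_fun_abs continuous_intros)

lemma nice_sqrt: "nice f \<Longrightarrow> nice (\<lambda>x. sqrt (f x))"
  by (auto simp: nice_def intro: bdd_fun_sqrt continuous_intros)

lemma nice_du: "nice (du i j)"
  by (simp add: nice_def continuous_du bdd_fun_OmR)

lemma nice_grad_sq: "nice (grad_sq u)"
  unfolding grad_sq_du[abs_def] sum_3 by (intro nice_add nice_power nice_du)

definition gn :: "real^3 \<Rightarrow> real" where "gn x = sqrt (grad_sq u x)"

lemma nice_gn: "nice gn" unfolding gn_def[abs_def] by (intro nice_sqrt nice_grad_sq)

lemma gn_nonneg: "0 \<le> gn x" by (simp add: gn_def grad_sq_nonneg)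

lemma gn_sq: "(gn x)\<^sup>2 = grad_sq u x" by (simp add: gn_def grad_sq_nonneg)

definition w :: "real^3 \<Rightarrow> real" where "w x = norm (U x)"

lemma w_nonneg: "0 \<le> w x" by (simp add: w_def)

lemma continuous_w: "continuous_on S w"
  unfolding w_def[abs_def] by (intro continuous_intros continuous_on_subset[OF continuous_U]) auto

lemma w_off: "x \<notin> Om \<Longrightarrow> w x = 0" by (simp add: w_def U_off)

lemmas nice_intros = nice_const nice_add nice_diff nice_mult nice_power nice_abs nice_du nice_grad_sq nice_gn
  nice_continuous[OF continuous_w] nice_continuous[OF continuous_on_rad] nice_continuous[OF continuous_Psi]
  nice_continuous[OF continuous_Q] nice_continuous[OF continuous_U_nth]

lemma nice_cylinder:
  assumes "nice h" "R \<ge> 0"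
  shows "integrable lborel (\<lambda>x. indicator (OmR R) x * h x)"
  using assms OmR_subset
  by (intro integrable_bdd_fun open_OmR bounded_OmR) (auto simp: nice_def intro: continuous_on_subset)

lemma nice_measurable: "nice h \<Longrightarrow> (\<lambda>x. indicator Om x * h x) \<in> borel_measurable borel"
  using borel_measurable_continuous_on_indicator[of Om h] open_Om by (simp add: nice_def)

lemma Om_vec3: "vec3 (q, s) \<in> Om \<longleftrightarrow> f1 (norm q) < s \<and> s < f2 (norm q)"
  by (simp add: domain_def rad_vec3) (simp add: vec3_def)

text \<open>Estimates are proved for the column above a single horizontal point and only then
  integrated over annuli in the plane.\<close>

definition vint :: "(real^3 \<Rightarrow> real) \<Rightarrow> real \<times> real \<Rightarrow> real" where
  "vint h q = (\<integral>s. indicator Om (vec3 (q, s)) * h (vec3 (q, s)) \<partial>lborel)"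

lemma measurable_vert: "nice h \<Longrightarrow> (\<lambda>s. indicator Om (vec3 (q, s)) * h (vec3 (q, s))) \<in> borel_measurable borel"
proof -
  assume "nice h"
  have "(\<lambda>s. vec3 (q, s)) \<in> borel_measurable borel"
    unfolding vec3_def by (intro borel_measurable_continuous_onI continuous_intros)
  from measurable_compose[OF this nice_measurable[OF \<open>nice h\<close>]] show ?thesis .
qed

lemma vert_integrable:
  assumes "nice h"
  shows "integrable lborel (\<lambda>s. indicator Om (vec3 (q, s)) * h (vec3 (q, s)))"
proof -
  have n: "norm q + 1 \<ge> 0" by simp
  obtain K where K: "\<And>x. x \<in> OmR (norm q + 1) \<Longrightarrow> \<bar>h x\<bar> \<le> K"
    using assms n unfolding nice_def bdd_fun_def by blast
  show ?thesis
  proof (rule integrable_lborel_bounded[OF measurable_vert[OF assms], where K="max K 0" and S="{f1 (norm q)..f2 (norm q)}"])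
    fix s
    show "\<bar>indicator Om (vec3 (q, s)) * h (vec3 (q, s))\<bar> \<le> max K 0"
      using K[of "vec3 (q, s)"] by (auto simp: indicator_def OmR_eq rad_vec3)
    show "s \<notin> {f1 (norm q)..f2 (norm q)} \<Longrightarrow> indicator Om (vec3 (q, s)) * h (vec3 (q, s)) = 0"
      by (auto simp: indicator_def Om_vec3)
  qed auto
qed

lemma vint_mono:
  assumes "nice f" "nice g" "\<And>s. vec3 (q, s) \<in> Om \<Longrightarrow> f (vec3 (q, s)) \<le> g (vec3 (q, s))"
  shows "vint f q \<le> vint g q"
  unfolding vint_def by (intro integral_mono vert_integrable assms) (use assms(3) in \<open>auto simp: indicator_def\<close>)

lemma vint_nonneg:
  assumes "\<And>s. vec3 (q, s) \<in> Om \<Longrightarrow> 0 \<le> f (vec3 (q, s))"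
  shows "0 \<le> vint f q"
  unfolding vint_def by (rule Bochner_Integration.integral_nonneg) (use assms in \<open>auto simp: indicator_def\<close>)

lemma vint_add: "nice f \<Longrightarrow> nice g \<Longrightarrow> vint (\<lambda>x. f x + g x) q = vint f q + vint g q"
  unfolding vint_def by (simp add: distrib_left vert_integrable)

lemma vint_cmult: "vint (\<lambda>x. c * f x) q = c * vint f q"
proof -
  have "vint (\<lambda>x. c * f x) q = (\<integral>s. c * (indicator Om (vec3 (q, s)) * f (vec3 (q, s))) \<partial>lborel)"
    unfolding vint_def by (simp add: mult.left_commute)
  then show ?thesis by (simp add: vint_def)
qed

lemma vint_one: "vint (\<lambda>x. 1) q = f2 (norm q) - f1 (norm q)"
proof -
  have "vint (\<lambda>x. 1) q = (\<integral>s. indicator {f1 (norm q)<..<f2 (norm q)} s \<partial>lborel)"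
    unfolding vint_def by (intro Bochner_Integration.integral_cong) (auto simp: indicator_def Om_vec3)
  then show ?thesis using f_less[of "norm q"] by simp
qed

lemma vint_CS:
  assumes "nice f" "nice g" "\<And>x. 0 \<le> f x" "\<And>x. 0 \<le> g x"
  shows "vint (\<lambda>x. f x * g x) q \<le> sqrt (vint (\<lambda>x. (f x)\<^sup>2) q) * sqrt (vint (\<lambda>x. (g x)\<^sup>2) q)"
proof -
  let ?i = "\<lambda>s. indicator Om (vec3 (q, s)) :: real"
  have e: "(?i s * f (vec3 (q, s))) * (?i s * g (vec3 (q, s))) = ?i s * (f (vec3 (q, s)) * g (vec3 (q, s)))"
    "(?i s * f (vec3 (q, s)))\<^sup>2 = ?i s * (f (vec3 (q, s)))\<^sup>2" for s f g
    by (auto simp: indicator_def)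
  have "(\<integral>s. (?i s * f (vec3 (q, s))) * (?i s * g (vec3 (q, s))) \<partial>lborel)
     \<le> sqrt (\<integral>s. (?i s * f (vec3 (q, s)))\<^sup>2 \<partial>lborel) * sqrt (\<integral>s. (?i s * g (vec3 (q, s)))\<^sup>2 \<partial>lborel)"
    by (rule Cauchy_Schwarz_integral)
       (use assms in \<open>auto simp: measurable_vert e(2) intro!: vert_integrable nice_power\<close>)
  then show ?thesis unfolding e vint_def .
qed

lemma vint_le_sqrt:
  assumes H: "f2 (norm q) - f1 (norm q) \<le> H" and f: "nice f" "\<And>x. 0 \<le> f x"
  shows "vint f q \<le> sqrt H * sqrt (vint (\<lambda>x. (f x)\<^sup>2) q)"
proof -
  have "vint (\<lambda>x. 1 * f x) q \<le> sqrt (vint (\<lambda>x. 1\<^sup>2) q) * sqrt (vint (\<lambda>x. (f x)\<^sup>2) q)"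
    by (rule vint_CS) (use f in \<open>auto intro: nice_const\<close>)
  also have "\<dots> \<le> sqrt H * sqrt (vint (\<lambda>x. (f x)\<^sup>2) q)"
    using H vint_nonneg[of q "\<lambda>x. (f x)\<^sup>2"] by (intro mult_right_mono) (auto simp: vint_one)
  finally show ?thesis by simp
qed

abbreviation "D \<equiv> vint (grad_sq u)"
abbreviation "m \<equiv> vint (\<lambda>x. (w x)\<^sup>2)"

lemma D_nonneg: "0 \<le> D q" by (intro vint_nonneg grad_sq_nonneg)
lemma m_nonneg: "0 \<le> m q" by (intro vint_nonneg) auto

section \<open>Estimates for one column\<close>

context
  fixes q :: "real \<times> real" and H :: real
  assumes H: "f2 (norm q) - f1 (norm q) \<le> H"
begin

lemma H_pos: "0 < H" using H f_less[of "norm q"] by simp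

text \<open>Integrate \<partial>_3 U_i upwards from the lower wall, where \<open>U\<close> vanishes,
  and use Cauchy-Schwarz on a segment of length at most \<open>H\<close>.\<close>

lemma U_nth_bound: "\<bar>U (vec3 (q, z)) $ i\<bar> \<le> sqrt H * sqrt (vint (\<lambda>x. (du i 3 x)\<^sup>2) q)"
proof (cases "vec3 (q, z) \<in> Om")
  case True
  then have z: "f1 (norm q) < z" "z < f2 (norm q)" by (auto simp: Om_vec3)
  obtain K where K: "\<And>x. x \<in> Om \<Longrightarrow> rad x \<le> norm q \<Longrightarrow> \<bar>du i 3 x\<bar> \<le> K"
    using bounded_derivs[of "norm q"] by metis
  have line: "vec3 (q, 0) + t *\<^sub>R axis 3 1 = vec3 (q, t)" for t by (simp add: vec3_def pt_add_axis)
  have 1: "integrable lborel (\<lambda>t. indicator {f1 (norm q)..z} t * (indicator Om (vec3 (q, t)) * du i 3 (vec3 (q, t))))"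
    and 2: "(\<integral>t. indicator {f1 (norm q)..z} t * (indicator Om (vec3 (q, t)) * du i 3 (vec3 (q, t))) \<partial>lborel)
      = U (vec3 (q, z)) $ i - U (vec3 (q, f1 (norm q))) $ i"
    using integral_pd_line[where G="\<lambda>x. U x $ i" and d="du i 3" and W=Om and x="vec3 (q, 0)" and j=3
        and a="f1 (norm q)" and b=z and K=K, OF open_Om continuous_U_nth _ has_pd_U continuous_du, unfolded line] z K
    by (auto simp: U_off rad_vec3)
  have "U (vec3 (q, f1 (norm q))) = 0" by (rule U_off) (simp add: Om_vec3)
  then have "\<bar>U (vec3 (q, z)) $ i\<bar> =
      \<bar>\<integral>t. indicator {f1 (norm q)..z} t * (indicator Om (vec3 (q, t)) * du i 3 (vec3 (q, t))) \<partial>lborel\<bar>"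
    using 2 by simp
  also have "\<dots> \<le> (\<integral>t. indicator Om (vec3 (q, t)) * \<bar>du i 3 (vec3 (q, t))\<bar> \<partial>lborel)"
    by (intro integral_abs_bound_integral 1 vert_integrable nice_abs nice_du)
       (auto simp: indicator_def)
  also have "\<dots> = vint (\<lambda>x. \<bar>du i 3 x\<bar>) q" by (simp add: vint_def)
  also have "\<dots> \<le> sqrt H * sqrt (vint (\<lambda>x. \<bar>du i 3 x\<bar>\<^sup>2) q)"
    by (rule vint_le_sqrt[OF H]) (auto intro: nice_intros)
  finally show ?thesis by simp
next
  case False
  have "0 \<le> vint (\<lambda>x. (du i 3 x)\<^sup>2) q" by (intro vint_nonneg) auto
  then show ?thesis using False H_pos by (simp add: U_off)
qed

lemma w_sq_bound: "(w (vec3 (q, z)))\<^sup>2 \<le> H * D q"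
proof -
  have p: "0 \<le> vint (\<lambda>x. (du i 3 x)\<^sup>2) q" for i by (intro vint_nonneg) auto
  have "(U (vec3 (q, z)) $ i)\<^sup>2 \<le> H * vint (\<lambda>x. (du i 3 x)\<^sup>2) q" for i
  proof -
    have "\<bar>U (vec3 (q, z)) $ i\<bar>\<^sup>2 \<le> (sqrt H * sqrt (vint (\<lambda>x. (du i 3 x)\<^sup>2) q))\<^sup>2"
      using U_nth_bound by (intro power_mono) auto
    then show ?thesis using H_pos p[of i] by (simp add: power_mult_distrib)
  qed
  then have "(w (vec3 (q, z)))\<^sup>2 \<le> H * vint (\<lambda>x. (du 1 3 x)\<^sup>2) q + H * vint (\<lambda>x. (du 2 3 x)\<^sup>2) q
     + H * vint (\<lambda>x. (du 3 3 x)\<^sup>2) q"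
    unfolding w_def norm3_sq by (intro add_mono) auto
  also have "\<dots> = H * vint (\<lambda>x. (du 1 3 x)\<^sup>2 + (du 2 3 x)\<^sup>2 + (du 3 3 x)\<^sup>2) q"
    by (simp add: vint_add nice_intros distrib_left)
  also have "\<dots> \<le> H * D q"
    using H_pos by (intro mult_left_mono vint_mono nice_intros) (auto simp: grad_sq_du sum_3)
  finally show ?thesis .
qed

lemma w_bound: "w (vec3 (q, z)) \<le> sqrt (H * D q)"
  using w_sq_bound real_le_rsqrt by blast

text \<open>Poincare's inequality for a column: the supremum bound times the height.\<close>

lemma m_bound: "m q \<le> H\<^sup>2 * D q"
proof -
  have "m q \<le> vint (\<lambda>x. (H * D q) * 1) q"
    by (intro vint_mono nice_intros) (use w_sq_bound in auto)
  also have "\<dots> = (H * D q) * (f2 (norm q) - f1 (norm q))" unfolding vint_cmult vint_one ..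
  also have "\<dots> \<le> (H * D q) * H" using H H_pos D_nonneg by (intro mult_left_mono) auto
  finally show ?thesis by (simp add: power2_eq_square mult_ac)
qed

lemma sqrt_m_bound: "sqrt (m q) \<le> H * sqrt (D q)"
proof -
  have "sqrt (m q) \<le> sqrt (H\<^sup>2 * D q)" using m_bound by simp
  then show ?thesis using H_pos by (simp add: real_sqrt_mult)
qed

lemma Psi_line_bound: "\<bar>Psi (vec3 (q, z))\<bar> \<le> norm q * (sqrt H * sqrt (m q))"
proof -
  have "\<bar>Psi (vec3 (q, z))\<bar> \<le> norm q * (\<integral>s. norm (U (vec3 (q, s))) \<partial>lborel)"
    using Psi_bound[of "vec3 (q, z)"] by (simp add: rad_vec3) (simp add: vec3_def)
  also have "(\<integral>s. norm (U (vec3 (q, s))) \<partial>lborel) = vint w q"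
    unfolding vint_def by (intro Bochner_Integration.integral_cong) (auto simp: indicator_def w_def U_off)
  also have "norm q * vint w q \<le> norm q * (sqrt H * sqrt (m q))"
    by (intro mult_left_mono vint_le_sqrt[OF H] nice_intros w_nonneg) auto
  finally show ?thesis .
qed

lemma vint_w_gn: "vint (\<lambda>x. w x * gn x) q \<le> sqrt (m q) * sqrt (D q)"
  using vint_CS[of w gn q] by (simp add: nice_intros w_nonneg gn_nonneg gn_sq)

lemma vint_gn: "vint gn q \<le> sqrt H * sqrt (D q)"
  using vint_le_sqrt[OF H nice_gn gn_nonneg] by (simp add: gn_sq)

lemma vint_w_gn': "vint (\<lambda>x. w x * gn x) q \<le> H * D q"
proof -
  have "sqrt (m q) * sqrt (D q) \<le> (H * sqrt (D q)) * sqrt (D q)"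
    using sqrt_m_bound by (intro mult_right_mono) (auto simp: D_nonneg)
  then show ?thesis using vint_w_gn D_nonneg[of q] by (simp add: mult.assoc)
qed

lemma vint_Psi_gn: "vint (\<lambda>x. \<bar>Psi x\<bar> * gn x) q \<le> norm q * (H\<^sup>2 * D q)"
proof -
  have "vint (\<lambda>x. \<bar>Psi x\<bar> * gn x) q \<le> vint (\<lambda>x. (norm q * (sqrt H * sqrt (m q))) * gn x) q"
    by (intro vint_mono nice_intros mult_right_mono Psi_line_bound gn_nonneg)
  also have "\<dots> = (norm q * (sqrt H * sqrt (m q))) * vint gn q" by (rule vint_cmult)
  also have "\<dots> \<le> (norm q * (sqrt H * (H * sqrt (D q)))) * (sqrt H * sqrt (D q))"
    using sqrt_m_bound vint_gn H_pos m_nonneg D_nonneg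
    by (intro mult_mono mult_left_mono vint_nonneg gn_nonneg) auto
  also have "\<dots> = norm q * ((sqrt H * sqrt H) * H * (sqrt (D q) * sqrt (D q)))" by (simp only: mult_ac)
  also have "\<dots> = norm q * (H\<^sup>2 * D q)" using H_pos D_nonneg[of q] by (simp add: power2_eq_square)
  finally show ?thesis .
qed

text \<open>The factor \<open>m q\<close> is deliberately not converted into \<open>D q\<close>: on
  an annulus \<open>m_sup\<close> bounds it uniformly, which leaves only the square root of
  \<open>D q\<close> to integrate. The bound on the cubic term has the same form for the same
  reason.\<close>

lemma vint_Psi_w_gn: "vint (\<lambda>x. \<bar>Psi x\<bar> * (w x * gn x)) q \<le> norm q * (m q * sqrt (H * D q))"
proof -
  have "vint (\<lambda>x. \<bar>Psi x\<bar> * (w x * gn x)) q \<le> vint (\<lambda>x. (norm q * (sqrt H * sqrt (m q))) * (w x * gn x)) q"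
    by (intro vint_mono nice_intros mult_right_mono Psi_line_bound mult_nonneg_nonneg gn_nonneg w_nonneg)
  also have "\<dots> = (norm q * (sqrt H * sqrt (m q))) * vint (\<lambda>x. w x * gn x) q" by (rule vint_cmult)
  also have "\<dots> \<le> (norm q * (sqrt H * sqrt (m q))) * (sqrt (m q) * sqrt (D q))"
    using vint_w_gn H_pos m_nonneg by (intro mult_left_mono) auto
  also have "\<dots> = norm q * ((sqrt (m q) * sqrt (m q)) * (sqrt H * sqrt (D q)))" by (simp only: mult_ac)
  also have "\<dots> = norm q * (m q * sqrt (H * D q))" using m_nonneg[of q] by (simp add: real_sqrt_mult)
  finally show ?thesis .
qed

lemma vint_w_cube: "vint (\<lambda>x. w x ^ 3) q \<le> m q * sqrt (H * D q)"
proof -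
  have "vint (\<lambda>x. w x ^ 3) q \<le> vint (\<lambda>x. sqrt (H * D q) * (w x)\<^sup>2) q"
  proof (intro vint_mono nice_intros)
    fix s
    have "w (vec3 (q, s)) ^ 3 = w (vec3 (q, s)) * (w (vec3 (q, s)))\<^sup>2" by (simp add: power3_eq_cube power2_eq_square)
    also have "\<dots> \<le> sqrt (H * D q) * (w (vec3 (q, s)))\<^sup>2" by (intro mult_right_mono w_bound) auto
    finally show "w (vec3 (q, s)) ^ 3 \<le> sqrt (H * D q) * (w (vec3 (q, s)))\<^sup>2" .
  qed
  then show ?thesis by (simp add: vint_cmult mult.commute)
qed

end

end

section \<open>Annuli\<close>

text \<open>Half-open, so that an annulus is a difference of open discs, matching the strict
  inequality in \<open>domain_R\<close>.\<close>

definition ann :: "real \<Rightarrow> real \<Rightarrow> (real \<times> real) set" where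
  "ann R R' = {q. R \<le> norm q \<and> norm q < R'}"

lemma ann_borel [measurable]: "ann R R' \<in> sets borel"
proof -
  have "ann R R' = ball 0 R' - ball 0 R" by (auto simp: ann_def)
  then show ?thesis by simp
qed

lemma indicator_ann: "R \<le> R' \<Longrightarrow> indicator (ann R R') q = indicator (ball 0 R') q - (indicator (ball 0 R) q :: real)"
  by (auto simp: ann_def indicator_def)

lemma measure_ann:
  assumes "0 \<le> R" "R \<le> R'"
  shows "integrable lborel (\<lambda>q. indicator (ann R R') q :: real)"
    and "(\<integral>q. indicator (ann R R') q \<partial>lborel) = pi * (R'\<^sup>2 - R\<^sup>2)"
proof -
  have b: "integrable lborel (\<lambda>q::real\<times>real. indicator (ball 0 r) q :: real)" for r
    using emeasure_lborel_ball_finite[of "0::real\<times>real" r]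
    by (intro integrable_real_indicator) (auto simp: less_top)
  have c: "measure lborel (ball (0::real\<times>real) r) = pi * r\<^sup>2" if "r \<ge> 0" for r
    using content_ball[OF that, of "0::real\<times>real"] by (simp add: unit_ball_vol_2 power2_eq_square mult.commute)
  show "integrable lborel (\<lambda>q. indicator (ann R R') q :: real)"
    unfolding indicator_ann[OF assms(2)] using b by simp
  show "(\<integral>q. indicator (ann R R') q \<partial>lborel) = pi * (R'\<^sup>2 - R\<^sup>2)"
    unfolding indicator_ann[OF assms(2)] using b c[of R] c[of R'] assms
    by (simp add: algebra_simps)
qed

context axi_flow begin

lemma cyl_fubini:
  assumes h: "nice h" and R: "R \<ge> 0"
  shows "integrable lborel (\<lambda>q. indicator (ball 0 R) q * vint h q)"
    and "(\<integral>q. indicator (ball 0 R) q * vint h q \<partial>lborel) = (\<integral>x. indicator (OmR R) x * h x \<partial>lborel)"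
proof -
  let ?h = "\<lambda>x. indicator (OmR R) x * h x"
  have i: "integrable lborel ?h" by (rule nice_cylinder[OF assms])
  then have hm: "?h \<in> borel_measurable borel" by simp
  have vi: "integrable lborel (\<lambda>p. ?h (vec3 p))" using i integrable_vec3_iff[OF hm] by simp
  have "(\<integral>s. ?h (vec3 (q, s)) \<partial>lborel) = indicator (ball 0 R) q * vint h q" for q
  proof -
    have "?h (vec3 (q, s)) = indicator (ball 0 R) q * (indicator Om (vec3 (q, s)) * h (vec3 (q, s)))" for s
      using R by (auto simp: indicator_def OmR_eq rad_vec3)
    then have "(\<integral>s. ?h (vec3 (q, s)) \<partial>lborel)
        = (\<integral>s. indicator (ball 0 R) q * (indicator Om (vec3 (q, s)) * h (vec3 (q, s))) \<partial>lborel)"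
      by (intro Bochner_Integration.integral_cong) auto
    then show ?thesis by (simp add: vint_def)
  qed
  then show "integrable lborel (\<lambda>q. indicator (ball 0 R) q * vint h q)"
    "(\<integral>q. indicator (ball 0 R) q * vint h q \<partial>lborel) = (\<integral>x. indicator (OmR R) x * h x \<partial>lborel)"
    using integral_lborel_fst[OF vi] integral_vec3[OF hm] by simp_all
qed

definition Y :: "real \<Rightarrow> real" where "Y R = (\<integral>x. indicator (OmR R) x * grad_sq u x \<partial>lborel)"

lemma ann_fubini:
  assumes h: "nice h" and R: "0 \<le> R" "R \<le> R'"
  shows "integrable lborel (\<lambda>q. indicator (ann R R') q * vint h q)"
    and "(\<integral>q. indicator (ann R R') q * vint h q \<partial>lborel) =
      (\<integral>x. indicator (OmR R') x * h x \<partial>lborel) - (\<integral>x. indicator (OmR R) x * h x \<partial>lborel)"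
  using cyl_fubini[OF h, of R] cyl_fubini[OF h, of R'] R
  by (simp_all add: indicator_ann left_diff_distrib)

lemma ann_D:
  assumes R: "0 \<le> R" "R \<le> R'"
  shows "(\<integral>q. indicator (ann R R') q * D q \<partial>lborel) = Y R' - Y R"
  using ann_fubini(2)[OF nice_grad_sq R] by (simp add: Y_def)

lemma slice_integrable:
  assumes h: "nice h"
  shows "integrable lborel (\<lambda>p. indicator {a..b} (fst p) * (indicator Om (pt (fst p) y (snd p)) * h (pt (fst p) y (snd p))))"
    (is "integrable lborel ?H")
proof -
  have "(\<lambda>p. pt (fst p) y (snd p)) \<in> borel_measurable borel"
    by (intro borel_measurable_continuous_onI continuous_intros)
  from measurable_compose[OF this nice_measurable[OF h]]
  have m1: "(\<lambda>p. indicator Om (pt (fst p) y (snd p)) * h (pt (fst p) y (snd p))) \<in> borel_measurable borel" .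
  have "(\<lambda>p::real\<times>real. indicator ({a..b} \<times> UNIV) p :: real) \<in> borel_measurable borel"
    by (intro borel_measurable_indicator borel_closed closed_Times) auto
  from borel_measurable_times[OF this m1] have m: "?H \<in> borel_measurable borel"
    by (rule back_subst[of "\<lambda>f. f \<in> borel_measurable borel"]) (auto simp: indicator_def fun_eq_iff)
  define R where "R = \<bar>a\<bar> + \<bar>b\<bar> + \<bar>y\<bar> + 1"
  have R: "R \<ge> 0" by (simp add: R_def)
  obtain K where K: "\<And>x. x \<in> OmR R \<Longrightarrow> \<bar>h x\<bar> \<le> K"
    using h R unfolding nice_def bdd_fun_def by blast
  obtain B where B: "\<And>x. x \<in> OmR R \<Longrightarrow> norm x \<le> B" using bounded_OmR[of R] by (auto simp: bounded_iff)
  have in_OmR: "pt t y s \<in> OmR R" if "t \<in> {a..b}" "pt t y s \<in> Om" for t s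
  proof -
    have "rad (pt t y s) \<le> \<bar>t\<bar> + \<bar>y\<bar>" by (simp add: sqrt_sum_squares_le_sum_abs)
    then have "rad (pt t y s) < R" using that by (auto simp: R_def)
    then show ?thesis using that R by (simp add: OmR_eq del: rad_pt)
  qed
  show ?thesis
  proof (rule integrable_lborel_bounded[OF m, where K="max K 0" and S="{a..b} \<times> {-B..B}"])
    fix p
    show "\<bar>?H p\<bar> \<le> max K 0"
      using K[OF in_OmR, of "fst p" "snd p"] by (auto simp: indicator_def)
    show "?H p = 0" if "p \<notin> {a..b} \<times> {-B..B}"
    proof (rule ccontr)
      assume "?H p \<noteq> 0"
      then have "fst p \<in> {a..b}" "pt (fst p) y (snd p) \<in> Om" by (auto simp: indicator_def split: if_splits)
      then have "\<bar>snd p\<bar> \<le> B" using B[OF in_OmR] component_le_norm_cart[of "pt (fst p) y (snd p)" 3]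
        by (metis order_trans pt_nth(3))
      then show False using that \<open>fst p \<in> {a..b}\<close> by (cases p) auto
    qed
  qed (auto intro: bounded_Times)
qed

lemma slice_vint:
  assumes h: "nice h"
  shows "integrable lborel (\<lambda>t. indicator {a..b} t * vint h (t, y))"
    and "(\<integral>t. indicator {a..b} t * vint h (t, y) \<partial>lborel) =
      (\<integral>s. (\<integral>t. indicator {a..b} t * (indicator Om (pt t y s) * h (pt t y s)) \<partial>lborel) \<partial>lborel)"
  using integral_lborel_fst[OF slice_integrable[OF h, of a b y]]
    integral_lborel_snd(1)[OF slice_integrable[OF h, of a b y]]
  by (simp_all add: vint_def)

lemma m_radial: "norm q = norm q' \<Longrightarrow> m q = m q'"
proof -
  assume q: "norm q = norm q'"
  have "w (vec3 (q, s)) = w (vec3 (q', s))" for s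
    unfolding w_def by (rule norm_U_radial) (simp_all add: rad_vec3 q, simp add: vec3_def)
  then show ?thesis
    unfolding vint_def using q by (simp add: indicator_def Om_vec3)
qed

text \<open>Along a line in direction x_1 the density |U|^2 changes at a rate of at most 2 |u|
  |\<nabla>u|. The zero extension lets the line leave and re-enter the domain, and Fubini over the
  heights reassembles columns.\<close>

lemma m_diff:
  assumes ab: "a \<le> b"
  shows "\<bar>m (b, y) - m (a, y)\<bar> \<le> 2 * (\<integral>t. indicator {a..b} t * vint (\<lambda>x. w x * gn x) (t, y) \<partial>lborel)"
proof -
  define N where "N x = (w x)\<^sup>2" for x
  define dN where "dN x = 2 * (U x $ 1 * du 1 1 x + U x $ 2 * du 2 1 x + U x $ 3 * du 3 1 x)" for x
  have N_eq: "N x = U x $ 1 * U x $ 1 + U x $ 2 * U x $ 2 + U x $ 3 * U x $ 3" for x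
    unfolding N_def w_def norm3_sq by (simp add: power2_eq_square)
  have cN: "continuous_on UNIV N" unfolding N_def by (intro continuous_intros continuous_w)
  have N0: "N x = 0" if "x \<notin> Om" for x using that by (simp add: N_def w_off)
  have hN: "has_pd 1 N (dN x) x" if "x \<in> Om" for x
  proof -
    have "has_pd 1 N ((du 1 1 x * U x $ 1 + U x $ 1 * du 1 1 x) + (du 2 1 x * U x $ 2 + U x $ 2 * du 2 1 x)
       + (du 3 1 x * U x $ 3 + U x $ 3 * du 3 1 x)) x"
      unfolding N_eq[abs_def] by (intro has_pd_add has_pd_mult has_pd_U that)
    then show ?thesis by (simp add: dN_def algebra_simps)
  qed
  have ndN: "nice dN" unfolding dN_def by (intro nice_intros)
  have dNb: "\<bar>dN x\<bar> \<le> 2 * (w x * gn x)" for x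
  proof -
    define d where "d = pt (du 1 1 x) (du 2 1 x) (du 3 1 x)"
    have "dN x = 2 * (U x \<bullet> d)" by (simp add: dN_def d_def inner_vec_def sum_3)
    moreover have "\<bar>U x \<bullet> d\<bar> \<le> norm (U x) * norm d" by (rule Cauchy_Schwarz_ineq2)
    moreover have "norm d \<le> gn x"
    proof -
      have "(norm d)\<^sup>2 \<le> grad_sq u x" unfolding norm3_sq grad_sq_du sum_3 by (simp add: d_def)
      then show ?thesis unfolding gn_def by (rule real_le_rsqrt)
    qed
    ultimately show ?thesis
      using mult_left_mono[of "norm d" "gn x" "norm (U x)"] by (simp add: w_def abs_mult)
  qed
  have line: "(\<integral>t. indicator {a..b} t * (indicator Om (pt t y s) * dN (pt t y s)) \<partial>lborel) = N (pt b y s) - N (pt a y s)" for s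
  proof -
    obtain K where K: "\<And>x. x \<in> OmR (\<bar>a\<bar> + \<bar>b\<bar> + \<bar>y\<bar> + 1) \<Longrightarrow> \<bar>dN x\<bar> \<le> K"
      using ndN unfolding nice_def bdd_fun_def by (metis abs_ge_zero add_nonneg_nonneg zero_le_one)
    have l: "pt 0 y s + t *\<^sub>R axis 1 1 = pt t y s" for t by (simp add: pt_add_axis)
    show ?thesis
    proof (rule integral_pd_line(2)[OF open_Om cN N0 hN _ _ ab, where x="pt 0 y s" and K=K, unfolded l])
      show "continuous_on Om dN" using ndN by (simp add: nice_def)
      fix t assume t: "a \<le> t" "t \<le> b" "pt t y s \<in> Om"
      have "rad (pt t y s) \<le> \<bar>t\<bar> + \<bar>y\<bar>" by (simp add: sqrt_sum_squares_le_sum_abs)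
      then have "rad (pt t y s) < \<bar>a\<bar> + \<bar>b\<bar> + \<bar>y\<bar> + 1" using t by auto
      then show "\<bar>dN (pt t y s)\<bar> \<le> K" using t by (intro K) (simp add: OmR_eq del: rad_pt)
    qed
  qed
  have mN: "m (c, y) = (\<integral>s. N (pt c y s) \<partial>lborel)" for c
    unfolding vint_def by (intro Bochner_Integration.integral_cong) (auto simp: N_def indicator_def w_off)
  have "m (b, y) - m (a, y) = (\<integral>s. N (pt b y s) - N (pt a y s) \<partial>lborel)"
    unfolding mN by (rule Bochner_Integration.integral_diff[symmetric]; rule integrable_vert[OF cN N0])
  also have "\<dots> = (\<integral>t. indicator {a..b} t * vint dN (t, y) \<partial>lborel)"
    unfolding slice_vint(2)[OF ndN] line ..
  finally have e: "m (b, y) - m (a, y) = (\<integral>t. indicator {a..b} t * vint dN (t, y) \<partial>lborel)" .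
  have "\<bar>\<integral>t. indicator {a..b} t * vint dN (t, y) \<partial>lborel\<bar> \<le> (\<integral>t. indicator {a..b} t * vint (\<lambda>x. 2 * (w x * gn x)) (t, y) \<partial>lborel)"
  proof (rule integral_abs_bound_integral)
    show "integrable lborel (\<lambda>t. indicator {a..b} t * vint dN (t, y))" by (rule slice_vint(1)[OF ndN])
    show "integrable lborel (\<lambda>t. indicator {a..b} t * vint (\<lambda>x. 2 * (w x * gn x)) (t, y))"
      by (intro slice_vint(1) nice_intros)
    fix t
    have "\<bar>vint dN (t, y)\<bar> \<le> vint (\<lambda>x. 2 * (w x * gn x)) (t, y)"
      unfolding vint_def
      by (rule integral_abs_bound_integral; (intro vert_integrable nice_intros ndN)?)
         (use dNb in \<open>auto simp: indicator_def\<close>)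
    then show "\<bar>indicator {a..b} t * vint dN (t, y)\<bar> \<le> indicator {a..b} t * vint (\<lambda>x. 2 * (w x * gn x)) (t, y)"
      by (auto simp: indicator_def)
  qed
  also have "\<dots> = 2 * (\<integral>t. indicator {a..b} t * vint (\<lambda>x. w x * gn x) (t, y) \<partial>lborel)"
  proof -
    have vc: "vint (\<lambda>x. 2 * (w x * gn x)) (t, y) = 2 * vint (\<lambda>x. w x * gn x) (t, y)" for t
      by (rule vint_cmult)
    have "(\<integral>t. indicator {a..b} t * vint (\<lambda>x. 2 * (w x * gn x)) (t, y) \<partial>lborel)
        = (\<integral>t. 2 * (indicator {a..b} t * vint (\<lambda>x. w x * gn x) (t, y)) \<partial>lborel)"
      by (rule Bochner_Integration.integral_cong[OF refl]) (simp only: vc mult.left_commute[of _ 2])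
    also have "\<dots> = 2 * (\<integral>t. indicator {a..b} t * vint (\<lambda>x. w x * gn x) (t, y) \<partial>lborel)"
      by (rule integral_mult_right_zero)
    finally show ?thesis .
  qed
  finally show ?thesis unfolding e .
qed

lemma ann_slice_integrable:
  assumes h: "nice h"
  shows "integrable lborel (\<lambda>t. indicator (ann R R') (t, y) * vint h (t, y))"
proof -
  have "(\<lambda>t. (t, y)) \<in> borel_measurable borel"
    by (intro borel_measurable_continuous_onI continuous_intros)
  from measurable_compose[OF this borel_measurable_indicator[OF ann_borel]]
  have m: "(\<lambda>t. indicator (ann R R') (t, y) :: real) \<in> borel_measurable borel" .
  have i: "integrable lborel (\<lambda>t. indicator {-R'..R'} t * vint h (t, y))" by (rule slice_vint(1)[OF h])
  have "integrable lborel (\<lambda>t. indicator (ann R R') (t, y) * (indicator {-R'..R'} t * vint h (t, y)))"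
    by (rule Bochner_Integration.integrable_bound[OF i])
       (use m i in \<open>auto simp: indicator_def dest: borel_measurable_integrable\<close>)
  moreover have "indicator (ann R R') (t, y) * (indicator {-R'..R'} t * vint h (t, y)) = indicator (ann R R') (t, y) * vint h (t, y)" for t
  proof -
    have "\<bar>t\<bar> \<le> norm (t, y)" by (simp add: norm_pair_real)
    then show ?thesis by (auto simp: indicator_def ann_def)
  qed
  ultimately show ?thesis by simp
qed

text \<open>A radial quantity is estimated along the lines \<open>x\<^sub>2 = y\<close>, \<open>0 \<le> y \<le> R/2\<close>, all of which
  cross the annulus in segments of length at least its width; this replaces polar coordinates.\<close>

lemma m_sup:
  assumes R: "0 < R" "0 < L" and q0: "q0 \<in> ann R (R + L)"
  shows "R / 2 * m q0 \<le> (\<integral>q. indicator (ann R (R + L)) q * m q \<partial>lborel) / L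
      + 2 * (\<integral>q. indicator (ann R (R + L)) q * vint (\<lambda>x. w x * gn x) q \<partial>lborel)"
proof -
  let ?A = "ann R (R + L)"
  let ?wg = "\<lambda>x. w x * gn x"
  define Bm where "Bm y = (\<integral>t. indicator ?A (t, y) * m (t, y) \<partial>lborel)" for y
  define Bw where "Bw y = (\<integral>t. indicator ?A (t, y) * vint ?wg (t, y) \<partial>lborel)" for y
  have nm: "nice (\<lambda>x. (w x)\<^sup>2)" and nw: "nice ?wg" by (intro nice_intros)+
  have wg0: "0 \<le> vint ?wg q" for q by (intro vint_nonneg mult_nonneg_nonneg w_nonneg gn_nonneg)
  have Bm0: "0 \<le> Bm y" "0 \<le> Bw y" for y
    unfolding Bm_def Bw_def using m_nonneg wg0 by (auto intro!: Bochner_Integration.integral_nonneg)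
  have RL: "0 \<le> R" "R \<le> R + L" using R by auto
  have iBm: "integrable lborel Bm" "(\<integral>y. Bm y \<partial>lborel) = (\<integral>q. indicator ?A q * m q \<partial>lborel)"
    unfolding Bm_def[abs_def] using integral_lborel_snd[OF ann_fubini(1)[OF nm RL]] by auto
  have iBw: "integrable lborel Bw" "(\<integral>y. Bw y \<partial>lborel) = (\<integral>q. indicator ?A q * vint ?wg q \<partial>lborel)"
    unfolding Bw_def[abs_def] using integral_lborel_snd[OF ann_fubini(1)[OF nw RL]] by auto
  have key: "m q0 \<le> Bm y / L + 2 * Bw y" if y: "0 \<le> y" "y \<le> R / 2" for y
  proof -
    \<comment> \<open>On this line the annulus contains the first coordinates from \<alpha> up to
      \<alpha>', and \<open>x0\<close> marks the point at the same radius as \<open>q0\<close>,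
      where \<open>m\<close> takes the same value by symmetry.\<close>
    define \<alpha> where "\<alpha> = sqrt (R\<^sup>2 - y\<^sup>2)"
    define \<alpha>' where "\<alpha>' = sqrt ((R + L)\<^sup>2 - y\<^sup>2)"
    define x0 where "x0 = sqrt ((norm q0)\<^sup>2 - y\<^sup>2)"
    have yR: "y\<^sup>2 \<le> R\<^sup>2" using y R by (intro power_mono) auto
    have n0: "R \<le> norm q0" "norm q0 < R + L" using q0 by (auto simp: ann_def)
    have n0': "R\<^sup>2 \<le> (norm q0)\<^sup>2" "(norm q0)\<^sup>2 < (R + L)\<^sup>2"
      using n0 R by (auto intro: power_mono power_strict_mono)
    have \<alpha>0: "0 \<le> \<alpha>" using yR by (simp add: \<alpha>_def)
    have x0: "\<alpha> \<le> x0" "x0 < \<alpha>'" unfolding \<alpha>_def x0_def \<alpha>'_def using n0' by auto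
    \<comment> \<open>Since \<alpha> \<le> R, adding L to \<alpha> raises its square by no more than
      adding L to R does.\<close>
    have \<alpha>L: "\<alpha> + L \<le> \<alpha>'"
    proof -
      have "\<alpha> \<le> R" unfolding \<alpha>_def using R by (intro real_le_lsqrt) auto
      then have "2 * \<alpha> * L \<le> 2 * R * L" using R by simp
      moreover have "\<alpha>\<^sup>2 = R\<^sup>2 - y\<^sup>2" using yR by (simp add: \<alpha>_def)
      ultimately have "(\<alpha> + L)\<^sup>2 \<le> (R + L)\<^sup>2 - y\<^sup>2" by (simp add: power2_sum)
      then show ?thesis unfolding \<alpha>'_def by (rule real_le_rsqrt)
    qed
    have inA: "(t, y) \<in> ?A" if "\<alpha> \<le> t" "t < \<alpha>'" for t
    proof -
      have "\<alpha>\<^sup>2 \<le> t\<^sup>2" "t\<^sup>2 < \<alpha>'\<^sup>2" using that \<alpha>0 by (auto intro: power_mono power_strict_mono)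
      moreover have "\<alpha>\<^sup>2 = R\<^sup>2 - y\<^sup>2" "\<alpha>'\<^sup>2 = (R + L)\<^sup>2 - y\<^sup>2"
        using yR n0' by (auto simp: \<alpha>_def \<alpha>'_def)
      ultimately have "R\<^sup>2 \<le> t\<^sup>2 + y\<^sup>2" "t\<^sup>2 + y\<^sup>2 < (R + L)\<^sup>2" by auto
      moreover from this(2) have "sqrt (t\<^sup>2 + y\<^sup>2) < R + L"
        using R real_sqrt_less_mono[of "t\<^sup>2 + y\<^sup>2" "(R + L)\<^sup>2"] by simp
      ultimately show ?thesis by (auto simp: ann_def norm_pair_real real_le_rsqrt)
    qed
    have mq0: "m q0 = m (x0, y)"
    proof (rule m_radial)
      have "x0\<^sup>2 = (norm q0)\<^sup>2 - y\<^sup>2" using n0' yR by (simp add: x0_def)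
      then show "norm q0 = norm (x0, y)" by (simp add: norm_pair_real)
    qed
    have le1: "m q0 \<le> m (x, y) + 2 * Bw y" if x: "\<alpha> \<le> x" "x < \<alpha>'" for x
    proof -
      define a b where "a = min x x0" and "b = max x x0"
      have ab: "a \<le> b" "\<alpha> \<le> a" "b < \<alpha>'" using x x0 by (auto simp: a_def b_def)
      have "m q0 - m (x, y) \<le> \<bar>m (b, y) - m (a, y)\<bar>"
        unfolding mq0 a_def b_def by (auto simp: max_def min_def)
      also have "\<dots> \<le> 2 * (\<integral>t. indicator {a..b} t * vint ?wg (t, y) \<partial>lborel)" by (rule m_diff[OF ab(1)])
      also have "(\<integral>t. indicator {a..b} t * vint ?wg (t, y) \<partial>lborel) \<le> Bw y"
        unfolding Bw_def
      proof (rule integral_mono[OF slice_vint(1)[OF nw] ann_slice_integrable[OF nw]])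
        fix t show "indicator {a..b} t * vint ?wg (t, y) \<le> indicator ?A (t, y) * vint ?wg (t, y)"
          using inA[of t] ab wg0[of "(t, y)"] by (auto simp: indicator_def)
      qed
      finally show ?thesis by simp
    qed
    \<comment> \<open>Averaging over the first stretch of length \<open>L\<close> replaces the
      unknown value \<open>m (x, y)\<close> by a line integral.\<close>
    have "(\<integral>x. indicator {\<alpha>..<\<alpha> + L} x * (m q0 - 2 * Bw y) \<partial>lborel) \<le> Bm y"
      unfolding Bm_def
    proof (rule integral_mono[OF _ ann_slice_integrable[OF nm]])
      show "integrable lborel (\<lambda>x. indicator {\<alpha>..<\<alpha> + L} x * (m q0 - 2 * Bw y))" using R by simp
      fix t show "indicator {\<alpha>..<\<alpha> + L} t * (m q0 - 2 * Bw y) \<le> indicator ?A (t, y) * m (t, y)"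
        using inA[of t] le1[of t] \<alpha>L m_nonneg[of "(t, y)"] by (auto simp: indicator_def)
    qed
    then have "L * (m q0 - 2 * Bw y) \<le> Bm y" using R by simp
    then show ?thesis using R by (simp add: field_simps)
  qed
  \<comment> \<open>Integrating in \<open>y\<close> turns the line integrals into integrals over the
    annulus; the length of the range gives the factor R/2.\<close>
  have "(\<integral>y. indicator {0..R / 2} y * m q0 \<partial>lborel) \<le> (\<integral>y. Bm y / L + 2 * Bw y \<partial>lborel)"
  proof (rule integral_mono)
    show "integrable lborel (\<lambda>y. indicator {0..R / 2} y * m q0)" using R by simp
    show "integrable lborel (\<lambda>y. Bm y / L + 2 * Bw y)" using iBm(1) iBw(1) by simp
    fix y show "indicator {0..R / 2} y * m q0 \<le> Bm y / L + 2 * Bw y"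
      using key[of y] Bm0[of y] R by (auto simp: indicator_def)
  qed
  then show ?thesis using R iBm iBw by simp
qed

end

section \<open>The cutoff and the energy inequality\<close>

text \<open>At 0 the difference quotient is dominated by |s|^(n+1), hence the exponent of at least
  2.\<close>

lemma DERIV_max_power:
  "((\<lambda>t::real. (max 0 t) ^ Suc (Suc n)) has_real_derivative (real (Suc (Suc n)) * (max 0 t) ^ Suc n)) (at t)"
proof -
  consider "t > 0" | "t < 0" | "t = 0" by linarith
  then show ?thesis
  proof cases
    case 1
    have D: "((\<lambda>t::real. t ^ Suc (Suc n)) has_real_derivative (real (Suc (Suc n)) * t ^ Suc n)) (at t)"
      using DERIV_pow[of "Suc (Suc n)" t UNIV] by simp
    have "\<forall>\<^sub>F s in nhds t. s \<in> {0<..}" using 1 by (intro eventually_nhds_in_open) auto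
    then have "\<forall>\<^sub>F s in nhds t. s ^ Suc (Suc n) = (max 0 s) ^ Suc (Suc n)"
      by (rule eventually_mono) (auto simp: max_def)
    then show ?thesis using D 1 by (subst (asm) DERIV_cong_ev[OF refl _ refl]) (auto simp: max_def)
  next
    case 2
    have "\<forall>\<^sub>F s in nhds t. s \<in> {..<0}" using 2 by (intro eventually_nhds_in_open) auto
    then have "\<forall>\<^sub>F s in nhds t. 0 = (max 0 s) ^ Suc (Suc n)"
      by (rule eventually_mono) (auto simp: max_def)
    then have "((\<lambda>s. (max 0 s) ^ Suc (Suc n)) has_real_derivative 0) (at t)"
      using DERIV_cong_ev[OF refl, of "\<lambda>s. 0" "\<lambda>s. (max 0 s) ^ Suc (Suc n)" t 0 0] by simp
    then show ?thesis using 2 by (simp add: max_def)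
  next
    case 3
    have "((\<lambda>s. ((max 0 s) ^ Suc (Suc n) - (max 0 0) ^ Suc (Suc n)) / (s - 0)) \<longlongrightarrow> 0) (at (0::real))"
    proof (rule Lim_null_comparison[where g="\<lambda>s. \<bar>s\<bar> ^ Suc n"])
      show "\<forall>\<^sub>F s in at (0::real). norm (((max 0 s) ^ Suc (Suc n) - (max 0 0) ^ Suc (Suc n)) / (s - 0)) \<le> \<bar>s\<bar> ^ Suc n"
      proof -
        have "norm (((max 0 s) ^ Suc (Suc n) - (max 0 0) ^ Suc (Suc n)) / (s - 0)) \<le> \<bar>s\<bar> ^ Suc n" for s :: real
        proof (cases "s > 0")
          case True
          then show ?thesis by simp
        next
          case False
          then have "max 0 s = 0" by simp
          then have "norm (((max 0 s) ^ Suc (Suc n) - (max 0 0) ^ Suc (Suc n)) / (s - 0)) = 0" by simp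
          then show ?thesis by (simp only: zero_le_power_abs)
        qed
        then show ?thesis by (intro always_eventually allI)
      qed
      show "((\<lambda>s. \<bar>s\<bar> ^ Suc n) \<longlongrightarrow> 0) (at (0::real))"
        by (rule tendsto_eq_intros refl | simp)+
    qed
    then show ?thesis using 3 by (simp add: has_field_derivative_iff)
  qed
qed

text \<open>A cutoff from \<open>1\<close> (for \<open>t \<le> 0\<close>) to \<open>0\<close> (for \<open>t \<ge> 1\<close>), equal to \<open>(1 - t\<^sup>3)\<^sup>4\<close> in between; the
  exponents make it twice continuously differentiable with both derivatives dominated by its square root.\<close>

definition cutoff :: "real \<Rightarrow> real" where "cutoff t = (max 0 (1 - (max 0 t) ^ 3)) ^ 4"
definition cutoff1 :: "real \<Rightarrow> real" where
  "cutoff1 t = - (12 * (max 0 (1 - (max 0 t) ^ 3)) ^ 3 * (max 0 t)\<^sup>2)"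
definition cutoff2 :: "real \<Rightarrow> real" where
  "cutoff2 t = 108 * (max 0 (1 - (max 0 t) ^ 3))\<^sup>2 * (max 0 t) ^ 4 - 24 * (max 0 (1 - (max 0 t) ^ 3)) ^ 3 * max 0 t"

lemma DERIV_max_3: "((\<lambda>t::real. (max 0 t) ^ 3) has_real_derivative (3 * (max 0 t)\<^sup>2)) (at t)"
  using DERIV_max_power[of 1 t] by (simp add: numeral_3_eq_3 numeral_2_eq_2)

lemma DERIV_max_2: "((\<lambda>t::real. (max 0 t)\<^sup>2) has_real_derivative (2 * max 0 t)) (at t)"
  using DERIV_max_power[of 0 t] by (simp add: numeral_2_eq_2)

lemma DERIV_max_4: "((\<lambda>t::real. (max 0 t) ^ 4) has_real_derivative (4 * (max 0 t) ^ 3)) (at t)"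
  using DERIV_max_power[of 2 t] by (simp add: eval_nat_numeral)

lemma DERIV_cutoff: "(cutoff has_real_derivative cutoff1 t) (at t)"
proof -
  have "((\<lambda>t::real. 1 - (max 0 t) ^ 3) has_real_derivative - (3 * (max 0 t)\<^sup>2)) (at t)"
    using DERIV_diff[OF DERIV_const DERIV_max_3, of 1 t] by simp
  from DERIV_chain2[OF DERIV_max_4 this]
  show ?thesis by (simp add: cutoff_def[abs_def] cutoff1_def algebra_simps)
qed

lemma DERIV_cutoff1: "(cutoff1 has_real_derivative cutoff2 t) (at t)"
proof -
  have "((\<lambda>t::real. 1 - (max 0 t) ^ 3) has_real_derivative - (3 * (max 0 t)\<^sup>2)) (at t)"
    using DERIV_diff[OF DERIV_const DERIV_max_3, of 1 t] by simp
  from DERIV_mult[OF DERIV_chain2[OF DERIV_max_3 this] DERIV_max_2[of t]]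
  have "((\<lambda>t. - 12 * ((max 0 (1 - (max 0 t) ^ 3)) ^ 3 * (max 0 t)\<^sup>2)) has_real_derivative
     - 12 * (3 * (max 0 (1 - (max 0 t) ^ 3))\<^sup>2 * - (3 * (max 0 t)\<^sup>2) * (max 0 t)\<^sup>2 + 2 * max 0 t * (max 0 (1 - (max 0 t) ^ 3)) ^ 3)) (at t)"
    by (intro DERIV_cmult)
  then show ?thesis
    by (simp add: cutoff1_def[abs_def] cutoff2_def power4_eq_xxxx power2_eq_square algebra_simps)
qed

lemma continuous_cutoff2: "continuous_on S cutoff2"
  unfolding cutoff2_def by (intro continuous_intros)

lemma cutoff_one: "t \<le> 0 \<Longrightarrow> cutoff t = 1" and cutoff1_le0: "t \<le> 0 \<Longrightarrow> cutoff1 t = 0"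
  and cutoff2_le0: "t \<le> 0 \<Longrightarrow> cutoff2 t = 0"
  by (auto simp: cutoff_def cutoff1_def cutoff2_def max_def)

lemma cutoff_zero: "t \<ge> 1 \<Longrightarrow> cutoff t = 0" and cutoff1_ge1: "t \<ge> 1 \<Longrightarrow> cutoff1 t = 0"
proof -
  have "max 0 (1 - (max 0 t) ^ 3) = 0" if t: "t \<ge> 1"
  proof -
    have "1 \<le> t ^ 3" using t by (rule one_le_power)
    moreover have "max 0 t = t" using t by simp
    ultimately show ?thesis by simp
  qed
  then show "t \<ge> 1 \<Longrightarrow> cutoff t = 0" "t \<ge> 1 \<Longrightarrow> cutoff1 t = 0" by (simp_all add: cutoff_def cutoff1_def)
qed

text \<open>The square root of the cutoff is the square of its base, and this square divides both
  derivatives; where the base is nonzero, t is at most 1. The constant is 132 = 108 + 24, from the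
  coefficients of \<open>cutoff2\<close>, and it also covers the 12 in
  \<open>cutoff1\<close>.\<close>

lemma cutoff_bounds:
  shows "0 \<le> cutoff t" "cutoff t \<le> 1" "\<bar>cutoff1 t\<bar> \<le> 132 * sqrt (cutoff t)" "\<bar>cutoff2 t\<bar> \<le> 132 * sqrt (cutoff t)"
    "\<bar>cutoff1 t\<bar> \<le> 132" "\<bar>cutoff2 t\<bar> \<le> 132"
proof -
  define p where "p = max 0 t"
  define y where "y = max 0 (1 - p ^ 3)"
  have p: "0 \<le> p" and y: "0 \<le> y" "y \<le> 1" by (auto simp: p_def y_def)
  have c: "cutoff t = y ^ 4" "cutoff1 t = - (12 * y ^ 3 * p\<^sup>2)" "cutoff2 t = 108 * y\<^sup>2 * p ^ 4 - 24 * y ^ 3 * p"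
    by (simp_all add: cutoff_def cutoff1_def cutoff2_def y_def p_def)
  have s: "sqrt (cutoff t) = y\<^sup>2"
    unfolding c by (rule real_sqrt_unique) (use y in \<open>simp_all add: power2_eq_square power4_eq_xxxx mult.assoc\<close>)
  have p1: "p \<le> 1" if "y \<noteq> 0"
  proof (rule ccontr)
    assume "\<not> p \<le> 1"
    then have "1 \<le> p ^ 3" by (intro one_le_power) auto
    then show False using that by (simp add: y_def)
  qed
  show 0: "0 \<le> cutoff t" "cutoff t \<le> 1" using y by (auto simp: c power_le_one)
  have y2: "y\<^sup>2 \<le> 1" using y by (simp add: power_le_one)
  show 1: "\<bar>cutoff1 t\<bar> \<le> 132 * sqrt (cutoff t)"
  proof (cases "y = 0")
    case False
    have "y ^ 3 * p\<^sup>2 \<le> y\<^sup>2 * 1" using y p p1[OF False]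
      by (intro mult_mono power_decreasing) (auto simp: power_le_one)
    then have "12 * (y ^ 3 * p\<^sup>2) \<le> 132 * y\<^sup>2" using zero_le_power2[of y] by linarith
    then show ?thesis using y p unfolding s c(2) by (simp add: abs_mult mult.assoc)
  qed (simp add: c)
  show 2: "\<bar>cutoff2 t\<bar> \<le> 132 * sqrt (cutoff t)"
  proof (cases "y = 0")
    case False
    have "y ^ 3 * p \<le> y\<^sup>2 * 1" using y p p1[OF False]
      by (intro mult_mono power_decreasing) (auto simp: power_le_one)
    moreover have "y\<^sup>2 * p ^ 4 \<le> y\<^sup>2 * 1" using y p p1[OF False]
      by (intro mult_left_mono) (auto simp: power_le_one)
    moreover have "0 \<le> y ^ 3 * p" "0 \<le> y\<^sup>2 * p ^ 4" using y p by auto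
    ultimately have "\<bar>108 * (y\<^sup>2 * p ^ 4) - 24 * (y ^ 3 * p)\<bar> \<le> 132 * y\<^sup>2" by linarith
    then show ?thesis unfolding s c(3) by (simp add: mult.assoc)
  qed (simp add: c)
  have "132 * sqrt (cutoff t) \<le> 132" using y2 by (simp add: s)
  then show "\<bar>cutoff1 t\<bar> \<le> 132" "\<bar>cutoff2 t\<bar> \<le> 132" using 1 2 by linarith+
qed

text \<open>Counting coefficients: 12 + 4 + 2 = 18 for the r w n product, 1 for r w^3, 6 for the
  product of \<Psi> with w n, and 8 for the term with \<open>f2\<close>, all rounded up to
  20.\<close>

lemma rest_abs_bound:
  fixes f1 f2 \<Psi> r w n x1 x2 U1 U2 U3 :: real
  assumes x: "\<bar>x1\<bar> \<le> r" "\<bar>x2\<bar> \<le> r" and U: "\<bar>U1\<bar> \<le> w" "\<bar>U2\<bar> \<le> w" "\<bar>U3\<bar> \<le> w"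
    and d: "\<bar>d11\<bar> \<le> n" "\<bar>d12\<bar> \<le> n" "\<bar>d21\<bar> \<le> n" "\<bar>d22\<bar> \<le> n" "\<bar>d31\<bar> \<le> n" "\<bar>d32\<bar> \<le> n" "\<bar>d33\<bar> \<le> n"
    and Q: "\<bar>Q\<bar> \<le> r * w" and N: "N = w\<^sup>2"
  shows "\<bar>2 * f1 * (U1 * (x1 * d11 + x2 * d12) + U2 * (x1 * d21 + x2 * d22) + U3 * (x1 * d31 + x2 * d32))
      - (4 * f2 * \<Psi> - 2 * f1 * U3) * (x1 * d31 + x2 * d32)
      - 2 * f1 * Q * d33 - 2 * f1 * \<Psi> * (U1 * d31 + U2 * d32 + U3 * d33) - f1 * Q * N\<bar>
    \<le> 20 * (\<bar>f1\<bar> * (r * (w * n) + r * w ^ 3 + \<bar>\<Psi>\<bar> * (w * n)) + \<bar>f2\<bar> * (r * (\<bar>\<Psi>\<bar> * n)))"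
proof -
  have r0: "0 \<le> r" and w0: "0 \<le> w" and n0: "0 \<le> n"
    using order_trans[OF abs_ge_zero x(1)] order_trans[OF abs_ge_zero U(1)] order_trans[OF abs_ge_zero d(1)] by auto
  have prod: "\<bar>a * b\<bar> \<le> A * B" if "\<bar>a\<bar> \<le> A" "\<bar>b\<bar> \<le> B" for a b A B :: real
    unfolding abs_mult using that by (intro mult_mono) auto
  have A: "\<bar>x1 * a + x2 * b\<bar> \<le> 2 * (r * n)" if "\<bar>a\<bar> \<le> n" "\<bar>b\<bar> \<le> n" for a b
    using prod[OF x(1) that(1)] prod[OF x(2) that(2)] by linarith
  define A1 A2 A3 where "A1 = x1 * d11 + x2 * d12" and "A2 = x1 * d21 + x2 * d22" and "A3 = x1 * d31 + x2 * d32"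
  have AA: "\<bar>A1\<bar> \<le> 2 * (r * n)" "\<bar>A2\<bar> \<le> 2 * (r * n)" "\<bar>A3\<bar> \<le> 2 * (r * n)"
    unfolding A1_def A2_def A3_def using d A by auto
  have S: "\<bar>U1 * A1 + U2 * A2 + U3 * A3\<bar> \<le> 6 * (r * (w * n))"
    using prod[OF U(1) AA(1)] prod[OF U(2) AA(2)] prod[OF U(3) AA(3)] by (simp add: mult_ac)
  have T: "\<bar>U1 * d31 + U2 * d32 + U3 * d33\<bar> \<le> 3 * (w * n)"
    using prod[OF U(1) d(5)] prod[OF U(2) d(6)] prod[OF U(3) d(7)] by linarith
  have lin: "\<bar>c * f1 * s\<bar> \<le> c * k * (\<bar>f1\<bar> * X)" if "\<bar>s\<bar> \<le> k * X" "0 \<le> c" for c s k X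
    using mult_left_mono[OF that(1), of "c * \<bar>f1\<bar>"] that(2) by (simp add: abs_mult mult_ac)
  have t1: "\<bar>2 * f1 * (U1 * A1 + U2 * A2 + U3 * A3)\<bar> \<le> 12 * (\<bar>f1\<bar> * (r * (w * n)))"
    using lin[OF S, of 2] by simp
  have t2: "\<bar>4 * f2 * \<Psi> * A3\<bar> \<le> 8 * (\<bar>f2\<bar> * (r * (\<bar>\<Psi>\<bar> * n)))"
    using mult_left_mono[OF AA(3), of "4 * \<bar>f2\<bar> * \<bar>\<Psi>\<bar>"] by (simp add: abs_mult mult_ac)
  have t3: "\<bar>2 * f1 * U3 * A3\<bar> \<le> 4 * (\<bar>f1\<bar> * (r * (w * n)))"
    using mult_left_mono[OF prod[OF U(3) AA(3)], of "2 * \<bar>f1\<bar>"] by (simp add: abs_mult mult_ac)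
  have t4: "\<bar>2 * f1 * Q * d33\<bar> \<le> 2 * (\<bar>f1\<bar> * (r * (w * n)))"
    using mult_left_mono[OF prod[OF Q d(7)], of "2 * \<bar>f1\<bar>"] by (simp add: abs_mult mult_ac)
  have t5: "\<bar>2 * f1 * \<Psi> * (U1 * d31 + U2 * d32 + U3 * d33)\<bar> \<le> 6 * (\<bar>f1\<bar> * (\<bar>\<Psi>\<bar> * (w * n)))"
  proof -
    have "\<bar>\<Psi> * (U1 * d31 + U2 * d32 + U3 * d33)\<bar> \<le> 3 * (\<bar>\<Psi>\<bar> * (w * n))"
      using mult_left_mono[OF T, of "\<bar>\<Psi>\<bar>"] by (simp add: abs_mult)
    from lin[OF this, of 2] show ?thesis by (simp add: mult.assoc)
  qed
  have t6: "\<bar>f1 * Q * N\<bar> \<le> \<bar>f1\<bar> * (r * w ^ 3)"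
    using mult_left_mono[OF prod[OF Q, of N "w\<^sup>2"], of "\<bar>f1\<bar>"]
    by (simp add: N abs_mult power2_eq_square power3_eq_cube mult_ac)
  have nn: "0 \<le> \<bar>f1\<bar> * (r * (w * n))" "0 \<le> \<bar>f1\<bar> * (r * w ^ 3)" "0 \<le> \<bar>f1\<bar> * (\<bar>\<Psi>\<bar> * (w * n))" "0 \<le> \<bar>f2\<bar> * (r * (\<bar>\<Psi>\<bar> * n))"
    using r0 w0 n0 by auto
  have e: "2 * f1 * (U1 * A1 + U2 * A2 + U3 * A3) - (4 * f2 * \<Psi> - 2 * f1 * U3) * A3
      - 2 * f1 * Q * d33 - 2 * f1 * \<Psi> * (U1 * d31 + U2 * d32 + U3 * d33) - f1 * Q * N
    = 2 * f1 * (U1 * A1 + U2 * A2 + U3 * A3) - 4 * f2 * \<Psi> * A3 + 2 * f1 * U3 * A3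
      - 2 * f1 * Q * d33 - 2 * f1 * \<Psi> * (U1 * d31 + U2 * d32 + U3 * d33) - f1 * Q * N"
    by (simp add: algebra_simps)
  have comb: "\<bar>a - b + c - d - e - f\<bar> \<le> 20 * (X + V + Z + W)"
    if "\<bar>a\<bar> \<le> 12 * X" "\<bar>b\<bar> \<le> 8 * W" "\<bar>c\<bar> \<le> 4 * X" "\<bar>d\<bar> \<le> 2 * X" "\<bar>e\<bar> \<le> 6 * Z" "\<bar>f\<bar> \<le> V"
      "0 \<le> X" "0 \<le> V" "0 \<le> Z" "0 \<le> W" for a b c d e f X V Z W :: real
  proof -
    have "\<bar>a - b + c\<bar> \<le> 16 * X + 8 * W" using that(1-3) by linarith
    moreover have "\<bar>d + e + f\<bar> \<le> 2 * X + 6 * Z + V" using that(4-6) by linarith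
    ultimately have "\<bar>a - b + c - d - e - f\<bar> \<le> 18 * X + 8 * W + 6 * Z + V" by linarith
    then show ?thesis using that(7-) unfolding distrib_left by linarith
  qed
  show ?thesis
    unfolding A1_def[symmetric] A2_def[symmetric] A3_def[symmetric] e
    using comb[OF t1 t2 t3 t4 t5 t6 nn] by (simp add: algebra_simps)
qed

text \<open>The argument \<open>s\<close> stands for r^2, mapped affinely so that R^2 goes to 0 and
  R'^2 to 1. \<open>Phi1\<close> and \<open>Phi2\<close> are the derivatives in \<open>s\<close>,
  which accounts for the powers of R'^2 - R^2.\<close>

definition Phi :: "real \<Rightarrow> real \<Rightarrow> real \<Rightarrow> real" where "Phi R R' s = cutoff ((s - R\<^sup>2) / (R'\<^sup>2 - R\<^sup>2))"
definition Phi1 :: "real \<Rightarrow> real \<Rightarrow> real \<Rightarrow> real" where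
  "Phi1 R R' s = cutoff1 ((s - R\<^sup>2) / (R'\<^sup>2 - R\<^sup>2)) / (R'\<^sup>2 - R\<^sup>2)"
definition Phi2 :: "real \<Rightarrow> real \<Rightarrow> real \<Rightarrow> real" where
  "Phi2 R R' s = cutoff2 ((s - R\<^sup>2) / (R'\<^sup>2 - R\<^sup>2)) / (R'\<^sup>2 - R\<^sup>2)\<^sup>2"

lemma sq_vec3: "sq (vec3 (q, s)) = (norm q)\<^sup>2"
  by (cases q) (simp add: sq_def norm_pair_real)

context axi_flow begin

text \<open>Up to a factor 20 this dominates everything in the energy identity that carries a
  derivative of the cutoff; it vanishes for r \<le> R.\<close>

definition EE :: "real \<Rightarrow> real \<Rightarrow> real^3 \<Rightarrow> real" where
  "EE R R' x = \<bar>Phi1 R R' (sq x)\<bar> * (rad x * (w x * gn x) + rad x * w x ^ 3 + \<bar>Psi x\<bar> * (w x * gn x))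
     + \<bar>Phi2 R R' (sq x)\<bar> * (rad x * (\<bar>Psi x\<bar> * gn x))"

context
  fixes R R' :: real
  assumes R: "0 \<le> R" "R < R'"
begin

lemma diff_sq_pos: "R'\<^sup>2 - R\<^sup>2 > 0" using R by (simp add: power_strict_mono)

lemma DERIV_Phi: "(Phi R R' has_real_derivative Phi1 R R' s) (at s)"
proof -
  have "((\<lambda>s. (s - R\<^sup>2) / (R'\<^sup>2 - R\<^sup>2)) has_real_derivative 1 / (R'\<^sup>2 - R\<^sup>2)) (at s)"
    using diff_sq_pos by (auto intro!: derivative_eq_intros)
  from DERIV_chain2[OF DERIV_cutoff this] show ?thesis by (simp add: Phi_def[abs_def] Phi1_def)
qed

lemma DERIV_Phi1: "(Phi1 R R' has_real_derivative Phi2 R R' s) (at s)"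
proof -
  have "((\<lambda>s. (s - R\<^sup>2) / (R'\<^sup>2 - R\<^sup>2)) has_real_derivative 1 / (R'\<^sup>2 - R\<^sup>2)) (at s)"
    using diff_sq_pos by (auto intro!: derivative_eq_intros)
  from DERIV_cdivide[OF DERIV_chain2[OF DERIV_cutoff1 this], of "R'\<^sup>2 - R\<^sup>2"]
  show ?thesis by (simp add: Phi1_def[abs_def] Phi2_def power2_eq_square)
qed

lemma continuous_Phi2: "continuous_on S (Phi2 R R')"
  unfolding Phi2_def using diff_sq_pos
  by (intro continuous_intros continuous_on_compose2[OF continuous_cutoff2[of UNIV]]) auto

lemma continuous_Phis:
  "continuous_on S (\<lambda>x. Phi R R' (sq x))" "continuous_on S (\<lambda>x. Phi1 R R' (sq x))" "continuous_on S (\<lambda>x. Phi2 R R' (sq x))"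
proof -
  have "continuous_on UNIV (Phi R R')" "continuous_on UNIV (Phi1 R R')"
    using DERIV_isCont[OF DERIV_Phi] DERIV_isCont[OF DERIV_Phi1] by (auto intro: continuous_at_imp_continuous_on)
  then show "continuous_on S (\<lambda>x. Phi R R' (sq x))" "continuous_on S (\<lambda>x. Phi1 R R' (sq x))" "continuous_on S (\<lambda>x. Phi2 R R' (sq x))"
    using continuous_Phi2[of UNIV] by (auto intro: continuous_on_compose2[OF _ continuous_sq])
qed

lemma Phi_zero: "s \<ge> R'\<^sup>2 \<Longrightarrow> Phi R R' s = 0" "s \<ge> R'\<^sup>2 \<Longrightarrow> Phi1 R R' s = 0"
  using diff_sq_pos by (auto simp: Phi_def Phi1_def intro!: cutoff_zero cutoff1_ge1)

lemma Phi_inner: "s \<le> R\<^sup>2 \<Longrightarrow> Phi R R' s = 1" "s \<le> R\<^sup>2 \<Longrightarrow> Phi1 R R' s = 0" "s \<le> R\<^sup>2 \<Longrightarrow> Phi2 R R' s = 0"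
  using diff_sq_pos by (auto simp: Phi_def Phi1_def Phi2_def divide_nonpos_pos intro!: cutoff_one cutoff1_le0 cutoff2_le0)

lemma Phi_bounds:
  "0 \<le> Phi R R' s" "Phi R R' s \<le> 1"
  "\<bar>Phi1 R R' s\<bar> \<le> 132 / (R'\<^sup>2 - R\<^sup>2) * sqrt (Phi R R' s)"
  "\<bar>Phi2 R R' s\<bar> \<le> 132 / (R'\<^sup>2 - R\<^sup>2)\<^sup>2 * sqrt (Phi R R' s)"
  "\<bar>Phi1 R R' s\<bar> \<le> 132 / (R'\<^sup>2 - R\<^sup>2)" "\<bar>Phi2 R R' s\<bar> \<le> 132 / (R'\<^sup>2 - R\<^sup>2)\<^sup>2"
  unfolding Phi_def Phi1_def Phi2_def
  using diff_sq_pos cutoff_bounds[of "(s - R\<^sup>2) / (R'\<^sup>2 - R\<^sup>2)"]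
  by (auto simp: abs_divide divide_right_mono)

lemma nice_Phis: "nice (\<lambda>x. Phi R R' (sq x))" "nice (\<lambda>x. Phi1 R R' (sq x))" "nice (\<lambda>x. Phi2 R R' (sq x))"
  by (intro nice_continuous continuous_Phis)+

lemma nice_EE: "nice (EE R R')"
  unfolding EE_def[abs_def] by (intro nice_intros nice_Phis)

lemma energy_inequality:
  "(\<integral>x. indicator (OmR R') x * (Phi R R' (sq x) * grad_sq u x) \<partial>lborel)
     \<le> (\<integral>x. indicator (OmR R') x * (20 * EE R R' x) \<partial>lborel)"
proof -
  define rest where "rest x = 2 * Phi1 R R' (sq x) * (\<Sum>i\<in>UNIV. U x $ i * (x$1 * du i 1 x + x$2 * du i 2 x))
      - (4 * Phi2 R R' (sq x) * Psi x - 2 * Phi1 R R' (sq x) * U x $ 3) * (x$1 * du 3 1 x + x$2 * du 3 2 x)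
      - 2 * Phi1 R R' (sq x) * Q x * du 3 3 x
      - 2 * Phi1 R R' (sq x) * Psi x * (U x $ 1 * du 3 1 x + U x $ 2 * du 3 2 x + U x $ 3 * du 3 3 x)
      - Phi1 R R' (sq x) * Q x * ((U x $ 1)\<^sup>2 + (U x $ 2)\<^sup>2 + (U x $ 3)\<^sup>2)" for x
  have R': "R' \<ge> 0" using R by simp
  have nx: "nice (\<lambda>x. x $ i)" for i by (intro nice_continuous continuous_intros)
  have nr: "nice rest" unfolding rest_def sum_3 by (intro nice_intros nice_Phis nx)
  have np: "nice (\<lambda>x. Phi R R' (sq x) * grad_sq u x)" by (intro nice_intros nice_Phis)
  have "(\<integral>x. indicator (OmR R') x * (Phi R R' (sq x) * grad_sq u x + rest x) \<partial>lborel) = 0"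
    unfolding rest_def
    by (rule energy_identity[OF R' DERIV_Phi DERIV_Phi1 continuous_Phi2 Phi_zero])
  moreover have "(\<integral>x. indicator (OmR R') x * (Phi R R' (sq x) * grad_sq u x + rest x) \<partial>lborel)
     = (\<integral>x. indicator (OmR R') x * (Phi R R' (sq x) * grad_sq u x) \<partial>lborel) + (\<integral>x. indicator (OmR R') x * rest x \<partial>lborel)"
    unfolding distrib_left
    by (intro Bochner_Integration.integral_add nice_cylinder np nr R')
  ultimately have "(\<integral>x. indicator (OmR R') x * (Phi R R' (sq x) * grad_sq u x) \<partial>lborel)
     = - (\<integral>x. indicator (OmR R') x * rest x \<partial>lborel)" by linarith
  also have "\<dots> \<le> \<bar>\<integral>x. indicator (OmR R') x * rest x \<partial>lborel\<bar>" by simp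
  also have "\<dots> \<le> (\<integral>x. indicator (OmR R') x * (20 * EE R R' x) \<partial>lborel)"
  proof (rule integral_abs_bound_integral)
    show "integrable lborel (\<lambda>x. indicator (OmR R') x * rest x)" by (rule nice_cylinder[OF nr R'])
    show "integrable lborel (\<lambda>x. indicator (OmR R') x * (20 * EE R R' x))"
      by (intro nice_cylinder R' nice_intros nice_EE)
    fix x
    have "\<bar>rest x\<bar> \<le> 20 * EE R R' x"
      unfolding rest_def EE_def sum_3
    proof (rule rest_abs_bound)
      show "\<bar>Q x\<bar> \<le> rad x * w x" using abs_Q_le[of x] by (simp add: w_def)
      show "(U x $ 1)\<^sup>2 + (U x $ 2)\<^sup>2 + (U x $ 3)\<^sup>2 = (w x)\<^sup>2" by (simp only: w_def norm3_sq)
      show "\<bar>U x $ 1\<bar> \<le> w x" "\<bar>U x $ 2\<bar> \<le> w x" "\<bar>U x $ 3\<bar> \<le> w x"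
        unfolding w_def by (rule component_le_norm_cart)+
    qed (simp_all add: gn_def abs_le_rad du_le)
    then show "\<bar>indicator (OmR R') x * rest x\<bar> \<le> indicator (OmR R') x * (20 * EE R R' x)"
      by (auto simp: indicator_def)
  qed
  finally show ?thesis .
qed

lemma Y_le_Phi: "Y R \<le> (\<integral>x. indicator (OmR R') x * (Phi R R' (sq x) * grad_sq u x) \<partial>lborel)"
  unfolding Y_def
proof (rule integral_mono)
  show "integrable lborel (\<lambda>x. indicator (OmR R) x * grad_sq u x)" by (rule nice_cylinder[OF nice_grad_sq R(1)])
  show "integrable lborel (\<lambda>x. indicator (OmR R') x * (Phi R R' (sq x) * grad_sq u x))"
    by (intro nice_cylinder nice_intros nice_Phis) (use R in simp)
  fix x
  have "x \<in> OmR R' \<and> Phi R R' (sq x) = 1" if "x \<in> OmR R"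
  proof
    have "x \<in> Om" "rad x < R" using that R by (auto simp: OmR_eq)
    then show "x \<in> OmR R'" using R by (simp add: OmR_eq)
    have "sq x < R\<^sup>2" using that by (auto simp: domain_R_def sq_def)
    then show "Phi R R' (sq x) = 1" by (simp add: Phi_inner)
  qed
  then show "indicator (OmR R) x * grad_sq u x \<le> indicator (OmR R') x * (Phi R R' (sq x) * grad_sq u x)"
    using grad_sq_nonneg[of x] Phi_bounds(1)[of "sq x"] by (auto simp: indicator_def)
qed

lemma EE_inner: "norm q \<le> R \<Longrightarrow> vint (EE R R') q = 0"
proof -
  assume "norm q \<le> R"
  then have "(norm q)\<^sup>2 \<le> R\<^sup>2" by (intro power_mono) auto
  then have "EE R R' (vec3 (q, s)) = 0" for s by (simp add: EE_def sq_vec3 Phi_inner)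
  then show ?thesis by (simp add: vint_def)
qed

lemma Y_le_EE: "Y R \<le> 20 * (\<integral>q. indicator (ann R R') q * vint (EE R R') q \<partial>lborel)"
proof -
  have R': "R' \<ge> 0" using R by simp
  have "Y R \<le> (\<integral>x. indicator (OmR R') x * (20 * EE R R' x) \<partial>lborel)"
    using Y_le_Phi energy_inequality by (rule order_trans)
  also have "\<dots> = 20 * (\<integral>x. indicator (OmR R') x * EE R R' x \<partial>lborel)"
    by (simp add: mult.left_commute[of _ 20])
  also have "(\<integral>x. indicator (OmR R') x * EE R R' x \<partial>lborel) = (\<integral>q. indicator (ball 0 R') q * vint (EE R R') q \<partial>lborel)"
    by (rule cyl_fubini(2)[OF nice_EE R', symmetric])
  also have "\<dots> = (\<integral>q. indicator (ann R R') q * vint (EE R R') q \<partial>lborel)"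
  proof (rule Bochner_Integration.integral_cong[OF refl])
    fix q :: "real \<times> real"
    show "indicator (ball 0 R') q * vint (EE R R') q = indicator (ann R R') q * vint (EE R R') q"
      using EE_inner[of q] by (auto simp: indicator_def ann_def)
  qed
  finally show ?thesis .
qed

text \<open>H D comes from |u| |\<nabla>u|. The two equal terms with \<open>m q\<close> come from
  |u|^3 and from the stream function in the convective part. H^2 D comes from the second derivative
  of the cutoff, where \<open>Psi\<close> brings another factor r.\<close>

lemma vint_EE:
  assumes H: "f2 (norm q) - f1 (norm q) \<le> H"
    and k1: "\<bar>Phi1 R R' ((norm q)\<^sup>2)\<bar> \<le> k1" and k2: "\<bar>Phi2 R R' ((norm q)\<^sup>2)\<bar> \<le> k2"
  shows "vint (EE R R') q \<le> k1 * norm q * (H * D q + 2 * (m q * sqrt (H * D q))) + k2 * (norm q)\<^sup>2 * (H\<^sup>2 * D q)"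
proof -
  have k0: "0 \<le> k1" "0 \<le> k2" using k1 k2 by linarith+
  define r where "r = norm q"
  have r0: "0 \<le> r" by (simp add: r_def)
  let ?g = "\<lambda>x. k1 * (r * (w x * gn x)) + k1 * (r * w x ^ 3) + k1 * (\<bar>Psi x\<bar> * (w x * gn x)) + k2 * (r * (\<bar>Psi x\<bar> * gn x))"
  have "vint (EE R R') q \<le> vint ?g q"
  proof (intro vint_mono nice_EE nice_intros)
    fix s
    let ?x = "vec3 (q, s)"
    have "EE R R' ?x \<le> k1 * (r * (w ?x * gn ?x) + r * w ?x ^ 3 + \<bar>Psi ?x\<bar> * (w ?x * gn ?x)) + k2 * (r * (\<bar>Psi ?x\<bar> * gn ?x))"
      unfolding EE_def sq_vec3 rad_vec3 r_def using k1 k2 w_nonneg[of ?x] gn_nonneg[of ?x]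
      by (intro add_mono mult_right_mono) auto
    then show "EE R R' ?x \<le> k1 * (r * (w ?x * gn ?x)) + k1 * (r * w ?x ^ 3) + k1 * (\<bar>Psi ?x\<bar> * (w ?x * gn ?x)) + k2 * (r * (\<bar>Psi ?x\<bar> * gn ?x))"
      by (simp add: distrib_left)
  qed
  also have "vint ?g q = k1 * (r * vint (\<lambda>x. w x * gn x) q) + k1 * (r * vint (\<lambda>x. w x ^ 3) q)
     + k1 * vint (\<lambda>x. \<bar>Psi x\<bar> * (w x * gn x)) q + k2 * (r * vint (\<lambda>x. \<bar>Psi x\<bar> * gn x) q)"
  proof -
    have "vint ?g q = vint (\<lambda>x. k1 * (r * (w x * gn x))) q + vint (\<lambda>x. k1 * (r * w x ^ 3)) q
        + vint (\<lambda>x. k1 * (\<bar>Psi x\<bar> * (w x * gn x))) q + vint (\<lambda>x. k2 * (r * (\<bar>Psi x\<bar> * gn x))) q"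
      by (subst vint_add, (intro nice_intros)+)+ (rule refl)
    then show ?thesis by (simp only: vint_cmult)
  qed
  also have "\<dots> \<le> k1 * (r * (H * D q)) + k1 * (r * (m q * sqrt (H * D q)))
     + k1 * (r * (m q * sqrt (H * D q))) + k2 * (r * (r * (H\<^sup>2 * D q)))"
    using vint_w_gn'[OF H] vint_w_cube[OF H] vint_Psi_w_gn[OF H] vint_Psi_gn[OF H] k0 r0
    unfolding r_def by (intro add_mono mult_left_mono) auto
  also have "\<dots> = k1 * norm q * (H * D q + 2 * (m q * sqrt (H * D q))) + k2 * (norm q)\<^sup>2 * (H\<^sup>2 * D q)"
    by (simp add: r_def power2_eq_square algebra_simps)
  finally show ?thesis .
qed

end

end

section \<open>Consequences of the energy inequality\<close>

context axi_flow begin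

lemma Y_nonneg: "0 \<le> Y R"
  unfolding Y_def by (intro Bochner_Integration.integral_nonneg mult_nonneg_nonneg grad_sq_nonneg) auto

lemma Y_mono: "0 \<le> R \<Longrightarrow> R \<le> R' \<Longrightarrow> Y R \<le> Y R'"
  using ann_D[of R R'] Bochner_Integration.integral_nonneg[of lborel "\<lambda>q. indicator (ann R R') q * D q"]
  by (simp add: D_nonneg)

text \<open>The height is at most the width L, so Poincare factors L are compensated by the cutoff
  derivatives, of orders 1/(RL) and 1/(RL)^2 in r^2, and the quadratic terms are of order e. For the
  cubic terms, \<open>m_sup\<close> bounds \<open>m\<close> by 6 L e / R, and Cauchy-Schwarz bounds
  the integral of the square root of \<open>D\<close> by the root of area times e. The constant is
  20 times 6336, with the 20 from \<open>Y_le_EE\<close>.\<close>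

lemma annulus_inequality:
  assumes R: "0 < R" "0 < L" "L \<le> R"
    and f: "\<And>r. R \<le> r \<Longrightarrow> r \<le> R + L \<Longrightarrow> f2 r - f1 r \<le> L"
  defines "e \<equiv> Y (R + L) - Y R"
  shows "Y R \<le> 126720 * (e + L / sqrt R * (e * sqrt e))"
proof -
  let ?A = "ann R (R + L)"
  have RL: "0 \<le> R" "R \<le> R + L" "R < R + L" using R by auto
  have H: "f2 (norm q) - f1 (norm q) \<le> L" if "q \<in> ?A" for q
    using f that by (auto simp: ann_def)
  have nm: "nice (\<lambda>x. (w x)\<^sup>2)" and nw: "nice (\<lambda>x. w x * gn x)" by (intro nice_intros)+
  have iD: "integrable lborel (\<lambda>q. indicator ?A q * D q)" by (rule ann_fubini(1)[OF nice_grad_sq RL(1,2)])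
  have eD: "(\<integral>q. indicator ?A q * D q \<partial>lborel) = e" unfolding e_def by (rule ann_D[OF RL(1,2)])
  have e0: "0 \<le> e" using Y_mono[OF RL(1,2)] by (simp add: e_def)
  have im: "(\<integral>q. indicator ?A q * m q \<partial>lborel) \<le> L\<^sup>2 * e"
  proof -
    have "(\<integral>q. indicator ?A q * m q \<partial>lborel) \<le> (\<integral>q. L\<^sup>2 * (indicator ?A q * D q) \<partial>lborel)"
    proof (rule integral_mono[OF ann_fubini(1)[OF nm RL(1,2)]])
      fix q show "indicator ?A q * m q \<le> L\<^sup>2 * (indicator ?A q * D q)"
        using m_bound[OF H, of q] by (auto simp: indicator_def)
    qed (use iD in simp)
    then show ?thesis by (simp add: eD)
  qed
  have iw: "(\<integral>q. indicator ?A q * vint (\<lambda>x. w x * gn x) q \<partial>lborel) \<le> L * e"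
  proof -
    have "(\<integral>q. indicator ?A q * vint (\<lambda>x. w x * gn x) q \<partial>lborel) \<le> (\<integral>q. L * (indicator ?A q * D q) \<partial>lborel)"
    proof (rule integral_mono[OF ann_fubini(1)[OF nw RL(1,2)]])
      fix q show "indicator ?A q * vint (\<lambda>x. w x * gn x) q \<le> L * (indicator ?A q * D q)"
        using vint_w_gn'[OF H, of q] by (auto simp: indicator_def)
    qed (use iD in simp)
    then show ?thesis by (simp add: eD)
  qed
  \<comment> \<open>Inserting the two integrals just bounded into \<open>m_sup\<close> gives R/2 m
    \<le> L e + 2 L e.\<close>
  define M where "M = 6 * L * e / R"
  have M0: "0 \<le> M" using e0 R by (simp add: M_def)
  have mM: "m q \<le> M" if "q \<in> ?A" for q
  proof -
    have "(\<integral>q. indicator ?A q * m q \<partial>lborel) / L \<le> L\<^sup>2 * e / L" using im R by (simp add: divide_right_mono)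
    then have "R / 2 * m q \<le> L\<^sup>2 * e / L + 2 * (L * e)"
      using m_sup[OF R(1,2) that] iw by linarith
    also have "\<dots> = 3 * L * e" using R by (simp add: power2_eq_square)
    finally show ?thesis using R by (simp add: M_def field_simps)
  qed
  have isq: "(\<integral>q. indicator ?A q * sqrt (D q) \<partial>lborel) \<le> 4 * sqrt (R * L) * sqrt e"
    and isqi: "integrable lborel (\<lambda>q. indicator ?A q * sqrt (D q))"
  proof -
    let ?f = "\<lambda>q. indicator ?A q :: real" and ?g = "\<lambda>q. indicator ?A q * sqrt (D q)"
    have gs: "(?g q)\<^sup>2 = indicator ?A q * D q" for q using D_nonneg[of q] by (auto simp: indicator_def)
    have fs: "(?f q)\<^sup>2 = indicator ?A q" for q by (auto simp: indicator_def)
    have fg: "?f q * ?g q = ?g q" for q by (auto simp: indicator_def)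
    have ge: "?g q = sqrt (indicator ?A q * D q)" for q by (auto simp: indicator_def)
    have fi: "integrable lborel ?f" by (rule measure_ann(1)[OF RL(1,2)])
    have gm: "?g \<in> borel_measurable lborel" unfolding ge using borel_measurable_integrable[OF iD] by measurable
    show "integrable lborel ?g"
    proof (rule Bochner_Integration.integrable_bound[OF Bochner_Integration.integrable_add[OF fi iD] gm])
      have "sqrt d \<le> 1 + d" if "0 \<le> d" for d :: real
        by (rule real_le_lsqrt) (use that in \<open>auto simp: power2_eq_square algebra_simps\<close>)
      then show "AE q in lborel. norm (?g q) \<le> norm (indicator ?A q + indicator ?A q * D q)"
        using D_nonneg by (auto simp: indicator_def)
    qed
    have "(\<integral>q. ?f q * ?g q \<partial>lborel) \<le> sqrt (\<integral>q. (?f q)\<^sup>2 \<partial>lborel) * sqrt (\<integral>q. (?g q)\<^sup>2 \<partial>lborel)"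
      by (rule Cauchy_Schwarz_integral)
         (use fi gm iD D_nonneg in \<open>auto simp: gs fs\<close>)
    then have "(\<integral>q. ?g q \<partial>lborel) \<le> sqrt (pi * ((R + L)\<^sup>2 - R\<^sup>2)) * sqrt e"
      unfolding gs fs fg eD measure_ann(2)[OF RL(1,2)] .
    \<comment> \<open>By L \<le> R and pi < 4 the area is at most 12 R L; 16 is used for its exact
      root.\<close>
    also have "\<dots> \<le> sqrt (16 * (R * L)) * sqrt e"
    proof (intro mult_right_mono real_sqrt_le_mono)
      have "(R + L)\<^sup>2 - R\<^sup>2 \<le> 3 * (R * L)" using R mult_right_mono[OF R(3), of L] by (simp add: power2_eq_square algebra_simps)
      then have "pi * ((R + L)\<^sup>2 - R\<^sup>2) \<le> 4 * (3 * (R * L))"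
        using pi_less_4 R by (intro mult_mono) (auto simp: power2_eq_square algebra_simps)
      then show "pi * ((R + L)\<^sup>2 - R\<^sup>2) \<le> 16 * (R * L)" using mult_pos_pos[OF R(1,2)] by linarith
    qed (use e0 in auto)
    also have "sqrt (16 * (R * L)) = 4 * sqrt (R * L)" by (simp add: real_sqrt_mult)
    finally show "(\<integral>q. ?g q \<partial>lborel) \<le> 4 * sqrt (R * L) * sqrt e" .
  qed
  define c where "c = 264 * M / sqrt L"
  have c0: "0 \<le> c" using M0 R by (simp add: c_def)
  have dsq: "2 * (R * L) \<le> (R + L)\<^sup>2 - R\<^sup>2" using R by (simp add: power2_eq_square algebra_simps)
  have k1: "\<bar>Phi1 R (R + L) s\<bar> \<le> 66 / (R * L)" for s
  proof -
    have "132 / ((R + L)\<^sup>2 - R\<^sup>2) \<le> 132 / (2 * (R * L))"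
      using dsq R diff_sq_pos[OF RL(1,3)] by (intro divide_left_mono mult_pos_pos) auto
    then show ?thesis using Phi_bounds(5)[OF RL(1,3), of s] by (simp add: mult.commute)
  qed
  have k2: "\<bar>Phi2 R (R + L) s\<bar> \<le> 33 / (R * L)\<^sup>2" for s
  proof -
    have "(2 * (R * L))\<^sup>2 \<le> ((R + L)\<^sup>2 - R\<^sup>2)\<^sup>2" using dsq R by (intro power_mono) auto
    then have "132 / ((R + L)\<^sup>2 - R\<^sup>2)\<^sup>2 \<le> 132 / (2 * (R * L))\<^sup>2" using R diff_sq_pos[OF RL(1,3)] by (intro divide_left_mono) auto
    also have "\<dots> = 33 / (R * L)\<^sup>2" using R by (simp add: power_mult_distrib)
    finally show ?thesis using Phi_bounds(6)[OF RL(1,3), of s] by simp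
  qed
  \<comment> \<open>Here norm q \<le> 2R because L \<le> R. The 264 is 132 from the first derivative
    of the cutoff plus 132 from the second.\<close>
  have vE: "vint (EE R (R + L)) q \<le> 264 * D q + c * sqrt (D q)" if q: "q \<in> ?A" for q
  proof -
    have nq: "norm q \<le> 2 * R" using q R by (auto simp: ann_def)
    have "vint (EE R (R + L)) q \<le> 66 / (R * L) * norm q * (L * D q + 2 * (m q * sqrt (L * D q)))
        + 33 / (R * L)\<^sup>2 * (norm q)\<^sup>2 * (L\<^sup>2 * D q)"
      by (rule vint_EE[OF RL(1,3) H[OF q] k1 k2])
    also have "\<dots> \<le> 66 / (R * L) * (2 * R) * (L * D q + 2 * (M * sqrt (L * D q))) + 33 / (R * L)\<^sup>2 * (2 * R)\<^sup>2 * (L\<^sup>2 * D q)"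
      using nq R D_nonneg[of q] m_nonneg[of q] mM[OF q]
      by (intro add_mono mult_mono mult_left_mono power_mono order_refl) auto
    also have "\<dots> = 264 * D q + c * sqrt (D q)"
    proof -
      have 1: "66 / (R * L) * (2 * R) = 132 / L" using R by simp
      have 2: "33 / (R * L)\<^sup>2 * (2 * R)\<^sup>2 * (L\<^sup>2 * D q) = 132 * D q" using R by (simp add: power2_eq_square)
      have 3: "132 / L * (2 * (M * sqrt (L * D q))) = c * sqrt (D q)"
      proof -
        have "132 / L * (2 * (M * sqrt (L * D q))) = 264 * M * (sqrt L / L) * sqrt (D q)" by (simp add: real_sqrt_mult)
        also have "sqrt L / L = 1 / sqrt L" using R by (simp add: sqrt_divide_self_eq inverse_eq_divide)
        finally show ?thesis by (simp add: c_def)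
      qed
      show ?thesis unfolding 1 2 distrib_left 3 using R by simp
    qed
    finally show ?thesis .
  qed
  have "(\<integral>q. indicator ?A q * vint (EE R (R + L)) q \<partial>lborel) \<le> (\<integral>q. 264 * (indicator ?A q * D q) + c * (indicator ?A q * sqrt (D q)) \<partial>lborel)"
  proof (rule integral_mono[OF ann_fubini(1)[OF nice_EE[OF RL(1,3)] RL(1,2)]])
    show "integrable lborel (\<lambda>q. 264 * (indicator ?A q * D q) + c * (indicator ?A q * sqrt (D q)))"
      using iD isqi by simp
    fix q show "indicator ?A q * vint (EE R (R + L)) q \<le> 264 * (indicator ?A q * D q) + c * (indicator ?A q * sqrt (D q))"
      using vE[of q] by (auto simp: indicator_def)
  qed
  also have "\<dots> = 264 * e + c * (\<integral>q. indicator ?A q * sqrt (D q) \<partial>lborel)"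
    using iD isqi by (simp add: eD)
  also have "\<dots> \<le> 264 * e + c * (4 * sqrt (R * L) * sqrt e)"
    using isq c0 by (intro add_left_mono mult_left_mono)
  also have "c * (4 * sqrt (R * L) * sqrt e) = 6336 * (L / sqrt R * (e * sqrt e))"
  proof -
    have "c * (4 * sqrt (R * L) * sqrt e) = 1056 * M * sqrt R * sqrt e"
      using R by (simp add: c_def real_sqrt_mult)
    also have "\<dots> = 6336 * L * e * (sqrt R / R) * sqrt e" by (simp add: M_def)
    also have "sqrt R / R = 1 / sqrt R" using R by (simp add: sqrt_divide_self_eq inverse_eq_divide)
    finally show ?thesis by simp
  qed
  finally have "(\<integral>q. indicator ?A q * vint (EE R (R + L)) q \<partial>lborel) \<le> 264 * e + 6336 * (L / sqrt R * (e * sqrt e))" .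
  then have "Y R \<le> 20 * (264 * e + 6336 * (L / sqrt R * (e * sqrt e)))"
    using Y_le_EE[OF RL(1,3)] unfolding distrib_left by linarith
  also have "\<dots> \<le> 126720 * (e + L / sqrt R * (e * sqrt e))" using e0 unfolding distrib_left by simp
  finally show ?thesis .
qed

text \<open>The gradient terms are absorbed into the left-hand side, which is where the
  domination of the derivatives of the cutoff by its square root is needed.\<close>

lemma sup_bound_energy:
  assumes R: "0 < R" and S: "\<And>x. R \<le> rad x \<Longrightarrow> rad x \<le> 2 * R \<Longrightarrow> w x \<le> S"
    and H: "\<And>r. R \<le> r \<Longrightarrow> r \<le> 2 * R \<Longrightarrow> f2 r - f1 r \<le> H"
  shows "Y R \<le> 1000000000 * (H * S\<^sup>2 + H^3 * S\<^sup>2 / R\<^sup>2 + H^3 * S^4 + R * H * S^3)"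
proof -
  have RR: "0 \<le> R" "R < 2 * R" "R \<le> 2 * R" "0 \<le> 2 * R" using R by auto
  have H0: "0 < H" using H[of R] f_less[of R] R by auto
  have S0: "0 \<le> S" using S[of "pt R 0 0"] w_nonneg[of "pt R 0 0"] R by auto
  \<comment> \<open>Remainders of three uses of Young's inequality, plus the cubic term; 1760 = 20 *
    44 * 2 and 1200 = 20 * 15 * 4.\<close>
  define B where "B = 3/2 * (1760 * S / R)\<^sup>2 + 3/2 * (1760 * H * S\<^sup>2 / R)\<^sup>2 + 3/2 * (1200 * H * S / R\<^sup>2)\<^sup>2 + 1760 * S^3 / R"
  have B0: "0 \<le> B" using R H0 S0 by (simp add: B_def)
  have PsiB: "\<bar>Psi x\<bar> \<le> 2 * R * H * S" if x: "R \<le> rad x" "rad x \<le> 2 * R" for x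
  proof -
    define q where "q = (x$1, x$2)"
    have nq: "norm q = rad x" by (simp add: q_def norm_pair_real rad_def)
    have "(\<integral>s. norm (U (pt (x$1) (x$2) s)) \<partial>lborel) = vint w q"
      unfolding vint_def q_def by (intro Bochner_Integration.integral_cong) (auto simp: indicator_def w_def U_off)
    also have "vint w q \<le> vint (\<lambda>x. S * 1) q"
      by (intro vint_mono nice_intros) (use S x in \<open>simp add: rad_vec3 nq\<close>)
    also have "\<dots> = S * (f2 (norm q) - f1 (norm q))" unfolding vint_cmult vint_one ..
    also have "\<dots> \<le> S * H" using H[of "rad x"] x S0 by (intro mult_left_mono) (auto simp: nq)
    finally have "rad x * (\<integral>s. norm (U (pt (x$1) (x$2) s)) \<partial>lborel) \<le> (2 * R) * (S * H)"
      using x S0 H0 by (intro mult_mono) (auto intro: Bochner_Integration.integral_nonneg)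
    then show ?thesis using Psi_bound[of x] by (simp add: mult_ac)
  qed
  \<comment> \<open>The transition from R to 2R has width 3 R^2 in r^2, so 44 = 132/3, and 15 rounds
    up 132/9.\<close>
  define k1 where "k1 = 44 / R\<^sup>2"
  define k2 where "k2 = 15 / R^4"
  let ?P = "\<lambda>x. Phi R (2 * R) (sq x)"
  have d: "(2 * R)\<^sup>2 - R\<^sup>2 = 3 * R\<^sup>2" by (simp add: power2_eq_square)
  have P0: "0 \<le> ?P x" and P1: "?P x \<le> 1" for x using Phi_bounds(1,2)[OF RR(1,2)] by auto
  have p1: "\<bar>Phi1 R (2 * R) (sq x)\<bar> \<le> k1 * sqrt (?P x)" for x
    using Phi_bounds(3)[OF RR(1,2), of "sq x"] unfolding d k1_def by simp
  have p2: "\<bar>Phi2 R (2 * R) (sq x)\<bar> \<le> k2 * sqrt (?P x)" for x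
  proof -
    have "132 / (3 * R\<^sup>2)\<^sup>2 \<le> k2" using R by (simp add: k2_def power2_eq_square power4_eq_xxxx field_simps)
    then have "132 / (3 * R\<^sup>2)\<^sup>2 * sqrt (?P x) \<le> k2 * sqrt (?P x)" using P0 by (intro mult_right_mono) auto
    then show ?thesis using Phi_bounds(4)[OF RR(1,2), of "sq x"] unfolding d by linarith
  qed
  \<comment> \<open>Three of the four terms contain the gradient. Giving each of them one sixth of
    the weighted energy leaves half of it on the left-hand side.\<close>
  have young: "a * b \<le> a\<^sup>2 / 6 + 3/2 * b\<^sup>2" for a b :: real
  proof -
    have "0 \<le> (a - 3 * b)\<^sup>2" by simp
    then show ?thesis by (simp add: power2_eq_square algebra_simps)
  qed
  have pw: "20 * EE R (2 * R) x \<le> 1/2 * (?P x * grad_sq u x) + B" if x: "R \<le> rad x" "rad x \<le> 2 * R" for x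
  proof -
    define a where "a = sqrt (?P x) * gn x"
    have a0: "0 \<le> a" using P0 gn_nonneg by (simp add: a_def)
    have a2: "a\<^sup>2 = ?P x * grad_sq u x" using P0 by (simp add: a_def power_mult_distrib gn_sq)
    have k0: "0 \<le> k1" "0 \<le> k2" using R by (auto simp: k1_def k2_def)
    have wS: "w x \<le> S" using S x by simp
    have t1: "20 * (\<bar>Phi1 R (2 * R) (sq x)\<bar> * (rad x * (w x * gn x))) \<le> a\<^sup>2 / 6 + 3/2 * (1760 * S / R)\<^sup>2"
    proof -
      have "20 * (\<bar>Phi1 R (2 * R) (sq x)\<bar> * (rad x * (w x * gn x))) \<le> 20 * ((k1 * sqrt (?P x)) * ((2 * R) * (S * gn x)))"
        using p1[of x] x wS k0 P0[of x] S0 R w_nonneg[of x] gn_nonneg[of x]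
        by (intro mult_left_mono mult_mono mult_right_mono) auto
      also have "\<dots> = a * (40 * k1 * R * S)" by (simp add: a_def mult_ac)
      also have "40 * k1 * R * S = 1760 * S / R" using R by (simp add: k1_def power2_eq_square)
      finally show ?thesis using young[of a "1760 * S / R"] by linarith
    qed
    have t2: "20 * (\<bar>Phi1 R (2 * R) (sq x)\<bar> * (\<bar>Psi x\<bar> * (w x * gn x))) \<le> a\<^sup>2 / 6 + 3/2 * (1760 * H * S\<^sup>2 / R)\<^sup>2"
    proof -
      have "20 * (\<bar>Phi1 R (2 * R) (sq x)\<bar> * (\<bar>Psi x\<bar> * (w x * gn x))) \<le> 20 * ((k1 * sqrt (?P x)) * ((2 * R * H * S) * (S * gn x)))"
        using p1[of x] PsiB[OF x] wS k0 P0[of x] S0 H0 R w_nonneg[of x] gn_nonneg[of x]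
        by (intro mult_left_mono mult_mono mult_right_mono) auto
      also have "\<dots> = a * (40 * k1 * R * H * S\<^sup>2)" by (simp add: a_def mult_ac power2_eq_square)
      also have "40 * k1 * R * H * S\<^sup>2 = 1760 * H * S\<^sup>2 / R" using R by (simp add: k1_def power2_eq_square)
      finally show ?thesis using young[of a "1760 * H * S\<^sup>2 / R"] by linarith
    qed
    have t3: "20 * (\<bar>Phi2 R (2 * R) (sq x)\<bar> * (rad x * (\<bar>Psi x\<bar> * gn x))) \<le> a\<^sup>2 / 6 + 3/2 * (1200 * H * S / R\<^sup>2)\<^sup>2"
    proof -
      have "20 * (\<bar>Phi2 R (2 * R) (sq x)\<bar> * (rad x * (\<bar>Psi x\<bar> * gn x))) \<le> 20 * ((k2 * sqrt (?P x)) * ((2 * R) * ((2 * R * H * S) * gn x)))"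
        using p2[of x] x PsiB[OF x] k0 P0[of x] S0 H0 R gn_nonneg[of x]
        by (intro mult_left_mono mult_mono mult_right_mono) auto
      also have "\<dots> = a * (80 * k2 * R\<^sup>2 * H * S)" by (simp add: a_def mult_ac power2_eq_square)
      also have "80 * k2 * R\<^sup>2 * H * S = 1200 * H * S / R\<^sup>2" using R by (simp add: k2_def power2_eq_square power4_eq_xxxx)
      finally show ?thesis using young[of a "1200 * H * S / R\<^sup>2"] by linarith
    qed
    have t4: "20 * (\<bar>Phi1 R (2 * R) (sq x)\<bar> * (rad x * w x ^ 3)) \<le> 1760 * S^3 / R"
    proof -
      have "k1 * sqrt (?P x) \<le> k1 * 1" using k0 P1[of x] by (intro mult_left_mono) auto
      then have "\<bar>Phi1 R (2 * R) (sq x)\<bar> \<le> k1" using p1[of x] by linarith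
      then have "20 * (\<bar>Phi1 R (2 * R) (sq x)\<bar> * (rad x * w x ^ 3)) \<le> 20 * (k1 * ((2 * R) * S ^ 3))"
        using x wS k0 S0 R w_nonneg[of x] by (intro mult_left_mono mult_mono power_mono) auto
      also have "\<dots> = 1760 * S^3 / R" using R by (simp add: k1_def power2_eq_square)
      finally show ?thesis .
    qed
    have "20 * EE R (2 * R) x = 20 * (\<bar>Phi1 R (2 * R) (sq x)\<bar> * (rad x * (w x * gn x)))
       + 20 * (\<bar>Phi1 R (2 * R) (sq x)\<bar> * (rad x * w x ^ 3))
       + 20 * (\<bar>Phi1 R (2 * R) (sq x)\<bar> * (\<bar>Psi x\<bar> * (w x * gn x)))
       + 20 * (\<bar>Phi2 R (2 * R) (sq x)\<bar> * (rad x * (\<bar>Psi x\<bar> * gn x)))"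
      by (simp add: EE_def algebra_simps)
    also have "\<dots> \<le> 1/2 * a\<^sup>2 + B" unfolding B_def using t1 t2 t3 t4 by linarith
    finally show ?thesis by (simp add: a2)
  qed
  define Z where "Z = (\<integral>x. indicator (OmR (2 * R)) x * (?P x * grad_sq u x) \<partial>lborel)"
  have np: "nice (\<lambda>x. ?P x * grad_sq u x)" by (intro nice_intros nice_Phis[OF RR(1,2)])
  have iP: "integrable lborel (\<lambda>x. indicator (OmR (2 * R)) x * (?P x * grad_sq u x))"
    by (rule nice_cylinder[OF np RR(4)])
  have iV: "integrable lborel (\<lambda>x. indicator (OmR r) x * 1 :: real)" if "0 \<le> r" for r
    by (rule nice_cylinder[OF nice_const that])
  have "Z \<le> (\<integral>x. indicator (OmR (2 * R)) x * (20 * EE R (2 * R) x) \<partial>lborel)"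
    unfolding Z_def by (rule energy_inequality[OF RR(1,2)])
  also have "\<dots> \<le> (\<integral>x. 1/2 * (indicator (OmR (2 * R)) x * (?P x * grad_sq u x))
      + B * (indicator (OmR (2 * R)) x * 1 - indicator (OmR R) x * 1) \<partial>lborel)"
  proof (rule integral_mono)
    show "integrable lborel (\<lambda>x. indicator (OmR (2 * R)) x * (20 * EE R (2 * R) x))"
      by (intro nice_cylinder RR nice_intros nice_EE)
    show "integrable lborel (\<lambda>x. 1/2 * (indicator (OmR (2 * R)) x * (?P x * grad_sq u x))
      + B * (indicator (OmR (2 * R)) x * 1 - indicator (OmR R) x * 1))"
      using iP iV[OF RR(1)] iV[OF RR(4)] by simp
    fix x
    show "indicator (OmR (2 * R)) x * (20 * EE R (2 * R) x) \<le> 1/2 * (indicator (OmR (2 * R)) x * (?P x * grad_sq u x))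
      + B * (indicator (OmR (2 * R)) x * 1 - indicator (OmR R) x * 1)"
    proof (cases "x \<in> OmR (2 * R)")
      case True
      then have x: "x \<in> Om" "rad x < 2 * R" using R by (auto simp: OmR_eq)
      show ?thesis
      proof (cases "rad x < R")
        case T: True
        then have "sq x \<le> R\<^sup>2" using R rad_sq[of x] power_mono[of "rad x" R 2] by (simp add: sq_def)
        then have "EE R (2 * R) x = 0" by (simp add: EE_def Phi_inner[OF RR(1,2)])
        moreover have "x \<in> OmR R" using x T R by (simp add: OmR_eq)
        ultimately show ?thesis using True P0[of x] grad_sq_nonneg[of x] by simp
      next
        case False
        then have "x \<notin> OmR R" using R by (simp add: OmR_eq)
        then show ?thesis using True pw[of x] x False by simp
      qed
    next
      case False
      then have "x \<notin> OmR R" using R by (auto simp: OmR_eq)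
      then show ?thesis using False by simp
    qed
  qed
  also have "\<dots> = 1/2 * Z + B * (\<integral>q. indicator (ann R (2 * R)) q * vint (\<lambda>x. 1) q \<partial>lborel)"
    using iP iV[OF RR(1)] iV[OF RR(4)] ann_fubini(2)[OF nice_const RR(1,3), of 1]
    by (simp add: Z_def)
  finally have Z1: "Z \<le> 1/2 * Z + B * (\<integral>q. indicator (ann R (2 * R)) q * vint (\<lambda>x. 1) q \<partial>lborel)" .
  have "(\<integral>q. indicator (ann R (2 * R)) q * vint (\<lambda>x. 1) q \<partial>lborel) \<le> (\<integral>q. H * indicator (ann R (2 * R)) q \<partial>lborel)"
  proof (rule integral_mono[OF ann_fubini(1)[OF nice_const RR(1,3)]])
    show "integrable lborel (\<lambda>q. H * indicator (ann R (2 * R)) q)" using measure_ann(1)[OF RR(1,3)] by simp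
    fix q show "indicator (ann R (2 * R)) q * vint (\<lambda>x. 1) q \<le> H * indicator (ann R (2 * R)) q"
      using H[of "norm q"] by (auto simp: indicator_def vint_one ann_def)
  qed
  also have "\<dots> = H * (pi * (3 * R\<^sup>2))" using measure_ann(2)[OF RR(1,3)] by (simp add: d[unfolded power_mult_distrib] power_mult_distrib)
  also have "\<dots> \<le> H * (4 * (3 * R\<^sup>2))" using H0 pi_less_4 by (intro mult_left_mono mult_right_mono) auto
  finally have "B * (\<integral>q. indicator (ann R (2 * R)) q * vint (\<lambda>x. 1) q \<partial>lborel) \<le> B * (12 * H * R\<^sup>2)"
    using B0 by (intro mult_left_mono) auto
  with Z1 have "Z \<le> 2 * (B * (12 * H * R\<^sup>2))" by linarith
  then have "Y R \<le> 24 * (B * H * R\<^sup>2)" using Y_le_Phi[OF RR(1,2)] by (simp add: Z_def mult_ac)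
  also have "B * H * R\<^sup>2 = 4646400 * (H * S\<^sup>2) + 4646400 * (H^3 * S^4) + 2160000 * (H^3 * S\<^sup>2 / R\<^sup>2) + 1760 * (R * H * S^3)"
    using R by (simp add: B_def field_simps power2_eq_square power3_eq_cube power4_eq_xxxx)
  also have "24 * (4646400 * (H * S\<^sup>2) + 4646400 * (H^3 * S^4) + 2160000 * (H^3 * S\<^sup>2 / R\<^sup>2) + 1760 * (R * H * S^3))
     \<le> 1000000000 * (H * S\<^sup>2 + H^3 * S\<^sup>2 / R\<^sup>2 + H^3 * S^4 + R * H * S^3)"
  proof -
    have "0 \<le> H * S\<^sup>2" "0 \<le> H^3 * S^4" "0 \<le> H^3 * S\<^sup>2 / R\<^sup>2" "0 \<le> R * H * S^3" using H0 S0 R by auto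
    then show ?thesis unfolding distrib_left by linarith
  qed
  finally show ?thesis .
qed

end

section \<open>Decay of the energy\<close>

lemma pigeonhole_increment:
  fixes a :: "nat \<Rightarrow> real"
  assumes "0 < N"
  shows "\<exists>j<N. a (Suc j) - a j \<le> (a N - a 0) / N"
proof (rule ccontr)
  assume "\<not> ?thesis"
  then have "(a N - a 0) / N < a (Suc j) - a j" if "j < N" for j using that by auto
  then have "(\<Sum>j<N. (a N - a 0) / N) < (\<Sum>j<N. a (Suc j) - a j)"
    using assms by (intro sum_strict_mono) auto
  then show False using assms by (simp add: sum_lessThan_telescope)
qed

text \<open>Splitting \<open>[\<rho>, 2\<rho>]\<close> into about \<open>\<rho>\<^sup>1\<^sup>-\<^sup>\<beta>\<close> annuli and choosing the one that carries the least energy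
  gives \<open>Y(\<rho>) \<le> \<epsilon>(\<rho>) Y(2\<rho>)\<close> with \<open>\<epsilon>(\<rho>) \<rightarrow> 0\<close>, which contradicts polynomial growth.\<close>

lemma doubling_decay:
  fixes Y f :: "real \<Rightarrow> real"
  assumes mono: "\<And>R R'. 0 \<le> R \<Longrightarrow> R \<le> R' \<Longrightarrow> Y R \<le> Y R'" and nn: "\<And>R. 0 \<le> Y R"
    and step: "\<And>R L. 0 < R \<Longrightarrow> 0 < L \<Longrightarrow> L \<le> R \<Longrightarrow> (\<And>r. R \<le> r \<Longrightarrow> r \<le> R + L \<Longrightarrow> f r \<le> L) \<Longrightarrow>
       Y R \<le> K * ((Y (R + L) - Y R) + L / sqrt R * ((Y (R + L) - Y R) * sqrt (Y (R + L) - Y R)))"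
    and K: "0 < K" and C: "0 < C" and \<beta>: "0 \<le> \<beta>"
    and f: "\<And>r. 1 \<le> r \<Longrightarrow> f r \<le> C * r powr \<beta>"
    and \<rho>: "1 \<le> \<rho>" and small: "2 * (C * (2 * \<rho>) powr \<beta>) \<le> \<rho>"
  shows "Y \<rho> \<le> K * (2 * (C * (2 * \<rho>) powr \<beta>) / \<rho> + sqrt (128 * C^5 * ((2 * \<rho>) powr (5 * \<beta> - 4) * Y (2 * \<rho>)))) * Y (2 * \<rho>)"
proof -
  define l where "l = C * (2 * \<rho>) powr \<beta>"
  have l0: "0 < l" using C \<rho> by (simp add: l_def)
  have l\<rho>: "2 * l \<le> \<rho>" using small by (simp add: l_def)
  \<comment> \<open>As many annuli of width \<open>l\<close> as fit into [\<rho>, 2\<rho>]. Since 2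
    l \<le> \<rho>, rounding down costs at most a factor 2.\<close>
  define N where "N = nat \<lfloor>\<rho> / l\<rfloor>"
  have q2: "2 \<le> \<rho> / l" using l\<rho> l0 by (simp add: pos_le_divide_eq)
  have Nle: "real N \<le> \<rho> / l" using q2 by (simp add: N_def)
  have Nge: "\<rho> / (2 * l) \<le> real N"
  proof -
    have "\<rho> / l - 1 < real N" using q2 unfolding N_def by linarith
    moreover have "\<rho> / (2 * l) = \<rho> / l / 2" by simp
    ultimately show ?thesis using q2 by linarith
  qed
  have N0: "0 < N"
  proof -
    have "0 < \<rho> / (2 * l)" using l0 \<rho> by simp
    then show ?thesis using Nge by linarith
  qed
  define Y2 where "Y2 = Y (2 * \<rho>)"
  have Y20: "0 \<le> Y2" using nn by (simp add: Y2_def)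
  obtain j where j: "j < N" "Y (\<rho> + real (Suc j) * l) - Y (\<rho> + real j * l) \<le> (Y (\<rho> + real N * l) - Y (\<rho> + real 0 * l)) / N"
    using pigeonhole_increment[OF N0, of "\<lambda>j. Y (\<rho> + real j * l)"] by blast
  define R where "R = \<rho> + real j * l"
  define d where "d = Y (R + l) - Y R"
  have Rl: "R + l = \<rho> + real (Suc j) * l" by (simp add: R_def algebra_simps)
  have R\<rho>: "\<rho> \<le> R" using l0 by (simp add: R_def)
  have Nl: "real N * l \<le> \<rho>" using Nle l0 by (simp add: pos_le_divide_eq)
  have R2: "R + l \<le> 2 * \<rho>"
  proof -
    have "real (Suc j) * l \<le> real N * l" using j l0 by (intro mult_right_mono) auto
    then show ?thesis using Nl Rl by linarith
  qed
  have d0: "0 \<le> d" using mono[of R "R + l"] l0 R\<rho> \<rho> by (simp add: d_def)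
  have dle: "d \<le> Y2 * (2 * l / \<rho>)"
  proof -
    have "d \<le> (Y (\<rho> + real N * l) - Y \<rho>) / N" using j(2) unfolding d_def Rl by (simp add: R_def)
    also have "\<dots> \<le> Y2 / N"
      using mono[of "\<rho> + real N * l" "2 * \<rho>"] Nl nn[of \<rho>] \<rho> l0 by (intro divide_right_mono) (auto simp: Y2_def)
    also have "\<dots> \<le> Y2 / (\<rho> / (2 * l))" using Nge N0 l0 \<rho> Y20 by (intro divide_left_mono) auto
    finally show ?thesis by simp
  qed
  have "Y \<rho> \<le> Y R" using mono R\<rho> \<rho> by simp
  also have "Y R \<le> K * (d + l / sqrt R * (d * sqrt d))"
    unfolding d_def
  proof (rule step)
    fix r assume r: "R \<le> r" "r \<le> R + l"
    then have "f r \<le> C * r powr \<beta>" using R\<rho> \<rho> by (intro f) auto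
    also have "\<dots> \<le> l" unfolding l_def using r R\<rho> R2 \<rho> \<beta> C by (intro mult_left_mono powr_mono2) auto
    finally show "f r \<le> l" .
  qed (use R\<rho> \<rho> l0 l\<rho> in auto)
  also have "\<dots> \<le> K * (Y2 * (2 * l / \<rho>) + l / sqrt \<rho> * ((Y2 * (2 * l / \<rho>)) * sqrt (Y2 * (2 * l / \<rho>))))"
  proof -
    have "l / sqrt R \<le> l / sqrt \<rho>" using l0 R\<rho> \<rho> by (intro divide_left_mono) auto
    moreover have "d * sqrt d \<le> (Y2 * (2 * l / \<rho>)) * sqrt (Y2 * (2 * l / \<rho>))"
      using d0 dle by (intro mult_mono real_sqrt_le_mono) auto
    ultimately have "l / sqrt R * (d * sqrt d) \<le> l / sqrt \<rho> * ((Y2 * (2 * l / \<rho>)) * sqrt (Y2 * (2 * l / \<rho>)))"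
      by (rule mult_mono) (use l0 \<rho> d0 in auto)
    then show ?thesis using K dle by (intro mult_left_mono add_mono) auto
  qed
  also have "\<dots> = K * (2 * l / \<rho> + l / sqrt \<rho> * ((2 * l / \<rho>) * sqrt (Y2 * (2 * l / \<rho>)))) * Y2"
    by (simp add: algebra_simps)
  \<comment> \<open>The square of the left side is 8 l^5 Y2 / \<rho>^4. With l = C (2\<rho>)^\<beta>
    this produces the exponent 5\<beta> - 4, and 128 = 8 * 16 with 16 from (2\<rho>)^4.\<close>
  also have "l / sqrt \<rho> * ((2 * l / \<rho>) * sqrt (Y2 * (2 * l / \<rho>))) = sqrt (128 * C^5 * ((2 * \<rho>) powr (5 * \<beta> - 4) * Y2))"
  proof (rule real_sqrt_unique[symmetric])
    have l5: "l ^ 5 = C ^ 5 * (16 * \<rho> ^ 4 * (2 * \<rho>) powr (5 * \<beta> - 4))"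
    proof -
      have "((2 * \<rho>) powr \<beta>) ^ 5 = (2 * \<rho>) powr (5 * \<beta>)"
        using \<rho> powr_realpow[of "(2 * \<rho>) powr \<beta>" 5] by (simp add: powr_powr mult.commute)
      also have "\<dots> = (2 * \<rho>) powr (4 + (5 * \<beta> - 4))" by simp
      also have "\<dots> = (2 * \<rho>) ^ 4 * (2 * \<rho>) powr (5 * \<beta> - 4)"
        unfolding powr_add using \<rho> powr_realpow[of "2 * \<rho>" 4] by simp
      finally show ?thesis by (simp add: l_def power_mult_distrib)
    qed
    have "(l / sqrt \<rho> * ((2 * l / \<rho>) * sqrt (Y2 * (2 * l / \<rho>))))\<^sup>2 = l\<^sup>2 / \<rho> * ((2 * l / \<rho>)\<^sup>2 * (Y2 * (2 * l / \<rho>)))"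
      using \<rho> l0 Y20 by (simp add: power_mult_distrib power_divide)
    also have "\<dots> = 8 * l ^ 5 * Y2 / \<rho> ^ 4"
      using \<rho> by (simp add: field_simps eval_nat_numeral)
    also have "\<dots> = 128 * C^5 * ((2 * \<rho>) powr (5 * \<beta> - 4) * Y2)" unfolding l5 using \<rho> by simp
    finally show "(l / sqrt \<rho> * ((2 * l / \<rho>) * sqrt (Y2 * (2 * l / \<rho>))))\<^sup>2 = 128 * C^5 * ((2 * \<rho>) powr (5 * \<beta> - 4) * Y2)" .
  qed (use \<rho> l0 Y20 in auto)
  finally show ?thesis by (simp add: Y2_def l_def)
qed

text \<open>Beyond some radius the doubling factor is below 1/32, so Y(\<rho>) is at most 32^(-n)
  Y(2^n \<rho>). The limit hypothesis permits growth of at most \<rho>^4, a factor 16 per doubling,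
  so the bound decays like 2^(-n).\<close>

lemma energy_vanishes:
  fixes Y f :: "real \<Rightarrow> real"
  assumes mono: "\<And>R R'. 0 \<le> R \<Longrightarrow> R \<le> R' \<Longrightarrow> Y R \<le> Y R'" and nn: "\<And>R. 0 \<le> Y R"
    and step: "\<And>R L. 0 < R \<Longrightarrow> 0 < L \<Longrightarrow> L \<le> R \<Longrightarrow> (\<And>r. R \<le> r \<Longrightarrow> r \<le> R + L \<Longrightarrow> f r \<le> L) \<Longrightarrow>
       Y R \<le> K * ((Y (R + L) - Y R) + L / sqrt R * ((Y (R + L) - Y R) * sqrt (Y (R + L) - Y R)))"
    and K: "0 < K" and C: "0 < C" and \<beta>: "0 \<le> \<beta>" "\<beta> < 4/5"
    and f: "\<And>r. 1 \<le> r \<Longrightarrow> f r \<le> C * r powr \<beta>"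
    and lim: "((\<lambda>R. R powr (5 * \<beta> - 4) * Y R) \<longlongrightarrow> 0) at_top"
    and R: "0 \<le> R"
  shows "Y R = 0"
proof -
  have t2: "filterlim (\<lambda>\<rho>::real. 2 * \<rho>) at_top at_top"
    by (rule filterlim_tendsto_pos_mult_at_top[OF tendsto_const]) (auto intro: filterlim_ident)
  have pw: "((\<lambda>\<rho>. \<rho> powr (\<beta> - 1)) \<longlongrightarrow> 0) at_top"
    using \<beta> by (intro tendsto_neg_powr filterlim_ident) auto
  have e: "(2 * \<rho>) powr \<beta> / \<rho> = 2 * (2 * \<rho>) powr (\<beta> - 1)" if "\<rho> \<ge> 1" for \<rho> :: real
    using that by (simp add: powr_diff)
  have lim1: "((\<lambda>\<rho>. 2 * (C * (2 * \<rho>) powr \<beta>) / \<rho>) \<longlongrightarrow> 0) at_top"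
  proof (rule Lim_transform_eventually)
    have "((\<lambda>\<rho>. 4 * C * (2 * \<rho>) powr (\<beta> - 1)) \<longlongrightarrow> 4 * C * 0) at_top"
      by (intro tendsto_intros filterlim_compose[OF pw t2])
    then show "((\<lambda>\<rho>. 4 * C * (2 * \<rho>) powr (\<beta> - 1)) \<longlongrightarrow> 0) at_top" by simp
    show "\<forall>\<^sub>F \<rho> in at_top. 4 * C * (2 * \<rho>) powr (\<beta> - 1) = 2 * (C * (2 * \<rho>) powr \<beta>) / \<rho>"
      using eventually_ge_at_top[of 1]
    proof (rule eventually_mono)
      fix \<rho> :: real assume "1 \<le> \<rho>"
      have "2 * (C * (2 * \<rho>) powr \<beta>) / \<rho> = 2 * C * ((2 * \<rho>) powr \<beta> / \<rho>)" by simp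
      then show "4 * C * (2 * \<rho>) powr (\<beta> - 1) = 2 * (C * (2 * \<rho>) powr \<beta>) / \<rho>"
        unfolding e[OF \<open>1 \<le> \<rho>\<close>] by simp
    qed
  qed
  have "((\<lambda>\<rho>. K * (2 * (C * (2 * \<rho>) powr \<beta>) / \<rho> + sqrt (128 * C^5 * ((2 * \<rho>) powr (5 * \<beta> - 4) * Y (2 * \<rho>)))))
     \<longlongrightarrow> K * (0 + sqrt (128 * C^5 * 0))) at_top"
    by (intro tendsto_intros lim1 filterlim_compose[OF lim t2])
  then have lim2: "((\<lambda>\<rho>. K * (2 * (C * (2 * \<rho>) powr \<beta>) / \<rho> + sqrt (128 * C^5 * ((2 * \<rho>) powr (5 * \<beta> - 4) * Y (2 * \<rho>)))))
     \<longlongrightarrow> 0) at_top" by simp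
  have "\<forall>\<^sub>F \<rho> in at_top. K * (2 * (C * (2 * \<rho>) powr \<beta>) / \<rho> + sqrt (128 * C^5 * ((2 * \<rho>) powr (5 * \<beta> - 4) * Y (2 * \<rho>)))) < 1/32"
    by (rule order_tendstoD(2)[OF lim2]) simp
  moreover have "\<forall>\<^sub>F \<rho> in at_top. 2 * (C * (2 * \<rho>) powr \<beta>) / \<rho> < 1"
    by (rule order_tendstoD(2)[OF lim1]) simp
  moreover have "\<forall>\<^sub>F \<rho> in at_top. \<rho> powr (5 * \<beta> - 4) * Y \<rho> < 1"
    by (rule order_tendstoD(2)[OF lim]) simp
  moreover have "\<forall>\<^sub>F \<rho> in at_top. (1::real) \<le> \<rho>" by (rule eventually_ge_at_top)
  ultimately have "\<forall>\<^sub>F \<rho> in at_top. 1 \<le> \<rho> \<and> Y \<rho> \<le> 1/32 * Y (2 * \<rho>) \<and> Y \<rho> \<le> \<rho> ^ 4"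
  proof eventually_elim
    case (elim \<rho>)
    have "Y \<rho> \<le> K * (2 * (C * (2 * \<rho>) powr \<beta>) / \<rho> + sqrt (128 * C^5 * ((2 * \<rho>) powr (5 * \<beta> - 4) * Y (2 * \<rho>)))) * Y (2 * \<rho>)"
      by (rule doubling_decay[OF mono nn step K C \<beta>(1) f]) (use elim in \<open>auto simp: field_simps\<close>)
    also have "\<dots> \<le> 1/32 * Y (2 * \<rho>)" using elim(1) nn by (intro mult_right_mono) auto
    finally have 1: "Y \<rho> \<le> 1/32 * Y (2 * \<rho>)" .
    have "\<rho> powr (4 - 5 * \<beta>) * (\<rho> powr (5 * \<beta> - 4) * Y \<rho>) \<le> \<rho> powr (4 - 5 * \<beta>) * 1"
      using elim(3) by (intro mult_left_mono) auto
    moreover have "\<rho> powr (4 - 5 * \<beta>) * \<rho> powr (5 * \<beta> - 4) = 1" using elim(4) by (simp add: powr_add[symmetric])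
    ultimately have "Y \<rho> \<le> \<rho> powr (4 - 5 * \<beta>)" by (simp add: mult.assoc[symmetric])
    also have "\<dots> \<le> \<rho> powr 4" using elim(4) \<beta> by (intro powr_mono) auto
    also have "\<dots> = \<rho> ^ 4" using elim(4) powr_realpow[of \<rho> 4] by simp
    finally show ?case using 1 elim(4) by simp
  qed
  then obtain \<rho>0 where \<rho>0: "\<And>\<rho>. \<rho>0 \<le> \<rho> \<Longrightarrow> 1 \<le> \<rho> \<and> Y \<rho> \<le> 1/32 * Y (2 * \<rho>) \<and> Y \<rho> \<le> \<rho> ^ 4"
    unfolding eventually_at_top_linorder by blast
  define \<rho> where "\<rho> = max \<rho>0 R"
  have \<rho>1: "\<rho>0 \<le> \<rho>" "1 \<le> \<rho>" using \<rho>0[of \<rho>] by (auto simp: \<rho>_def)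
  have big: "\<rho>0 \<le> 2 ^ n * \<rho>" for n
  proof -
    have "1 * \<rho> \<le> 2 ^ n * \<rho>" using \<rho>1 by (intro mult_right_mono) auto
    then show ?thesis using \<rho>1 by linarith
  qed
  have it: "Y \<rho> \<le> (1/32) ^ n * Y (2 ^ n * \<rho>)" for n
  proof (induction n)
    case (Suc n)
    have "(1/32) ^ n * Y (2 ^ n * \<rho>) \<le> (1/32) ^ n * (1/32 * Y (2 * (2 ^ n * \<rho>)))"
      using \<rho>0[OF big[of n]] by (intro mult_left_mono) auto
    also have "\<dots> = (1/32) ^ Suc n * Y (2 ^ Suc n * \<rho>)" by (simp add: mult.assoc)
    finally show ?case using Suc by linarith
  qed simp
  have "Y \<rho> \<le> \<rho> ^ 4 * (1/2) ^ n" for n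
  proof -
    have "(1/32) ^ n * Y (2 ^ n * \<rho>) \<le> (1/32) ^ n * (2 ^ n * \<rho>) ^ 4"
      using \<rho>0[OF big[of n]] by (intro mult_left_mono) auto
    also have "\<dots> = \<rho> ^ 4 * ((1/32) ^ n * (2 ^ 4) ^ n)"
    proof -
      have "((2::real) ^ n) ^ 4 = (2 ^ 4) ^ n" by (simp only: power_mult[symmetric] mult.commute)
      then show ?thesis by (simp only: power_mult_distrib mult_ac)
    qed
    also have "(1/32) ^ n * (2 ^ 4) ^ n = (1/2 :: real) ^ n" by (simp add: power_mult_distrib[symmetric])
    finally show ?thesis using it[of n] by linarith
  qed
  moreover have "(\<lambda>n. \<rho> ^ 4 * (1/2) ^ n) \<longlonglongrightarrow> \<rho> ^ 4 * 0"
    by (intro tendsto_intros LIMSEQ_power_zero) auto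
  ultimately have "Y \<rho> \<le> \<rho> ^ 4 * 0" by (intro LIMSEQ_le_const) auto
  then show ?thesis using mono[OF R, of \<rho>] nn[of R] by (simp add: \<rho>_def)
qed

section \<open>The Liouville theorem\<close>

context axi_flow begin

lemma w_slice_eq: "0 \<le> R \<Longrightarrow> f1 R \<le> z \<Longrightarrow> z \<le> f2 R \<Longrightarrow> norm (u (pt R 0 z)) = w (pt R 0 z)"
  by (cases "pt R 0 z \<in> Om")
     (use noslip1[of "pt R 0 z"] noslip2[of "pt R 0 z"] in \<open>auto simp: w_def U_on U_off domain_def\<close>)

text \<open>By symmetry the half-plane \<theta> = 0 carries all values of \<open>w\<close>. Outside
  the domain the left side is 0, while the supremum dominates the nonnegative value at the lower
  wall.\<close>

lemma w_le_Sup: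
  "w x \<le> Sup ((\<lambda>z. norm (u (pt (rad x) 0 z))) ` {f1 (rad x)..f2 (rad x)})"
proof -
  let ?I = "{f1 (rad x)..f2 (rad x)}"
  have im: "(\<lambda>z. norm (u (pt (rad x) 0 z))) ` ?I = (\<lambda>z. w (pt (rad x) 0 z)) ` ?I"
    by (intro image_cong refl w_slice_eq) auto
  have "continuous_on ?I (\<lambda>z. w (pt (rad x) 0 z))"
    by (rule continuous_on_compose2[OF continuous_w[of UNIV]]) (auto intro!: continuous_intros)
  then have bdd: "bdd_above ((\<lambda>z. w (pt (rad x) 0 z)) ` ?I)"
    by (intro bounded_imp_bdd_above compact_imp_bounded compact_continuous_image) auto
  have wx: "w x = w (pt (rad x) 0 (x$3))"
    unfolding w_def by (rule norm_U_radial) auto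
  show ?thesis unfolding im
  proof (cases "x \<in> Om")
    case True
    then have "x$3 \<in> ?I" by (auto simp: domain_def)
    then show "w x \<le> Sup ((\<lambda>z. w (pt (rad x) 0 z)) ` ?I)" unfolding wx by (intro cSUP_upper bdd)
  next
    case False
    have "w (pt (rad x) 0 (f1 (rad x))) \<le> Sup ((\<lambda>z. w (pt (rad x) 0 z)) ` ?I)"
      by (intro cSUP_upper bdd) (use f_less[of "rad x"] in auto)
    then show "w x \<le> Sup ((\<lambda>z. w (pt (rad x) 0 z)) ` ?I)"
      using False w_nonneg[of "pt (rad x) 0 (f1 (rad x))"] by (simp add: w_off)
  qed
qed

text \<open>Put T = 2R, H = C T^\<beta> and S = \<epsilon> T^(1 - 2\<beta>) into
  \<open>sup_bound_energy\<close>. The terms H^3 S^4 and R H S^3 scale exactly as T^(4 - 5\<beta>);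
  the other two carry an extra second or fourth power of T^(\<beta> - 1).\<close>

lemma sup_decay_imp_energy_decay:
  assumes C: "0 < C" and \<beta>: "0 \<le> \<beta>" "\<beta> < 1/2"
    and growth: "\<And>r. 1 \<le> r \<Longrightarrow> f2 r - f1 r \<le> C * r powr \<beta>"
    and lim: "((\<lambda>R. R powr (2*\<beta> - 1) * Sup ((\<lambda>z. norm (u (pt R 0 z))) ` {f1 R..f2 R})) \<longlongrightarrow> 0) at_top"
  shows "((\<lambda>R. R powr (5*\<beta> - 4) * Y R) \<longlongrightarrow> 0) at_top"
proof (rule tendstoI)
  fix \<eta> :: real assume \<eta>: "0 < \<eta>"
  \<comment> \<open>16 is 2^4, from passing between R and 2R in the weight; the bracket adds up the
    coefficients of C and C^3 in \<open>Zle\<close>.\<close>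
  define A where "A = 16 * (1000000000 * (2 * C + 5 * C^3))"
  have A: "0 < A" unfolding A_def using C by (intro mult_pos_pos add_pos_pos) auto
  \<comment> \<open>The cap at 1 allows every higher power of \<epsilon> to be replaced by
    \<epsilon>.\<close>
  define \<epsilon> where "\<epsilon> = min 1 (\<eta> / (2 * A))"
  have \<epsilon>: "0 < \<epsilon>" "\<epsilon> \<le> 1" "A * \<epsilon> < \<eta>"
  proof -
    show "0 < \<epsilon>" "\<epsilon> \<le> 1" using A \<eta> by (auto simp: \<epsilon>_def)
    have "A * \<epsilon> \<le> A * (\<eta> / (2 * A))" using A by (intro mult_left_mono) (auto simp: \<epsilon>_def)
    also have "\<dots> < \<eta>" using A \<eta> by simp
    finally show "A * \<epsilon> < \<eta>" .
  qed
  have "\<forall>\<^sub>F R in at_top. R powr (2*\<beta> - 1) * Sup ((\<lambda>z. norm (u (pt R 0 z))) ` {f1 R..f2 R}) < \<epsilon>"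
    by (rule order_tendstoD(2)[OF lim \<epsilon>(1)])
  then obtain R1 where R1: "\<And>R. R1 \<le> R \<Longrightarrow> R powr (2*\<beta> - 1) * Sup ((\<lambda>z. norm (u (pt R 0 z))) ` {f1 R..f2 R}) < \<epsilon>"
    unfolding eventually_at_top_linorder by blast
  have wb: "w x \<le> \<epsilon> * rad x powr (1 - 2*\<beta>)" if x: "R1 \<le> rad x" "1 \<le> rad x" for x
  proof -
    have "rad x powr (2*\<beta> - 1) * w x \<le> \<epsilon>"
      using mult_left_mono[OF w_le_Sup[of x], of "rad x powr (2*\<beta> - 1)"] R1[OF x(1)] by simp
    then have "rad x powr (1 - 2*\<beta>) * (rad x powr (2*\<beta> - 1) * w x) \<le> rad x powr (1 - 2*\<beta>) * \<epsilon>"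
      by (intro mult_left_mono) auto
    moreover have "rad x powr (1 - 2*\<beta>) * rad x powr (2*\<beta> - 1) = 1" using x by (simp add: powr_add[symmetric])
    then have "rad x powr (1 - 2*\<beta>) * (rad x powr (2*\<beta> - 1) * w x) = w x" by (metis mult.assoc mult_1)
    ultimately show ?thesis by (simp only: mult.commute)
  qed
  have main: "R powr (5*\<beta> - 4) * Y R \<le> A * \<epsilon>" if R: "R1 \<le> R" "1 \<le> R" for R
  proof -
    define T where "T = 2 * R"
    define b where "b = T powr \<beta>"
    have T: "1 \<le> T" "0 < T" using R by (auto simp: T_def)
    have b1: "1 \<le> b" using T \<beta> by (simp add: b_def ge_one_powr_ge_zero)
    have bT: "b \<le> T" unfolding b_def using powr_mono[of \<beta> 1 T] T \<beta> by simp
    \<comment> \<open>Expressing all powers through \<open>b\<close> and \<open>T\<close> makes the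
      comparison of the four terms an identity between rational expressions.\<close>
    define S where "S = \<epsilon> * T / b\<^sup>2"
    define H where "H = C * b"
    have bb: "b\<^sup>2 = T powr (2 * \<beta>)" using T powr_realpow[of b 2] b1 by (simp add: b_def powr_powr mult.commute)
    have S_eq: "S = \<epsilon> * T powr (1 - 2*\<beta>)" unfolding S_def bb using T by (simp add: powr_diff)
    have "Y R \<le> 1000000000 * (H * S\<^sup>2 + H^3 * S\<^sup>2 / R\<^sup>2 + H^3 * S^4 + R * H * S^3)"
    proof (rule sup_bound_energy)
      show "0 < R" using R by simp
      show "w x \<le> S" if x: "R \<le> rad x" "rad x \<le> 2 * R" for x
      proof -
        have "w x \<le> \<epsilon> * rad x powr (1 - 2*\<beta>)" using x R by (intro wb) auto
        also have "\<dots> \<le> S" unfolding S_eq T_def using x R \<epsilon> \<beta> by (intro mult_left_mono powr_mono2) auto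
        finally show ?thesis .
      qed
      show "f2 r - f1 r \<le> H" if r: "R \<le> r" "r \<le> 2 * R" for r
      proof -
        have "f2 r - f1 r \<le> C * r powr \<beta>" using r R by (intro growth) auto
        also have "\<dots> \<le> H" unfolding H_def b_def T_def using r R C \<beta> by (intro mult_left_mono powr_mono2) auto
        finally show ?thesis .
      qed
    qed
    also have "H * S\<^sup>2 + H^3 * S\<^sup>2 / R\<^sup>2 + H^3 * S^4 + R * H * S^3 =
        (T^4 / b^5) * (C * \<epsilon>\<^sup>2 * (b / T)\<^sup>2 + 4 * C^3 * \<epsilon>\<^sup>2 * (b / T)^4 + C^3 * \<epsilon>^4 + C * \<epsilon>^3 / 2)"
    proof -
      have b0: "b \<noteq> 0" "T \<noteq> 0" using b1 T by auto
      have Rt: "R = T / 2" by (simp add: T_def)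
      have e1: "H * S\<^sup>2 = (T^4 / b^5) * (C * \<epsilon>\<^sup>2 * (b / T)\<^sup>2)"
        unfolding H_def S_def using b0 by (simp add: field_simps eval_nat_numeral)
      have e2: "H^3 * S\<^sup>2 / R\<^sup>2 = (T^4 / b^5) * (4 * C^3 * \<epsilon>\<^sup>2 * (b / T)^4)"
        unfolding H_def S_def Rt using b0 by (simp add: field_simps eval_nat_numeral)
      have e3: "H^3 * S^4 = (T^4 / b^5) * (C^3 * \<epsilon>^4)"
        unfolding H_def S_def using b0 by (simp add: field_simps eval_nat_numeral)
      have e4: "R * H * S^3 = (T^4 / b^5) * (C * \<epsilon>^3 / 2)"
        unfolding H_def S_def Rt using b0 by (simp add: field_simps eval_nat_numeral)
      show ?thesis unfolding e1 e2 e3 e4 by (simp only: distrib_left)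
    qed
    finally have Y1: "Y R \<le> 1000000000 * ((T^4 / b^5) * (C * \<epsilon>\<^sup>2 * (b / T)\<^sup>2 + 4 * C^3 * \<epsilon>\<^sup>2 * (b / T)^4 + C^3 * \<epsilon>^4 + C * \<epsilon>^3 / 2))" .
    have Zle: "C * \<epsilon>\<^sup>2 * (b / T)\<^sup>2 + 4 * C^3 * \<epsilon>\<^sup>2 * (b / T)^4 + C^3 * \<epsilon>^4 + C * \<epsilon>^3 / 2 \<le> (2 * C + 5 * C^3) * \<epsilon>"
    proof -
      have p: "\<epsilon> ^ Suc n \<le> \<epsilon>" for n using \<epsilon> power_decreasing[of 1 "Suc n" \<epsilon>] by simp
      have q: "(b / T) ^ n \<le> 1" "0 \<le> (b / T) ^ n" for n using bT b1 T by (auto intro!: power_le_one)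
      have C3: "0 < C^3" using C by simp
      have x1: "C * \<epsilon>\<^sup>2 * (b / T)\<^sup>2 \<le> C * \<epsilon>"
      proof -
        have "C * \<epsilon>\<^sup>2 * (b / T)\<^sup>2 \<le> C * \<epsilon> * 1" using C \<epsilon> p[of 1] q[of 2]
          by (intro mult_mono mult_left_mono) (auto simp: numeral_2_eq_2)
        then show ?thesis by simp
      qed
      have x2: "4 * C^3 * \<epsilon>\<^sup>2 * (b / T)^4 \<le> 4 * C^3 * \<epsilon>"
      proof -
        have "4 * C^3 * \<epsilon>\<^sup>2 * (b / T)^4 \<le> 4 * C^3 * \<epsilon> * 1" using C3 \<epsilon> p[of 1] q[of 4]
          by (intro mult_mono mult_left_mono) (auto simp: numeral_2_eq_2)
        then show ?thesis by simp
      qed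
      have x3: "C^3 * \<epsilon>^4 \<le> C^3 * \<epsilon>" using C3 p[of 3] by (intro mult_left_mono) (auto simp: numeral_eq_Suc)
      have x4: "C * \<epsilon>^3 / 2 \<le> C * \<epsilon>"
      proof -
        have "C * \<epsilon>^3 \<le> C * \<epsilon>" using C p[of 2] by (intro mult_left_mono) (auto simp: numeral_eq_Suc)
        moreover have "0 \<le> C * \<epsilon>^3" using C \<epsilon> by simp
        ultimately show ?thesis by linarith
      qed
      show ?thesis using x1 x2 x3 x4 by (simp add: algebra_simps)
    qed
    note Y1
    also have "1000000000 * ((T^4 / b^5) * (C * \<epsilon>\<^sup>2 * (b / T)\<^sup>2 + 4 * C^3 * \<epsilon>\<^sup>2 * (b / T)^4 + C^3 * \<epsilon>^4 + C * \<epsilon>^3 / 2)) \<le> 1000000000 * (T^4 / b^5 * ((2 * C + 5 * C^3) * \<epsilon>))"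
      using T b1 by (intro mult_left_mono Zle) auto
    finally have Yb: "Y R \<le> 1000000000 * (T^4 / b^5 * ((2 * C + 5 * C^3) * \<epsilon>))" .
    have "R powr (5*\<beta> - 4) \<le> 16 * (b^5 / T^4)"
    proof -
      have "R powr (5*\<beta> - 4) = (T / 2) powr (5*\<beta> - 4)" by (simp add: T_def)
      also have "\<dots> = T powr (5*\<beta> - 4) * 2 powr (4 - 5*\<beta>)"
        using T powr_minus_divide[of 2 "5*\<beta> - 4"] by (simp add: powr_divide)
      also have "\<dots> \<le> T powr (5*\<beta> - 4) * 2 powr 4" using \<beta> by (intro mult_left_mono powr_mono) auto
      also have "(2::real) powr 4 = 16" using powr_realpow[of "2::real" 4] by simp
      also have "T powr (5*\<beta> - 4) = b^5 / T^4"
      proof -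
        have "b^5 = T powr (5 * \<beta>)" using T powr_realpow[of b 5] b1 by (simp add: b_def powr_powr mult.commute)
        moreover have "T^4 = T powr 4" using T powr_realpow[of T 4] by simp
        ultimately show ?thesis by (simp add: powr_diff)
      qed
      finally show ?thesis by (simp add: mult.commute)
    qed
    then have "R powr (5*\<beta> - 4) * Y R \<le> 16 * (b^5 / T^4) * (1000000000 * (T^4 / b^5 * ((2 * C + 5 * C^3) * \<epsilon>)))"
      using Yb Y_nonneg[of R] T b1 by (intro mult_mono) auto
    also have "\<dots> = A * \<epsilon>" using T b1 by (simp add: A_def)
    finally show ?thesis .
  qed
  show "\<forall>\<^sub>F R in at_top. dist (R powr (5*\<beta> - 4) * Y R) 0 < \<eta>"
    unfolding eventually_at_top_linorder
  proof (intro exI[of _ "max R1 1"] allI impI)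
    fix R assume "max R1 1 \<le> R"
    then have "R powr (5*\<beta> - 4) * Y R < \<eta>" using main[of R] \<epsilon>(3) by simp
    then show "dist (R powr (5*\<beta> - 4) * Y R) 0 < \<eta>" using Y_nonneg[of R] by simp
  qed
qed

lemma energy_ennreal:
  assumes "0 \<le> R"
  shows "(\<integral>\<^sup>+ x. indicator (OmR R) x * ennreal (grad_sq u x) \<partial>lborel) = ennreal (Y R)"
proof -
  have "(\<integral>\<^sup>+ x. indicator (OmR R) x * ennreal (grad_sq u x) \<partial>lborel)
     = (\<integral>\<^sup>+ x. ennreal (indicator (OmR R) x * grad_sq u x) \<partial>lborel)"
    by (intro nn_integral_cong) (auto simp: indicator_def)
  also have "\<dots> = ennreal (Y R)"
    unfolding Y_def using grad_sq_nonneg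
    by (intro nn_integral_eq_integral nice_cylinder nice_grad_sq assms) auto
  finally show ?thesis .
qed

text \<open>Zero energy makes the gradient vanish almost everywhere, and then everywhere by
  continuity, because a nonempty open set is not null. The column bound \<open>w_sq_bound\<close>
  then yields u = 0 directly, with no detour through constancy on a connected set.\<close>

lemma zero_energy_imp_zero:
  assumes Y: "\<And>R. 0 \<le> R \<Longrightarrow> Y R = 0" and x: "x \<in> Om"
  shows "u x = 0"
proof -
  have g0: "grad_sq u y = 0" if y: "y \<in> Om" for y
  proof (rule ccontr)
    assume "grad_sq u y \<noteq> 0"
    then have gy: "grad_sq u y > 0" using grad_sq_nonneg[of y] by linarith
    define R where "R = rad y + 1"
    have R0: "0 \<le> R" by (simp add: R_def)
    define V where "V = {z \<in> OmR R. grad_sq u z \<in> {0<..}}"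
    have yV: "y \<in> V" using y gy by (simp add: V_def R_def OmR_eq)
    have "open V"
      using continuous_open_preimage[OF continuous_on_subset[OF continuous_grad_sq OmR_subset] open_OmR, of "{0<..}" R]
      by (simp add: V_def vimage_def Int_def)
    have i: "integrable lborel (\<lambda>x. indicator (OmR R) x * grad_sq u x)" by (rule nice_cylinder[OF nice_grad_sq R0])
    have "AE z in lborel. indicator (OmR R) z * grad_sq u z = 0"
      using integral_nonneg_eq_0_iff_AE[OF i] Y[OF R0] grad_sq_nonneg by (simp add: Y_def)
    then have "AE z in lborel. z \<notin> V" by (rule AE_mp) (auto simp: V_def)
    moreover have "V \<in> sets lborel" using \<open>open V\<close> by simp
    ultimately have "V \<in> null_sets lborel" by (simp add: AE_iff_null_sets)
    then have "negligible V" by (simp add: negligible_iff_null_sets null_sets_completionI)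
    then show False using open_not_negligible[OF \<open>open V\<close>] yV by auto
  qed
  define q where "q = (x$1, x$2)"
  have xq: "x = vec3 (q, x$3)" by (simp add: q_def)
  have "D q = 0"
  proof -
    have "indicator Om (vec3 (q, s)) * grad_sq u (vec3 (q, s)) = (0::real)" for s
      using g0[of "vec3 (q, s)"] by (auto simp: indicator_def)
    then have "(\<lambda>s. indicator Om (vec3 (q, s)) * grad_sq u (vec3 (q, s)) :: real) = (\<lambda>s. 0)" by (rule ext)
    then show ?thesis unfolding vint_def by (simp only: Bochner_Integration.integral_zero)
  qed
  then have "(w x)\<^sup>2 \<le> 0" using w_sq_bound[of q "f2 (norm q) - f1 (norm q)" "x$3"] xq by simp
  then have "w x = 0" by simp
  then show ?thesis using x by (simp add: w_def U_on)
qed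

end

theorem theorem1p1:
  fixes f1 f2 f1' f2' :: "real \<Rightarrow> real"
    and u :: "real^3 \<Rightarrow> real^3" and P :: "real^3 \<Rightarrow> real"
    and \<gamma> C \<beta> :: real
  assumes sm1: "smooth_nonneg f1" and sm2: "smooth_nonneg f2"
    and d1: "\<And>r. r \<ge> 0 \<Longrightarrow> (f1 has_real_derivative f1' r) (at r within {0..})"
    and d2: "\<And>r. r \<ge> 0 \<Longrightarrow> (f2 has_real_derivative f2' r) (at r within {0..})"
    and gap: "\<exists>\<delta>>0. \<forall>r\<ge>0. f2 r - f1 r \<ge> \<delta>"
    and gam: "\<gamma> = max (SUP r\<in>{0..}. \<bar>f1' r\<bar>) (SUP r\<in>{0..}. \<bar>f2' r\<bar>)"
    and gam_fin: "bdd_above ((\<lambda>r. \<bar>f1' r\<bar>) ` {0..}) \<and> bdd_above ((\<lambda>r. \<bar>f2' r\<bar>) ` {0..})"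
    and Cpos: "C > 0" and \<beta>nn: "\<beta> \<ge> 0"
    and growth: "\<And>r. r \<ge> 1 \<Longrightarrow> \<bar>f2 r - f1 r\<bar> \<le> C * r powr \<beta>"
    and u_smooth: "\<And>i. smooth_upto_boundary (domain f1 f2) (comp u i)"
    and u_cont: "continuous_on (closure (domain f1 f2)) u"
    and P_smooth: "smooth_on3 (domain f1 f2) P"
    and axi: "axisymmetric (domain f1 f2) u"
    and NS: "steady_NS (domain f1 f2) u P"
    and noslip1: "\<And>x. x$3 = f1 (rad x) \<Longrightarrow> u x = 0"
    and noslip2: "\<And>x. x$3 = f2 (rad x) \<Longrightarrow> u x = 0"
    and cond: "(\<beta> < 1/2 \<and>
          ((\<lambda>R. R powr (2*\<beta> - 1) *
               Sup ((\<lambda>z. norm (u (pt R 0 z))) ` {f1 R..f2 R})) \<longlongrightarrow> 0) at_top)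
        \<or> (\<beta> < 4/5 \<and>
          ((\<lambda>R. ennreal (R powr (5*\<beta> - 4)) *
               (\<integral>\<^sup>+ x. indicator (domain_R f1 f2 R) x * ennreal (grad_sq u x) \<partial>lborel))
             \<longlongrightarrow> 0) at_top)"
  shows "\<forall>x\<in>domain f1 f2. u x = 0"
proof -
  interpret axi_flow f1 f2 u P
  proof
    show "continuous_on {0..} f1" "continuous_on {0..} f2"
      using d1 d2 by (auto intro!: DERIV_continuous_on)
    show "f1 r < f2 r" if "r \<ge> 0" for r
    proof -
      obtain \<delta> where "\<delta> > 0" "\<forall>r\<ge>0. f2 r - f1 r \<ge> \<delta>" using gap by blast
      then show ?thesis using that by force
    qed
  qed (fact u_smooth u_cont P_smooth axi NS noslip1 noslip2)+
  have gr: "f2 r - f1 r \<le> C * r powr \<beta>" if "1 \<le> r" for r using growth[OF that] by simp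
  have \<beta>1: "\<beta> < 4/5" using cond by auto
  have lim: "((\<lambda>R. R powr (5*\<beta> - 4) * Y R) \<longlongrightarrow> 0) at_top"
    using cond
  proof
    assume "\<beta> < 1/2 \<and> ((\<lambda>R. R powr (2*\<beta> - 1) *
               Sup ((\<lambda>z. norm (u (pt R 0 z))) ` {f1 R..f2 R})) \<longlongrightarrow> 0) at_top"
    then show ?thesis using sup_decay_imp_energy_decay[OF Cpos \<beta>nn _ gr] by blast
  next
    assume "\<beta> < 4/5 \<and> ((\<lambda>R. ennreal (R powr (5*\<beta> - 4)) *
               (\<integral>\<^sup>+ x. indicator (domain_R f1 f2 R) x * ennreal (grad_sq u x) \<partial>lborel)) \<longlongrightarrow> 0) at_top"
    then have "((\<lambda>R. ennreal (R powr (5*\<beta> - 4)) *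
               (\<integral>\<^sup>+ x. indicator (OmR R) x * ennreal (grad_sq u x) \<partial>lborel)) \<longlongrightarrow> 0) at_top" by blast
    \<comment> \<open>The energy of every truncated domain is finite, so the extended nonnegative
      limit in the hypothesis becomes a limit of real numbers.\<close>
    moreover have "\<forall>\<^sub>F R in at_top. ennreal (R powr (5*\<beta> - 4)) *
        (\<integral>\<^sup>+ x. indicator (OmR R) x * ennreal (grad_sq u x) \<partial>lborel) = ennreal (R powr (5*\<beta> - 4) * Y R)"
      using eventually_ge_at_top[of 0]
      by (rule eventually_mono) (simp add: energy_ennreal ennreal_mult Y_nonneg)
    ultimately have "((\<lambda>R. ennreal (R powr (5*\<beta> - 4) * Y R)) \<longlongrightarrow> ennreal 0) at_top"
      by (simp add: tendsto_cong)
    then show ?thesis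
      by (rule tendsto_ennrealD) (auto intro!: always_eventually simp: Y_nonneg)
  qed
  have "Y R = 0" if "0 \<le> R" for R
    by (rule energy_vanishes[where f="\<lambda>r. f2 r - f1 r", OF Y_mono Y_nonneg annulus_inequality _ Cpos \<beta>nn \<beta>1 gr lim that]) auto
  then show ?thesis using zero_energy_imp_zero by blast
qed

end
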